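(* Let $F$ be a differential field of characteristic zero with algebraically closed field of constants $C$, and let $n\ge 1$. Let $Y_{ij}$, $1\le i,j\le n$, be differential indeterminates over $F$, let $F\langle Y_{ij}\rangle$ be the differential quotient field of the differential polynomial ring $F\{Y_{ij}\}$, and let $X_{ij}$, $1\le i,j\le n$, be algebraically independent over $F\langle Y_{ij}\rangle$. Equip $F\langle Y_{ij}\rangle(X_{ij})$ with the derivation extending that of $F\langle Y_{ij}\rangle$ and satisfying $D(X_{ij})=\sum_{\ell=1}^n Y_{i\ell}X_{\ell j}$. Then $F\langle Y_{ij}\rangle(X_{ij})\supset F\langle Y_{ij}\rangle$ is a generic Picard-Vessiot extension of $F$ with differential Galois group $\mathrm{GL}_n(C)$. That is: (i) $F\langle Y_{ij}\rangle(X_{ij})\supset F\langle Y_{ij}\rangle$ is a Picard-Vessiot extension with differential Galois group $\mathrm{GL}_n(C)$; and (ii) every Picard-Vessiot extension $E\supseteq F$ with differential Galois group $\mathrm{GL}_n(C)$ can be obtained from it by a specialization $Y_{ij}\mapsto f_{ij}$ with $f_{ij}\in F$.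
   Context: A differential field extension $E\supseteq K$, where $K$ has characteristic zero and algebraically closed field of constants $C$, is a Picard-Vessiot extension if it is generated as a differential field over $K$ by the full set $V$ of solutions in $E$ of a monic linear homogeneous differential equation over $K$ of order $\dim_C V$, and $E$ has the same field of constants as $K$ (no new constants). Its differential Galois group $G(E/K)$ is the group of differential automorphisms of $E$ over $K$. $\mathrm{GL}_n(C)$ acts on $F\langle Y_{ij}\rangle(X_{ij})$, which is the function field of the group obtained from $\mathrm{GL}_n(C)$ by extending scalars to $F\langle Y_{ij}\rangle$, by fixing $F\langle Y_{ij}\rangle$ and multiplying the matrix $[X_{ij}]$ on the right by elements of $\mathrm{GL}_n(C)$. "Obtained by the specialization $Y_{ij}\mapsto f_{ij}$" means: $E$ is isomorphic over $F$, as a differential field, to the field $F(X_{ij})$ of rational functions in the $n^2$ algebraically independent variables $X_{ij}$ with the derivation that extends the derivation of $F$ and satisfies $D(X_{ij})=\sum_{\ell=1}^n f_{i\ell}X_{\ell j}$. *)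

theory Defs
  imports
    "HOL-Library.Poly_Mapping"
    "HOL-Library.Product_Lexorder"
    "HOL-Computational_Algebra.Fraction_Field"
    "HOL-Analysis.Determinants"
    "Jordan_Normal_Form.Determinant"
begin

no_notation vec_index (infixl "$" 100)

type_synonym ('a, 'n) sqmat = "(('a, 'n) Finite_Cartesian_Product.vec, 'n) Finite_Cartesian_Product.vec"

section \<open>Differential fields\<close>

definition derivation :: "('a::comm_ring_1 \<Rightarrow> 'a) \<Rightarrow> bool" where
  "derivation D \<longleftrightarrow>
     (\<forall>x y. D (x + y) = D x + D y) \<and> (\<forall>x y. D (x * y) = D x * y + x * D y)"

definition constants :: "('a::zero \<Rightarrow> 'a) \<Rightarrow> 'a set" where
  "constants D = {c. D c = 0}"

text \<open>The relative version, for a subfield \<open>C\<close> of the ambient field, of the class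
  \<open>alg_closed_field\<close>.\<close>

definition algebraically_closed_subfield :: "'a::field set \<Rightarrow> bool" where
  "algebraically_closed_subfield C \<longleftrightarrow>
     (\<forall>p. (\<forall>i. coeff p i \<in> C) \<and> degree p > 0 \<longrightarrow> (\<exists>x\<in>C. poly p x = 0))"

definition differential_subfield :: "('a::field \<Rightarrow> 'a) \<Rightarrow> 'a set \<Rightarrow> bool" where
  "differential_subfield D S \<longleftrightarrow>
     0 \<in> S \<and> 1 \<in> S \<and>
     (\<forall>x\<in>S. \<forall>y\<in>S. x + y \<in> S \<and> x - y \<in> S \<and> x * y \<in> S) \<and>
     (\<forall>x\<in>S. inverse x \<in> S \<and> D x \<in> S)"

text \<open>A differential field extension \<open>E \<supseteq> K\<close> is given by an embedding \<open>\<iota>\<close> of \<open>K\<close> into \<open>E\<close>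
  which commutes with the derivations.\<close>

definition differential_extension ::
  "('k::field \<Rightarrow> 'k) \<Rightarrow> ('e::field \<Rightarrow> 'e) \<Rightarrow> ('k \<Rightarrow> 'e) \<Rightarrow> bool" where
  "differential_extension DK DE \<iota> \<longleftrightarrow>
     derivation DK \<and> derivation DE \<and> field_hom \<iota> \<and> (\<forall>x. DE (\<iota> x) = \<iota> (DK x))"


section \<open>Picard--Vessiot extensions\<close>

text \<open>The solutions in \<open>E\<close> of \<open>D\<^sup>m y + a\<^sub>m\<^sub>-\<^sub>1 D\<^sup>m\<^sup>-\<^sup>1 y + \<dots> + a\<^sub>0 y = 0\<close> with coefficients in \<open>K\<close>.\<close>

definition ode_solutions ::
  "('e::field \<Rightarrow> 'e) \<Rightarrow> ('k \<Rightarrow> 'e) \<Rightarrow> nat \<Rightarrow> (nat \<Rightarrow> 'k) \<Rightarrow> 'e set" where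
  "ode_solutions DE \<iota> m a = {y. (DE ^^ m) y + (\<Sum>i<m. \<iota> (a i) * (DE ^^ i) y) = 0}"

definition basis_over ::
  "'k::field set \<Rightarrow> ('k \<Rightarrow> 'e::field) \<Rightarrow> nat \<Rightarrow> (nat \<Rightarrow> 'e) \<Rightarrow> 'e set \<Rightarrow> bool" where
  "basis_over C \<iota> m y V \<longleftrightarrow>
     V = {\<Sum>i<m. \<iota> (c i) * y i | c. \<forall>i<m. c i \<in> C} \<and>
     (\<forall>c. (\<forall>i<m. c i \<in> C) \<and> (\<Sum>i<m. \<iota> (c i) * y i) = 0 \<longrightarrow> (\<forall>i<m. c i = 0))"

text \<open>\<open>y\<^sub>0, \<dots>, y\<^sub>m\<^sub>-\<^sub>1\<close> is a basis over the constants of the full solution space \<open>V\<close> of some monic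
  linear homogeneous equation of order \<open>m = dim V\<close>, and \<open>V\<close> generates \<open>E\<close> over \<open>K\<close> as a
  differential field.\<close>

definition fundamental_system ::
  "('k::field \<Rightarrow> 'k) \<Rightarrow> ('e::field \<Rightarrow> 'e) \<Rightarrow> ('k \<Rightarrow> 'e) \<Rightarrow> nat \<Rightarrow> (nat \<Rightarrow> 'e) \<Rightarrow> bool" where
  "fundamental_system DK DE \<iota> m y \<longleftrightarrow>
     (\<exists>a. basis_over (constants DK) \<iota> m y (ode_solutions DE \<iota> m a) \<and>
          differential_subfield DE hull (range \<iota> \<union> ode_solutions DE \<iota> m a) = UNIV)"

definition picard_vessiot ::
  "('k::field \<Rightarrow> 'k) \<Rightarrow> ('e::field \<Rightarrow> 'e) \<Rightarrow> ('k \<Rightarrow> 'e) \<Rightarrow> bool" where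
  "picard_vessiot DK DE \<iota> \<longleftrightarrow>
     differential_extension DK DE \<iota> \<and>
     CHAR('k) = 0 \<and> algebraically_closed_subfield (constants DK) \<and>
     (\<exists>m y. fundamental_system DK DE \<iota> m y) \<and>
     constants DE = \<iota> ` constants DK"


section \<open>The differential Galois group as an algebraic group\<close>

definition galois_group :: "('e::field \<Rightarrow> 'e) \<Rightarrow> ('k \<Rightarrow> 'e) \<Rightarrow> ('e \<Rightarrow> 'e) set" where
  "galois_group DE \<iota> =
     {\<sigma>. field_hom \<sigma> \<and> bij \<sigma> \<and> (\<forall>x. \<sigma> (DE x) = DE (\<sigma> x)) \<and> (\<forall>x. \<sigma> (\<iota> x) = \<iota> x)}"

text \<open>The matrix \<open>c\<close> of \<open>\<sigma>\<close> on the solution space: \<open>\<sigma>(y\<^sub>j) = \<Sum>\<^sub>i c\<^sub>i\<^sub>j y\<^sub>i\<close> with constants \<open>c\<^sub>i\<^sub>j\<close>.\<close>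

definition galois_matrix ::
  "('k::field \<Rightarrow> 'k) \<Rightarrow> ('k \<Rightarrow> 'e::field) \<Rightarrow> nat \<Rightarrow> (nat \<Rightarrow> 'e) \<Rightarrow> ('e \<Rightarrow> 'e) \<Rightarrow> 'k Matrix.mat" where
  "galois_matrix DK \<iota> m y \<sigma> =
     (THE A. A \<in> carrier_mat m m \<and> (\<forall>i<m. \<forall>j<m. A $$ (i, j) \<in> constants DK) \<and>
             (\<forall>j<m. \<sigma> (y j) = (\<Sum>i<m. \<iota> (A $$ (i, j)) * y i)))"

inductive_set function_algebra :: "'k::comm_ring_1 set \<Rightarrow> ('g \<Rightarrow> 'k) set \<Rightarrow> ('g \<Rightarrow> 'k) set"
  for C :: "'k set" and S :: "('g \<Rightarrow> 'k) set" where
  const: "c \<in> C \<Longrightarrow> (\<lambda>_. c) \<in> function_algebra C S"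
| gen: "s \<in> S \<Longrightarrow> s \<in> function_algebra C S"
| add: "p \<in> function_algebra C S \<Longrightarrow> q \<in> function_algebra C S
        \<Longrightarrow> (\<lambda>x. p x + q x) \<in> function_algebra C S"
| mult: "p \<in> function_algebra C S \<Longrightarrow> q \<in> function_algebra C S
        \<Longrightarrow> (\<lambda>x. p x * q x) \<in> function_algebra C S"

text \<open>\<open>f\<close> is on \<open>H\<close> a polynomial over \<open>C\<close> in the functions of \<open>S\<close>; its values outside \<open>H\<close> are
  irrelevant.\<close>

definition regular_on ::
  "'g set \<Rightarrow> 'k::comm_ring_1 set \<Rightarrow> ('g \<Rightarrow> 'k) set \<Rightarrow> ('g \<Rightarrow> 'k) \<Rightarrow> bool" where
  "regular_on H C S f \<longleftrightarrow> (\<exists>p\<in>function_algebra C S. \<forall>x\<in>H. f x = p x)"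

text \<open>The coordinate ring of a linear group is generated by the matrix entries and the inverse of
  the determinant.\<close>

definition galois_coordinates ::
  "('k::field \<Rightarrow> 'k) \<Rightarrow> ('k \<Rightarrow> 'e::field) \<Rightarrow> nat \<Rightarrow> (nat \<Rightarrow> 'e) \<Rightarrow> (('e \<Rightarrow> 'e) \<Rightarrow> 'k) set" where
  "galois_coordinates DK \<iota> m y =
     {\<lambda>\<sigma>. galois_matrix DK \<iota> m y \<sigma> $$ (i, j) | i j. i < m \<and> j < m} \<union>
     {\<lambda>\<sigma>. inverse (Determinant.det (galois_matrix DK \<iota> m y \<sigma>))}"

definition GL :: "'k::field set \<Rightarrow> ('k, 'n::finite) sqmat set" where
  "GL C = {g. (\<forall>i j. g $ i $ j \<in> C) \<and> Determinants.det g \<noteq> 0}"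

definition GL_coordinates :: "(('k::field, 'n::finite) sqmat \<Rightarrow> 'k) set" where
  "GL_coordinates =
     {\<lambda>g. g $ i $ j | i j. True} \<union> {\<lambda>g. inverse (Determinants.det g)}"

text \<open>\<open>\<phi>\<close> is an isomorphism of algebraic groups from \<open>GL\<^sub>n(C)\<close> onto the differential Galois group of
  \<open>E\<close> over \<open>K\<close>, where \<open>C\<close> is the field of constants of \<open>K\<close> (a separate argument, so that for an extension of
  \<open>F\<langle>Y\<^sub>i\<^sub>j\<rangle>\<close> it can be given as the copy in \<open>F\<langle>Y\<^sub>i\<^sub>j\<rangle>\<close> of the constants of \<open>F\<close>): an isomorphism of groups under which the
  regular functions on both sides correspond.  A mere isomorphism of abstract groups would be too
  weak (for suitable \<open>C\<close>, the abstract groups \<open>C\<^sup>\<times>\<close> and \<open>C\<^sup>\<times> \<times> C\<close> are isomorphic).  The algebraic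
  structure on the Galois group comes from its action on a solution space generating \<open>E\<close>; it does
  not depend on which one is taken.\<close>

definition GL_galois_iso ::
  "('k::field \<Rightarrow> 'k) \<Rightarrow> ('e::field \<Rightarrow> 'e) \<Rightarrow> ('k \<Rightarrow> 'e) \<Rightarrow> 'k set \<Rightarrow>
   (('k, 'n::finite) sqmat \<Rightarrow> 'e \<Rightarrow> 'e) \<Rightarrow> bool" where
  "GL_galois_iso DK DE \<iota> C \<phi> \<longleftrightarrow>
     bij_betw \<phi> (GL C) (galois_group DE \<iota>) \<and>
     (\<forall>g\<in>GL C. \<forall>h\<in>GL C. \<phi> (g ** h) = \<phi> g \<circ> \<phi> h) \<and>
     (\<exists>m y. fundamental_system DK DE \<iota> m y \<and>
        (\<forall>f. regular_on (galois_group DE \<iota>) (constants DK) (galois_coordinates DK \<iota> m y) f \<longleftrightarrow>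
             regular_on (GL C) C GL_coordinates (f \<circ> \<phi>)))"


section \<open>Rational function fields and the generic extension\<close>

text \<open>The order on the variables is only there because the library needs it to make a polynomial
  ring an integral domain; a finite index type can always be ordered.\<close>

type_synonym ('v, 'a) ratfun = "(('v \<Rightarrow>\<^sub>0 nat) \<Rightarrow>\<^sub>0 'a) fract"

definition ratconst :: "'a::field \<Rightarrow> ('v::linorder, 'a) ratfun" where
  "ratconst a = Fract (Poly_Mapping.single 0 a) 1"

definition ratvar :: "'v::linorder \<Rightarrow> ('v, 'a::field) ratfun" where
  "ratvar v = Fract (Poly_Mapping.single (Poly_Mapping.single v 1) 1) 1"

text \<open>The unique derivation which extends \<open>D\<close> and takes the variable \<open>v\<close> to \<open>w v\<close>.\<close>

definition extend_derivation ::
  "('a::field \<Rightarrow> 'a) \<Rightarrow> ('v::linorder \<Rightarrow> ('v, 'a) ratfun) \<Rightarrow> ('v, 'a) ratfun \<Rightarrow> ('v, 'a) ratfun" where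
  "extend_derivation D w =
     (THE d. derivation d \<and> (\<forall>a. d (ratconst a) = ratconst (D a)) \<and> (\<forall>v. d (ratvar v) = w v))"

text \<open>The differential field \<open>F\<langle>Y\<^sub>i\<^sub>j\<rangle>\<close>; the variable \<open>(i, j, k)\<close> is the \<open>k\<close>-th derivative of \<open>Y\<^sub>i\<^sub>j\<close>.\<close>

type_synonym ('n, 'a) diff_ratfun = "('n \<times> 'n \<times> nat, 'a) ratfun"

definition diff_indet_derivation ::
  "('a::field \<Rightarrow> 'a) \<Rightarrow> ('n::linorder, 'a) diff_ratfun \<Rightarrow> ('n, 'a) diff_ratfun" where
  "diff_indet_derivation D = extend_derivation D (\<lambda>(i, j, k). ratvar (i, j, Suc k))"

definition diff_indet_matrix :: "(('n, 'a::field) diff_ratfun, 'n::{finite, linorder}) sqmat" where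
  "diff_indet_matrix = (\<chi> i j. ratvar (i, j, 0))"

text \<open>The derivation on \<open>K(X\<^sub>i\<^sub>j)\<close> which extends \<open>D\<close> and satisfies \<open>X' = A X\<close>.\<close>

definition matrix_derivation ::
  "('k::field \<Rightarrow> 'k) \<Rightarrow> ('k, 'n::{finite, linorder}) sqmat \<Rightarrow>
   ('n \<times> 'n, 'k) ratfun \<Rightarrow> ('n \<times> 'n, 'k) ratfun" where
  "matrix_derivation D A =
     extend_derivation D (\<lambda>(i, j). \<Sum>l\<in>UNIV. ratconst (A $ i $ l) * ratvar (l, j))"

text \<open>The differential field \<open>E\<close> is isomorphic over \<open>F\<close> to \<open>F(X\<^sub>i\<^sub>j)\<close> with \<open>X' = A X\<close>, i.e. it is
  obtained by the specialization \<open>Y\<^sub>i\<^sub>j \<mapsto> A\<^sub>i\<^sub>j\<close>.\<close>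

definition obtained_by_specialization ::
  "('f::field \<Rightarrow> 'f) \<Rightarrow> ('e::field \<Rightarrow> 'e) \<Rightarrow> ('f \<Rightarrow> 'e) \<Rightarrow> ('f, 'n::{finite, linorder}) sqmat \<Rightarrow> bool" where
  "obtained_by_specialization D DE \<iota> A \<longleftrightarrow>
     (\<exists>\<psi> :: ('n \<times> 'n, 'f) ratfun \<Rightarrow> 'e. field_hom \<psi> \<and> bij \<psi> \<and>
        (\<forall>z. \<psi> (matrix_derivation D A z) = DE (\<psi> z)) \<and>
        (\<forall>a. \<psi> (ratconst a) = \<iota> a))"

end

theory Submission
  imports Defs
begin

text \<open>(i) Commuting the partial derivatives with respect to \<open>Y\<^sub>i\<^sub>j\<^sup>(\<^sup>k\<^sup>)\<close> with the derivation shows, by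
  descending induction on \<open>k\<close>, that a constant of \<open>F\<langle>Y\<rangle>(X)\<close> involves no \<open>Y\<^sub>i\<^sub>j\<^sup>(\<^sup>k\<^sup>)\<close>; the commutator for
  \<open>k = 0\<close> then kills the partial derivatives with respect to \<open>X\<^sub>i\<^sub>j\<close> as well, because \<open>X\<close> is invertible.
  So there are no new constants, and for a differential automorphism \<open>\<sigma>\<close> the matrix \<open>X\<^sup>-\<^sup>1 \<sigma>(X)\<close> lies in
  \<open>GL\<^sub>n(C)\<close>.  The first row of \<open>X\<close> consists of solutions of a scalar equation of order \<open>n\<close>, since the
  first unit vector is cyclic for \<open>v \<mapsto> v' + v Y\<close>.

  (ii) In a Picard--Vessiot extension \<open>E\<close> the base field is the fixed field of the Galois group: if
  \<open>a \<notin> K\<close>, then \<open>1 \<otimes> a - a \<otimes> 1\<close> is not nilpotent in \<open>E \<otimes>\<^sub>K E\<close>, and the Nullstellensatz for the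
  finitely generated algebra of constants \<open>C[Y\<^sup>-\<^sup>1 \<otimes> Y, Y \<otimes> Y\<^sup>-\<^sup>1]\<close>, where \<open>Y\<close> is the Wronskian matrix,
  yields an automorphism which moves \<open>a\<close>.  If the group is \<open>GL\<^sub>n(C)\<close> as an algebraic group, then
  Hilbert 90 gives an invertible matrix \<open>X\<close> over \<open>E\<close> with \<open>\<sigma>(X) = X \<sigma>\<close> for all \<open>\<sigma>\<close>.  The entries of
  \<open>A = X' X\<^sup>-\<^sup>1\<close> are fixed, hence in \<open>F\<close>; the entries of \<open>X\<close> are algebraically independent because the
  ideal of their relations is stable under \<open>GL\<^sub>n(C)\<close>, hence under all partial derivatives; and they
  generate \<open>E\<close>, because only the identity fixes \<open>X\<close>.\<close>

section \<open>Derivations and multivariate polynomials\<close>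

text \<open>In (ii) nothing is known about E beyond its group. That the isomorphism is algebraic
  matters because the entries of its inverse become functions \<Sum> e \<sigma>(x) on the Galois
  group, and for such functions semilinear independence turns the cocycle identity into matrices
  over E. The fixed field theorem is needed twice: over F, to bring A into F, and over F(X), to see
  that X generates E. It is therefore proved for a system Y' = A Y over any base containing the
  constants of E, not for a scalar equation. Its core is that E and the constants of the tensor
  square are linearly disjoint over C, so that a C-valued point of the algebra B of constants
  extends to a specialisation E . B -> E compatible with the derivations. A point can avoid the
  zeros only of a non-nilpotent element, which is why nilpotents have to be excluded. The induced
  map sends finite-dimensional spaces of polynomials in Y onto themselves, and counting dimensions
  makes it injective. In (i), partial derivatives are the witnesses throughout, for the independence
  of vectors, the invertibility of X and the absence of new constants.\<close>

context
  fixes D :: "'a::comm_ring_1 \<Rightarrow> 'a"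
  assumes D: "derivation D"
begin

lemma derivation_add: "D (x + y) = D x + D y"
  using D by (auto simp: derivation_def)

lemma derivation_mult: "D (x * y) = D x * y + x * D y"
  using D by (auto simp: derivation_def)

lemma derivation_zero: "D 0 = 0"
  using derivation_add[of 0 0] by simp

lemma derivation_one: "D 1 = 0"
  using derivation_mult[of 1 1] by simp

lemma derivation_minus: "D (- x) = - D x"
  using derivation_add[of x "- x"] derivation_zero by (simp add: eq_neg_iff_add_eq_0 add.commute)

lemma derivation_diff: "D (x - y) = D x - D y"
  using derivation_add[of x "- y"] derivation_minus[of y] by simp

lemma derivation_sum: "D (sum f A) = (\<Sum>x\<in>A. D (f x))"
  by (induct A rule: infinite_finite_induct) (auto simp: derivation_zero derivation_add)

end

lemma derivation_inverse:
  fixes D :: "'a::field \<Rightarrow> 'a"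
  assumes D: "derivation D"
  shows "D (inverse x) = - D x * inverse x * inverse x"
proof (cases "x = 0")
  case False
  have "0 = D (x * inverse x)"
    using False by (simp add: derivation_one[OF D])
  also have "\<dots> = D x * inverse x + x * D (inverse x)"
    by (rule derivation_mult[OF D])
  finally have "x * D (inverse x) = - (D x * inverse x)"
    by (simp add: eq_neg_iff_add_eq_0 add.commute)
  then have "inverse x * (x * D (inverse x)) = inverse x * (- (D x * inverse x))" by simp
  then show ?thesis using False by (simp add: field_simps)
qed (simp add: derivation_zero[OF D])

section \<open>Multivariate polynomials and their evaluation\<close>

definition pconst :: "'a::zero \<Rightarrow> ('v \<Rightarrow>\<^sub>0 nat) \<Rightarrow>\<^sub>0 'a" where
  "pconst a = Poly_Mapping.single 0 a"

definition pvar :: "'v \<Rightarrow> ('v \<Rightarrow>\<^sub>0 nat) \<Rightarrow>\<^sub>0 'a::zero_neq_one" where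
  "pvar v = Poly_Mapping.single (Poly_Mapping.single v 1) 1"

lemma comm_ring_hom_pconst: "comm_ring_hom (pconst :: 'a::comm_ring_1 \<Rightarrow> ('v \<Rightarrow>\<^sub>0 nat) \<Rightarrow>\<^sub>0 'a)"
  by unfold_locales (auto simp: pconst_def single_add mult_single)

lemma pvar_mult_single:
  "pvar v * Poly_Mapping.single \<alpha> c = Poly_Mapping.single (Poly_Mapping.single v 1 + \<alpha>) (c::'a::comm_ring_1)"
  by (simp add: pvar_def mult_single)

lemma exponent_induct [case_names zero add_var]:
  fixes \<alpha> :: "'v \<Rightarrow>\<^sub>0 nat"
  assumes "P 0" and step: "\<And>v \<alpha>. P \<alpha> \<Longrightarrow> P (Poly_Mapping.single v 1 + \<alpha>)"
  shows "P \<alpha>"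
proof (induct \<alpha> rule: update_induct)
  case const
  show ?case by fact
next
  case (update f v n)
  have "P (f + Poly_Mapping.single v k)" for k
  proof (induct k)
    case 0
    show ?case using update by simp
  next
    case (Suc k)
    have "f + Poly_Mapping.single v (Suc k) = Poly_Mapping.single v 1 + (f + Poly_Mapping.single v k)"
      by (rule poly_mapping_eqI) (auto simp: lookup_add lookup_single when_def)
    then show ?case using step[OF Suc] by simp
  qed
  moreover have "Poly_Mapping.update v n f = f + Poly_Mapping.single v n"
    using update by (intro poly_mapping_eqI) (auto simp: lookup_add lookup_single lookup_update when_def in_keys_iff)
  ultimately show ?case by simp
qed

lemma mpoly_sum_singles:
  fixes p :: "'b \<Rightarrow>\<^sub>0 'a::comm_monoid_add"
  shows "p = (\<Sum>\<alpha>\<in>Poly_Mapping.keys p. Poly_Mapping.single \<alpha> (Poly_Mapping.lookup p \<alpha>))"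
  by (rule poly_mapping_eqI) (simp add: lookup_sum lookup_single when_def in_keys_iff)

lemma mpoly_single_induct [case_names single add]:
  fixes p :: "'b \<Rightarrow>\<^sub>0 'a::comm_monoid_add"
  assumes "\<And>\<alpha> c. P (Poly_Mapping.single \<alpha> c)" "\<And>p q. P p \<Longrightarrow> P q \<Longrightarrow> P (p + q)"
  shows "P p"
proof -
  have "P (\<Sum>\<alpha>\<in>A. Poly_Mapping.single \<alpha> (Poly_Mapping.lookup p \<alpha>))" if "finite A" for A
    using that
  proof induct
    case empty
    show ?case using assms(1)[of undefined 0] by simp
  qed (auto intro: assms)
  from this[OF finite_keys, of p] show ?thesis by (simp flip: mpoly_sum_singles)
qed

lemma mpoly_induct [case_names const add var]:
  fixes p :: "('v \<Rightarrow>\<^sub>0 nat) \<Rightarrow>\<^sub>0 'a::comm_ring_1"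
  assumes const: "\<And>c. P (pconst c)" and add: "\<And>p q. P p \<Longrightarrow> P q \<Longrightarrow> P (p + q)"
    and var: "\<And>v p. P p \<Longrightarrow> P (pvar v * p)"
  shows "P p"
proof (induct p rule: mpoly_single_induct)
  case (single \<alpha> c)
  show ?case
  proof (induct \<alpha> rule: exponent_induct)
    case zero
    show ?case using const[of c] by (simp add: pconst_def)
  next
    case (add_var v \<alpha>)
    show ?case using var[OF add_var, of v] by (simp only: pvar_mult_single)
  qed
qed (rule add)

definition mono_eval :: "('v \<Rightarrow> 'r::comm_ring_1) \<Rightarrow> ('v \<Rightarrow>\<^sub>0 nat) \<Rightarrow> 'r" where
  "mono_eval x \<alpha> = (\<Prod>v\<in>Poly_Mapping.keys \<alpha>. x v ^ Poly_Mapping.lookup \<alpha> v)"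

lemma mono_eval_superset:
  assumes "finite S" "Poly_Mapping.keys \<alpha> \<subseteq> S"
  shows "mono_eval x \<alpha> = (\<Prod>v\<in>S. x v ^ Poly_Mapping.lookup \<alpha> v)"
  unfolding mono_eval_def by (rule prod.mono_neutral_left) (use assms in \<open>auto simp: in_keys_iff\<close>)

lemma mono_eval_add: "mono_eval x (\<alpha> + \<beta>) = mono_eval x \<alpha> * mono_eval x \<beta>"
proof -
  let ?S = "Poly_Mapping.keys \<alpha> \<union> Poly_Mapping.keys \<beta>"
  have "mono_eval x (\<alpha> + \<beta>) = (\<Prod>v\<in>?S. x v ^ Poly_Mapping.lookup (\<alpha> + \<beta>) v)"
    by (rule mono_eval_superset) (auto simp: keys_add)
  also have "\<dots> = (\<Prod>v\<in>?S. x v ^ Poly_Mapping.lookup \<alpha> v) * (\<Prod>v\<in>?S. x v ^ Poly_Mapping.lookup \<beta> v)"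
    by (simp add: lookup_add power_add prod.distrib)
  also have "\<dots> = mono_eval x \<alpha> * mono_eval x \<beta>"
    by (simp add: mono_eval_superset[of ?S \<alpha>] mono_eval_superset[of ?S \<beta>])
  finally show ?thesis .
qed

lemma mono_eval_zero [simp]: "mono_eval x 0 = 1"
  by (simp add: mono_eval_def)

lemma mono_eval_single [simp]: "mono_eval x (Poly_Mapping.single v 1) = x v"
  by (simp add: mono_eval_def)

text \<open>The coefficient map is arbitrary on purpose. Ring homomorphisms give evaluations, while
  merely K-linear maps give the functionals that define \<open>tensor_kernel\<close>; the facts in
  the next context therefore ask of \<phi> only additivity.\<close>

definition peval :: "('a \<Rightarrow> 'r) \<Rightarrow> ('v \<Rightarrow> 'r) \<Rightarrow> (('v \<Rightarrow>\<^sub>0 nat) \<Rightarrow>\<^sub>0 'a::zero) \<Rightarrow> 'r::comm_ring_1" where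
  "peval \<phi> x p = (\<Sum>\<alpha>\<in>Poly_Mapping.keys p. \<phi> (Poly_Mapping.lookup p \<alpha>) * mono_eval x \<alpha>)"

context
  fixes \<phi> :: "'a::comm_ring_1 \<Rightarrow> 'r::comm_ring_1"
  assumes zero: "\<phi> 0 = 0" and add: "\<And>a b. \<phi> (a + b) = \<phi> a + \<phi> b"
begin

lemma peval_superset:
  assumes "finite S" "Poly_Mapping.keys p \<subseteq> S"
  shows "peval \<phi> x p = (\<Sum>\<alpha>\<in>S. \<phi> (Poly_Mapping.lookup p \<alpha>) * mono_eval x \<alpha>)"
  unfolding peval_def by (rule sum.mono_neutral_left) (use assms zero in \<open>auto simp: in_keys_iff\<close>)

lemma peval_add: "peval \<phi> x (p + q) = peval \<phi> x p + peval \<phi> x q"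
proof -
  let ?S = "Poly_Mapping.keys p \<union> Poly_Mapping.keys q"
  have "peval \<phi> x (p + q) = (\<Sum>\<alpha>\<in>?S. \<phi> (Poly_Mapping.lookup (p + q) \<alpha>) * mono_eval x \<alpha>)"
    by (rule peval_superset) (auto simp: keys_add)
  also have "\<dots> = peval \<phi> x p + peval \<phi> x q"
    by (simp add: peval_superset[of ?S p] peval_superset[of ?S q] lookup_add add sum.distrib distrib_right)
  finally show ?thesis .
qed

lemma peval_single: "peval \<phi> x (Poly_Mapping.single \<alpha> c) = \<phi> c * mono_eval x \<alpha>"
  using zero by (cases "c = 0") (auto simp: peval_def)

lemma peval_pconst: "peval \<phi> x (pconst c) = \<phi> c"
  by (simp add: pconst_def peval_single)

lemma peval_pvar_mult: "peval \<phi> x (pvar v * p) = x v * peval \<phi> x p"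
proof (induct p rule: mpoly_single_induct)
  case (single \<alpha> c)
  show ?case unfolding pvar_mult_single peval_single mono_eval_add mono_eval_single by (simp add: mult_ac)
next
  case (add p q)
  then show ?case by (simp add: distrib_left peval_add)
qed

end

lemma comm_ring_hom_peval:
  assumes "comm_ring_hom \<phi>"
  shows "comm_ring_hom (peval \<phi> x)"
proof -
  interpret comm_ring_hom \<phi> by fact
  note [simp] = peval_add[of \<phi>, OF hom_zero hom_add] peval_pconst[of \<phi>, OF hom_zero hom_add]
    peval_pvar_mult[of \<phi>, OF hom_zero hom_add] peval_single[of \<phi>, OF hom_zero hom_add]
  have 1: "peval \<phi> x (pconst c * q) = \<phi> c * peval \<phi> x q" for c q
    by (induct q rule: mpoly_single_induct) (auto simp: pconst_def mult_single hom_mult mult_ac algebra_simps)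
  have "peval \<phi> x (p * q) = peval \<phi> x p * peval \<phi> x q" for p q
    by (induct p rule: mpoly_induct) (auto simp: 1 distrib_right mult.assoc)
  then show ?thesis
    by unfold_locales (simp_all add: peval_def[of \<phi> x 0] flip: pconst_def single_one)
qed

lemma peval_pvar:
  assumes "comm_ring_hom \<phi>"
  shows "peval \<phi> x (pvar v) = x v"
proof -
  interpret comm_ring_hom \<phi> by fact
  interpret e: comm_ring_hom "peval \<phi> x" by (rule comm_ring_hom_peval[OF assms])
  show ?thesis using peval_pvar_mult[of \<phi>, OF hom_zero hom_add, of x v 1] by (simp add: e.hom_one)
qed

section \<open>Dual numbers and the construction of derivations\<close>

datatype 'a dual = Dual (dual_re: 'a) (dual_eps: 'a)

instantiation dual :: (comm_ring_1) comm_ring_1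
begin

definition "0 = Dual 0 0"

definition "1 = Dual 1 0"

definition "x + y = Dual (dual_re x + dual_re y) (dual_eps x + dual_eps y)"

definition "- x = Dual (- dual_re x) (- dual_eps x)"

definition "x - y = Dual (dual_re x - dual_re y) (dual_eps x - dual_eps y)"

definition "x * y = Dual (dual_re x * dual_re y) (dual_eps x * dual_re y + dual_re x * dual_eps y)"
instance
  by standard (auto simp: zero_dual_def one_dual_def plus_dual_def uminus_dual_def minus_dual_def
      times_dual_def algebra_simps)
end

lemmas dual_defs = zero_dual_def one_dual_def plus_dual_def uminus_dual_def minus_dual_def times_dual_def

text \<open>A derivation along a ring homomorphism \<open>h\<close> is the \<open>\<epsilon>\<close>-part of a homomorphism \<open>h + \<epsilon> d\<close> into
  the dual numbers, so the universal property of polynomials produces derivations.\<close>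

lemma mpoly_derivation_along:
  fixes h :: "(('v \<Rightarrow>\<^sub>0 nat) \<Rightarrow>\<^sub>0 'a::comm_ring_1) \<Rightarrow> 'r::comm_ring_1"
  assumes h: "comm_ring_hom h"
    and add: "\<And>a b. D (a + b) = D a + D b"
    and mult: "\<And>a b. D (a * b) = D a * h (pconst b) + h (pconst a) * D b"
  shows "\<exists>d. (\<forall>p q. d (p + q) = d p + d q) \<and> (\<forall>p q. d (p * q) = d p * h q + h p * d q) \<and>
    (\<forall>a. d (pconst a) = D a) \<and> (\<forall>v. d (pvar v) = w v)"
proof -
  interpret h: comm_ring_hom h by fact
  interpret c: comm_ring_hom "pconst :: 'a \<Rightarrow> ('v \<Rightarrow>\<^sub>0 nat) \<Rightarrow>\<^sub>0 'a" by (rule comm_ring_hom_pconst)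
  have D0: "D 0 = 0" using add[of 0 0] by simp
  have D1: "D 1 = 0" using mult[of 1 1] by (simp add: c.hom_one)
  define \<phi> where "\<phi> a = Dual (h (pconst a)) (D a)" for a
  define x where "x v = Dual (h (pvar v)) (w v)" for v
  have \<phi>: "comm_ring_hom \<phi>"
    by unfold_locales (auto simp: \<phi>_def dual_defs D0 D1 add mult h.hom_add h.hom_mult c.hom_add c.hom_mult)
  interpret \<phi>: comm_ring_hom \<phi> by fact
  interpret e: comm_ring_hom "peval \<phi> x" by (rule comm_ring_hom_peval[OF \<phi>])
  have cc: "peval \<phi> x (pconst a) = \<phi> a" for a by (rule peval_pconst[of \<phi>, OF \<phi>.hom_zero \<phi>.hom_add])
  have vv: "peval \<phi> x (pvar v) = x v" for v by (rule peval_pvar[OF \<phi>])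
  have re_plus: "dual_re (a + b) = dual_re a + dual_re b" "dual_re (a * b) = dual_re a * dual_re b" for a b :: "'r dual"
    by (simp_all add: plus_dual_def times_dual_def)
  have re_\<phi>: "dual_re (\<phi> a) = h (pconst a)" "dual_re (x v) = h (pvar v)" for a v by (simp_all add: \<phi>_def x_def)
  have re: "dual_re (peval \<phi> x p) = h p" for p
    by (induct p rule: mpoly_induct)
      (simp_all add: cc vv e.hom_add e.hom_mult h.hom_add h.hom_mult re_plus re_\<phi>)
  have "dual_eps (peval \<phi> x (p * q)) = dual_eps (peval \<phi> x p) * h q + h p * dual_eps (peval \<phi> x q)" for p q
    by (simp add: e.hom_mult re[symmetric]) (simp add: times_dual_def)
  then show ?thesis
    by (intro exI[of _ "\<lambda>p. dual_eps (peval \<phi> x p)"])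
      (simp add: cc vv e.hom_add plus_dual_def, simp add: \<phi>_def x_def)
qed

corollary mpoly_derivation_exists:
  fixes D :: "'a::comm_ring_1 \<Rightarrow> 'a"
  assumes "derivation D"
  shows "\<exists>d :: (('v \<Rightarrow>\<^sub>0 nat) \<Rightarrow>\<^sub>0 'a) \<Rightarrow> _. derivation d \<and> (\<forall>a. d (pconst a) = pconst (D a)) \<and> (\<forall>v. d (pvar v) = w v)"
proof -
  have id: "comm_ring_hom (\<lambda>x. x :: ('v \<Rightarrow>\<^sub>0 nat) \<Rightarrow>\<^sub>0 'a)" by unfold_locales auto
  interpret c: comm_ring_hom "pconst :: 'a \<Rightarrow> ('v \<Rightarrow>\<^sub>0 nat) \<Rightarrow>\<^sub>0 'a" by (rule comm_ring_hom_pconst)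
  show ?thesis
    using mpoly_derivation_along[OF id, of "\<lambda>a. pconst (D a)" w]
    by (simp add: derivation_add[OF assms] derivation_mult[OF assms] c.hom_add c.hom_mult derivation_def)
qed

section \<open>Fraction fields\<close>

lemma comm_ring_hom_to_fract: "comm_ring_hom (\<lambda>p::'a::idom. Fract p 1)"
  by unfold_locales (auto simp: Zero_fract_def One_fract_def)

lemma Fract_eq_0_iff: "Fract (p::'a::idom) 1 = 0 \<longleftrightarrow> p = 0"
  unfolding Zero_fract_def by (simp only: eq_fract zero_neq_one[symmetric] not_False_eq_True; simp)

lemma fract_hom_lift:
  fixes h :: "'p::idom \<Rightarrow> 'e::field"
  assumes h: "comm_ring_hom h" and inj: "\<And>p. h p = 0 \<Longrightarrow> p = 0"
  shows "\<exists>H. field_hom H \<and> (\<forall>p. H (Fract p 1) = h p)"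
proof -
  interpret h: comm_ring_hom h by fact
  define H where "H z = (SOME y. \<exists>a b. b \<noteq> 0 \<and> z = Fract a b \<and> y = h a / h b)" for z
  have H: "H (Fract a b) = h a / h b" if "b \<noteq> 0" for a b
  proof -
    have "\<exists>y a' b'. b' \<noteq> 0 \<and> Fract a b = Fract a' b' \<and> y = h a' / h b'" using that by blast
    then have "\<exists>a' b'. b' \<noteq> 0 \<and> Fract a b = Fract a' b' \<and> H (Fract a b) = h a' / h b'"
      unfolding H_def by (rule someI_ex)
    then obtain a' b' where *: "b' \<noteq> 0" "Fract a b = Fract a' b'" "H (Fract a b) = h a' / h b'" by blast
    then have "a * b' = a' * b" using that by (simp add: eq_fract)
    then have "h a * h b' = h a' * h b" by (simp flip: h.hom_mult)
    moreover have "h b \<noteq> 0" "h b' \<noteq> 0" using inj that * by auto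
    ultimately show ?thesis unfolding *(3) by (simp add: divide_simps mult.commute)
  qed
  have nz: "b \<noteq> 0 \<Longrightarrow> h b \<noteq> 0" for b using inj by auto
  have "field_hom H"
    proof
      fix x y :: "'p fract"
      obtain a b where x: "x = Fract a b" "b \<noteq> 0" by (cases x)
      obtain c d where y: "y = Fract c d" "d \<noteq> 0" by (cases y)
      show "H (x + y) = H x + H y" "H (x * y) = H x * H y"
        using x y nz by (simp_all add: H h.hom_add h.hom_mult field_simps)
    qed (simp_all add: Zero_fract_def One_fract_def H)
  then show ?thesis by (intro exI[of _ H]) (simp add: H)
qed

text \<open>The quotient rule is well defined: assumption 1 says that a / b = a' / b', and
  assumption 2 is the derivative of 1.\<close>

lemma quotient_rule_unique:
  fixes a b :: "'a::field"
  assumes "b \<noteq> 0" "b' \<noteq> 0" and 1: "a * b' = a' * b" and 2: "da * b' + a * db' = da' * b + a' * db"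
  shows "(da' * b' - a' * db') / (b' * b') = (da * b - a * db) / (b * b)"
proof -
  have "(da * b - a * db) * (b' * b') = b * b' * (da * b' + a * db') - b * b' * a * db' - a * b' * (db * b')"
    by (simp add: algebra_simps)
  also have "\<dots> = b * b' * (da' * b + a' * db) - b * db' * (a * b') - a * b' * (db * b')"
    unfolding 2 by (simp add: algebra_simps)
  also have "\<dots> = (da' * b' - a' * db') * (b * b)" unfolding 1 by (simp add: algebra_simps)
  finally show ?thesis using assms(1,2) by (simp add: frac_eq_eq)
qed

lemma quotient_rule_add:
  fixes a b :: "'a::field"
  assumes "b \<noteq> 0" "b' \<noteq> 0"
  shows "((da * b' + a * db' + (da' * b + a' * db)) * (b * b') - (a * b' + a' * b) * (db * b' + b * db')) / (b * b' * (b * b'))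
    = (da * b - a * db) / (b * b) + (da' * b' - a' * db') / (b' * b')"
  using assms by (simp add: add_frac_eq) (simp add: frac_eq_eq algebra_simps)

lemma quotient_rule_mult:
  fixes a b :: "'a::field"
  assumes "b \<noteq> 0" "b' \<noteq> 0"
  shows "((da * a' + a * da') * (b * b') - a * a' * (db * b' + b * db')) / (b * b' * (b * b'))
    = (da * b - a * db) / (b * b) * (a' / b') + a / b * ((da' * b' - a' * db') / (b' * b'))"
  using assms by (simp add: add_frac_eq) (simp add: frac_eq_eq algebra_simps)

text \<open>\<open>d0\<close> takes values in the fraction field and not in the ring, because
  \<open>extend_derivation\<close> may send a variable to any rational function.\<close>

lemma fract_derivation_lift:
  fixes d0 :: "'p::idom \<Rightarrow> 'p fract"
  assumes add: "\<And>a b. d0 (a + b) = d0 a + d0 b"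
    and mult: "\<And>a b. d0 (a * b) = d0 a * Fract b 1 + Fract a 1 * d0 b"
  shows "\<exists>d. derivation d \<and> (\<forall>p. d (Fract p 1) = d0 p)"
proof -
  interpret t: comm_ring_hom "\<lambda>p::'p. Fract p 1" by (rule comm_ring_hom_to_fract)
  let ?t = "\<lambda>p::'p. Fract p 1"
  have nz: "b \<noteq> 0 \<Longrightarrow> ?t b \<noteq> 0" for b using Fract_eq_0_iff[of b] by blast
  have fr: "Fract a b = ?t a / ?t b" if "b \<noteq> 0" for a b using that by simp
  let ?f = "\<lambda>a b. (d0 a * ?t b - ?t a * d0 b) / (?t b * ?t b)"
  define d where "d z = (SOME y. \<exists>a b. b \<noteq> 0 \<and> z = Fract a b \<and> y = ?f a b)" for z
  have d: "d (Fract a b) = ?f a b" if b: "b \<noteq> 0" for a b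
  proof -
    have "\<exists>y a' b'. b' \<noteq> 0 \<and> Fract a b = Fract a' b' \<and> y = ?f a' b'" using that by blast
    then have "\<exists>a' b'. b' \<noteq> 0 \<and> Fract a b = Fract a' b' \<and> d (Fract a b) = ?f a' b'"
      unfolding d_def by (rule someI_ex)
    then obtain a' b' where *: "b' \<noteq> 0" "Fract a b = Fract a' b'" "d (Fract a b) = ?f a' b'" by blast
    then have eq: "a * b' = a' * b" using that by (simp add: eq_fract)
    have e1: "?t a * ?t b' = ?t a' * ?t b" using eq by (simp flip: t.hom_mult)
    have "d0 (a * b') = d0 (a' * b)" using eq by simp
    then have e2: "d0 a * ?t b' + ?t a * d0 b' = d0 a' * ?t b + ?t a' * d0 b" by (simp add: mult)
    note n = nz[OF b] nz[OF *(1)]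
    from *(3) show ?thesis using quotient_rule_unique[OF n e1 e2] by (rule trans)
  qed
  have dt: "d (?t p) = d0 p" for p
  proof -
    have one: "Fract 1 1 = (1 :: 'p fract)" by (rule One_fract_def[symmetric])
    have "d0 1 + d0 1 = d0 1 + 0" using mult[of 1 1] unfolding one by (simp only: mult_1_left mult_1_right add_0_right)
    then have "d0 1 = 0" by (rule add_left_imp_eq)
    then show ?thesis
      using d[of 1 p, OF one_neq_zero] unfolding one by (simp only: mult_1_right mult_zero_right diff_0_right div_by_1)
  qed
  have "derivation d"
  proof -
    have "d (x + y) = d x + d y \<and> d (x * y) = d x * y + x * d y" for x y
    proof -
      obtain a b where x: "x = Fract a b" "b \<noteq> 0" by (cases x)
      obtain a' b' where y: "y = Fract a' b'" "b' \<noteq> 0" by (cases y)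
      have bb: "b * b' \<noteq> 0" using x y by simp
      define A B A' B' where AB: "A = ?t a" "B = ?t b" "A' = ?t a'" "B' = ?t b'"
      have n: "B \<noteq> 0" "B' \<noteq> 0" unfolding AB by (rule nz[OF x(2)], rule nz[OF y(2)])
      have X: "x = A / B" "y = A' / B'" unfolding AB x(1) y(1) by (rule fr[OF x(2)], rule fr[OF y(2)])
      have dx: "d x = (d0 a * B - A * d0 b) / (B * B)" "d y = (d0 a' * B' - A' * d0 b') / (B' * B')"
        unfolding AB x(1) y(1) by (rule d[OF x(2)], rule d[OF y(2)])
      have tm: "?t (p * q) = ?t p * ?t q" "?t (p + q) = ?t p + ?t q" for p q by (rule t.hom_mult, rule t.hom_add)
      have "x + y = Fract (a * b' + a' * b) (b * b')" "x * y = Fract (a * a') (b * b')"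
        using x y by (simp_all add: mult.commute[of b a'])
      then have s: "d (x + y) = ?f (a * b' + a' * b) (b * b')" "d (x * y) = ?f (a * a') (b * b')"
        by (simp_all only: d[OF bb])
      have "d (x + y) = d x + d y"
        unfolding s(1) dx add mult tm using quotient_rule_add[OF n] unfolding AB .
      moreover have "d (x * y) = d x * y + x * d y"
        unfolding s(2) dx mult tm unfolding X using quotient_rule_mult[OF n] unfolding AB .
      ultimately show ?thesis by blast
    qed
    then show ?thesis by (auto simp: derivation_def)
  qed
  then show ?thesis using dt by blast
qed

lemma ratconst_pconst: "ratconst a = Fract (pconst a) 1"
  by (simp add: ratconst_def pconst_def)

lemma ratvar_pvar: "ratvar v = Fract (pvar v) 1"
  by (simp add: ratvar_def pvar_def)

lemma field_hom_ratconst: "field_hom (ratconst :: 'a::field \<Rightarrow> ('v::linorder, 'a) ratfun)"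
proof -
  interpret c: comm_ring_hom "pconst :: 'a \<Rightarrow> ('v \<Rightarrow>\<^sub>0 nat) \<Rightarrow>\<^sub>0 'a" by (rule comm_ring_hom_pconst)
  interpret t: comm_ring_hom "\<lambda>p::('v \<Rightarrow>\<^sub>0 nat) \<Rightarrow>\<^sub>0 'a. Fract p 1" by (rule comm_ring_hom_to_fract)
  show ?thesis
    by unfold_locales (simp_all only: ratconst_pconst c.hom_zero t.hom_zero c.hom_one t.hom_one
        c.hom_add t.hom_add c.hom_mult t.hom_mult)
qed

text \<open>Constants and variables generate the field. Through this rule, derivations and
  homomorphisms are compared on generators only.\<close>

lemma ratfun_induct [case_names const var add mult inverse]:
  fixes z :: "('v::linorder, 'a::field) ratfun"
  assumes const: "\<And>c. P (ratconst c)" and var: "\<And>v. P (ratvar v)"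
    and add: "\<And>x y. P x \<Longrightarrow> P y \<Longrightarrow> P (x + y)" and mult: "\<And>x y. P x \<Longrightarrow> P y \<Longrightarrow> P (x * y)"
    and inv: "\<And>x. P x \<Longrightarrow> P (inverse x)"
  shows "P z"
proof -
  interpret t: comm_ring_hom "\<lambda>p::('v \<Rightarrow>\<^sub>0 nat) \<Rightarrow>\<^sub>0 'a. Fract p 1" by (rule comm_ring_hom_to_fract)
  have *: "P (Fract p 1)" for p :: "('v \<Rightarrow>\<^sub>0 nat) \<Rightarrow>\<^sub>0 'a"
    by (induct p rule: mpoly_induct)
      (simp_all only: t.hom_add t.hom_mult ratconst_pconst[symmetric] ratvar_pvar[symmetric] assms)
  obtain a b where z: "z = Fract a b" "b \<noteq> 0" by (cases z)
  then have "z = Fract a 1 * inverse (Fract b 1)" by simp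
  then show ?thesis using * mult inv by metis
qed

lemma ratfun_derivation_eqI:
  fixes d1 d2 :: "('v::linorder, 'a::field) ratfun \<Rightarrow> ('v, 'a) ratfun"
  assumes "derivation d1" "derivation d2" "\<And>a. d1 (ratconst a) = d2 (ratconst a)"
    "\<And>v. d1 (ratvar v) = d2 (ratvar v)"
  shows "d1 z = d2 z"
  by (induct z rule: ratfun_induct)
    (simp_all add: assms(3,4) assms(1,2)[THEN derivation_add] assms(1,2)[THEN derivation_mult]
      assms(1,2)[THEN derivation_inverse])

lemma extend_derivation:
  fixes D :: "'a::field \<Rightarrow> 'a" and w :: "'v::linorder \<Rightarrow> ('v, 'a) ratfun"
  assumes D: "derivation D"
  shows "derivation (extend_derivation D w)"
    and "extend_derivation D w (ratconst a) = ratconst (D a)"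
    and "extend_derivation D w (ratvar v) = w v"
proof -
  interpret t: comm_ring_hom "\<lambda>p::('v \<Rightarrow>\<^sub>0 nat) \<Rightarrow>\<^sub>0 'a. Fract p 1" by (rule comm_ring_hom_to_fract)
  interpret r: field_hom "ratconst :: 'a \<Rightarrow> ('v, 'a) ratfun" by (rule field_hom_ratconst)
  have "\<exists>d0. (\<forall>p q. d0 (p + q) = d0 p + d0 q) \<and> (\<forall>p q. d0 (p * q) = d0 p * Fract q 1 + Fract p 1 * d0 q) \<and>
    (\<forall>a. d0 (pconst a) = ratconst (D a)) \<and> (\<forall>v. d0 (pvar v) = w v)"
    by (rule mpoly_derivation_along[OF comm_ring_hom_to_fract])
      (simp_all only: derivation_add[OF D] derivation_mult[OF D] r.hom_add r.hom_mult ratconst_pconst[symmetric])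
  then obtain d0 where d0: "\<And>p q. d0 (p + q) = d0 p + d0 q" "\<And>p q. d0 (p * q) = d0 p * Fract q 1 + Fract p 1 * d0 q"
    "\<And>a. d0 (pconst a) = ratconst (D a)" "\<And>v. d0 (pvar v) = w v" by blast
  obtain d where d: "derivation d" "\<And>p. d (Fract p 1) = d0 p"
    using fract_derivation_lift[of d0, OF d0(1,2)] by blast
  have "\<exists>!d. derivation d \<and> (\<forall>a. d (ratconst a) = ratconst (D a)) \<and> (\<forall>v. d (ratvar v) = w v)"
  proof (rule ex1I[of _ d])
    show "derivation d \<and> (\<forall>a. d (ratconst a) = ratconst (D a)) \<and> (\<forall>v. d (ratvar v) = w v)"
      using d d0 by (simp add: ratconst_pconst ratvar_pvar)
    then show "d' = d" if "derivation d' \<and> (\<forall>a. d' (ratconst a) = ratconst (D a)) \<and> (\<forall>v. d' (ratvar v) = w v)" for d'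
      using ratfun_derivation_eqI[of d' d] that by auto
  qed
  from theI'[OF this] show "derivation (extend_derivation D w)"
     "extend_derivation D w (ratconst a) = ratconst (D a)" "extend_derivation D w (ratvar v) = w v"
    by (simp_all add: extend_derivation_def)
qed

lemma ratfun_eval:
  fixes \<iota> :: "'a::field \<Rightarrow> 'e::field"
  assumes \<iota>: "field_hom \<iota>" and inj: "\<And>p. peval \<iota> x p = 0 \<Longrightarrow> p = 0"
  obtains H :: "('v::linorder, 'a) ratfun \<Rightarrow> 'e" where "field_hom H" "\<And>a. H (ratconst a) = \<iota> a" "\<And>v. H (ratvar v) = x v"
    "\<And>p. H (Fract p 1) = peval \<iota> x p"
proof -
  interpret field_hom \<iota> by fact
  have c: "comm_ring_hom \<iota>" by unfold_locales
  obtain H where H: "field_hom H" "\<And>p. H (Fract p 1) = peval \<iota> x p"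
    using fract_hom_lift[OF comm_ring_hom_peval[OF c] inj] by blast
  show ?thesis
    by (rule that[OF H(1)]) (simp_all add: ratconst_pconst ratvar_pvar H peval_pvar[OF c]
      peval_pconst[of \<iota>, OF hom_zero hom_add])
qed

lemma ratfun_hom_eqI:
  fixes h1 h2 :: "('v::linorder, 'a::field) ratfun \<Rightarrow> 'e::field"
  assumes "field_hom h1" "field_hom h2" "\<And>a. h1 (ratconst a) = h2 (ratconst a)" "\<And>v. h1 (ratvar v) = h2 (ratvar v)"
  shows "h1 z = h2 z"
proof -
  interpret h1: field_hom h1 by fact
  interpret h2: field_hom h2 by fact
  show ?thesis by (induct z rule: ratfun_induct)
    (auto simp: assms(3,4) h1.hom_add h2.hom_add h1.hom_mult h2.hom_mult h1.hom_inverse h2.hom_inverse)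
qed

section \<open>Partial derivatives\<close>

definition exponent_degree :: "('v \<Rightarrow>\<^sub>0 nat) \<Rightarrow> nat" where
  "exponent_degree \<alpha> = (\<Sum>v\<in>Poly_Mapping.keys \<alpha>. Poly_Mapping.lookup \<alpha> v)"

definition degree_le :: "nat \<Rightarrow> (('v \<Rightarrow>\<^sub>0 nat) \<Rightarrow>\<^sub>0 'a::zero) \<Rightarrow> bool" where
  "degree_le n p \<longleftrightarrow> (\<forall>\<alpha>\<in>Poly_Mapping.keys p. exponent_degree \<alpha> \<le> n)"

lemma exponent_degree_add_var:
  "exponent_degree (Poly_Mapping.single v 1 + \<alpha>) = Suc (exponent_degree \<alpha>)"
proof -
  let ?S = "insert v (Poly_Mapping.keys \<alpha>)"
  have *: "exponent_degree \<beta> = (\<Sum>u\<in>?S. Poly_Mapping.lookup \<beta> u)" if "Poly_Mapping.keys \<beta> \<subseteq> ?S" for \<beta>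
    unfolding exponent_degree_def by (rule sum.mono_neutral_left) (use that in \<open>auto simp: in_keys_iff\<close>)
  have "exponent_degree (Poly_Mapping.single v 1 + \<alpha>)
      = (\<Sum>u\<in>?S. Poly_Mapping.lookup (Poly_Mapping.single v 1 + \<alpha>) u)"
    by (rule *) (use keys_add[of "Poly_Mapping.single v 1" \<alpha>] in auto)
  also have "\<dots> = (\<Sum>u\<in>?S. Poly_Mapping.lookup (Poly_Mapping.single v 1) u) + (\<Sum>u\<in>?S. Poly_Mapping.lookup \<alpha> u)"
    by (simp only: lookup_add sum.distrib)
  also have "(\<Sum>u\<in>?S. Poly_Mapping.lookup (Poly_Mapping.single v 1) u) = (1::nat)"
    by (subst sum.remove[of _ v]) (auto simp: lookup_single when_def intro!: sum.neutral)
  also have "(\<Sum>u\<in>?S. Poly_Mapping.lookup \<alpha> u) = exponent_degree \<alpha>"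
    by (rule *[symmetric]) auto
  finally show ?thesis by simp
qed

lemma exponent_split:
  assumes "Poly_Mapping.lookup \<alpha> v \<noteq> 0"
  shows "Poly_Mapping.single v 1 + (\<alpha> - Poly_Mapping.single v 1) = (\<alpha> :: 'v \<Rightarrow>\<^sub>0 nat)"
  by (rule poly_mapping_eqI) (use assms in \<open>auto simp: lookup_add lookup_minus lookup_single when_def\<close>)

lemma degree_le_0_imp_const:
  assumes "degree_le 0 p"
  shows "p = pconst (Poly_Mapping.lookup p 0)"
proof (rule poly_mapping_eqI)
  fix \<alpha>
  show "Poly_Mapping.lookup p \<alpha> = Poly_Mapping.lookup (pconst (Poly_Mapping.lookup p 0)) \<alpha>"
  proof (cases "\<alpha> = 0")
    case False
    then obtain v where v: "Poly_Mapping.lookup \<alpha> v \<noteq> 0"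
      by (metis lookup_zero poly_mapping_eqI)
    have "exponent_degree \<alpha> \<noteq> 0"
      using exponent_degree_add_var[of v "\<alpha> - Poly_Mapping.single v 1"] by (simp only: exponent_split[OF v])
    then have "\<alpha> \<notin> Poly_Mapping.keys p" using assms by (auto simp: degree_le_def)
    then show ?thesis using False by (simp add: pconst_def lookup_single in_keys_iff)
  qed (simp add: pconst_def)
qed

lemma degree_le_pconst: "degree_le n (pconst c)"
  by (auto simp: degree_le_def pconst_def exponent_degree_def)

lemma degree_le_exists: "\<exists>n. degree_le n p"
proof
  show "degree_le (\<Sum>\<alpha>\<in>Poly_Mapping.keys p. exponent_degree \<alpha>) p"
    unfolding degree_le_def by (auto intro: member_le_sum)
qed

lemma derivation_0: "derivation (\<lambda>_. 0)"
  by (simp add: derivation_def)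

definition pdiff :: "'v \<Rightarrow> (('v \<Rightarrow>\<^sub>0 nat) \<Rightarrow>\<^sub>0 'a::comm_ring_1) \<Rightarrow> ('v \<Rightarrow>\<^sub>0 nat) \<Rightarrow>\<^sub>0 'a" where
  "pdiff v = (SOME d. derivation d \<and> (\<forall>a. d (pconst a) = 0) \<and> (\<forall>u. d (pvar u) = (if u = v then 1 else 0)))"

lemma pdiff:
  fixes v :: 'v
  shows "derivation (pdiff v :: (('v \<Rightarrow>\<^sub>0 nat) \<Rightarrow>\<^sub>0 'a::comm_ring_1) \<Rightarrow> _)"
    and "pdiff v (pconst a :: ('v \<Rightarrow>\<^sub>0 nat) \<Rightarrow>\<^sub>0 'a) = 0"
    and "pdiff v (pvar u :: ('v \<Rightarrow>\<^sub>0 nat) \<Rightarrow>\<^sub>0 'a) = (if u = v then 1 else 0)"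
proof -
  have "\<exists>d :: (('v \<Rightarrow>\<^sub>0 nat) \<Rightarrow>\<^sub>0 'a) \<Rightarrow> _. derivation d \<and> (\<forall>a. d (pconst a) = 0) \<and> (\<forall>u. d (pvar u) = (if u = v then 1 else 0))"
    using mpoly_derivation_exists[OF derivation_0, of "\<lambda>u. if u = v then 1 else 0"]
    by (simp add: pconst_def)
  from someI_ex[OF this]
  show "derivation (pdiff v :: (('v \<Rightarrow>\<^sub>0 nat) \<Rightarrow>\<^sub>0 'a::comm_ring_1) \<Rightarrow> _)"
    and "pdiff v (pconst a :: ('v \<Rightarrow>\<^sub>0 nat) \<Rightarrow>\<^sub>0 'a) = 0"
    and "pdiff v (pvar u :: ('v \<Rightarrow>\<^sub>0 nat) \<Rightarrow>\<^sub>0 'a) = (if u = v then 1 else 0)"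
    by (simp_all add: pdiff_def)
qed

lemma pdiff_single:
  "pdiff v (Poly_Mapping.single \<alpha> (c::'a::comm_ring_1))
     = Poly_Mapping.single (\<alpha> - Poly_Mapping.single v 1) (of_nat (Poly_Mapping.lookup \<alpha> v) * c)"
proof (induct \<alpha> rule: exponent_induct)
  case zero
  show ?case using pdiff(2)[of v c] by (simp add: pconst_def)
next
  case (add_var u \<alpha>)
  let ?e = "\<lambda>v. Poly_Mapping.single v (1::nat)"
  have "pdiff v (Poly_Mapping.single (?e u + \<alpha>) c) = pdiff v (pvar u * Poly_Mapping.single \<alpha> c)"
    by (simp add: pvar_mult_single)
  also have "\<dots> = (if u = v then 1 else 0) * Poly_Mapping.single \<alpha> c +
      pvar u * Poly_Mapping.single (\<alpha> - ?e v) (of_nat (Poly_Mapping.lookup \<alpha> v) * c)"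
    by (simp add: derivation_mult[OF pdiff(1)] pdiff(3) add_var)
  \<comment> \<open>If v does not occur in \<alpha>, the truncated subtraction gives a wrong
    exponent, but the coefficient then contains the factor 0.\<close>
  also have "pvar u * Poly_Mapping.single (\<alpha> - ?e v) (of_nat (Poly_Mapping.lookup \<alpha> v) * c)
      = Poly_Mapping.single (?e u + \<alpha> - ?e v) (of_nat (Poly_Mapping.lookup \<alpha> v) * c)"
  proof (cases "Poly_Mapping.lookup \<alpha> v = 0")
    case False
    have "?e u + (\<alpha> - ?e v) = ?e u + \<alpha> - ?e v"
      by (rule poly_mapping_eqI) (use False in \<open>auto simp: lookup_add lookup_minus lookup_single when_def\<close>)
    then show ?thesis by (simp add: pvar_mult_single)
  qed simp
  also have "(if u = v then 1 else 0) * Poly_Mapping.single \<alpha> c + \<dots>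
     = Poly_Mapping.single (?e u + \<alpha> - ?e v) (of_nat (Poly_Mapping.lookup (?e u + \<alpha>) v) * c)"
    by (auto simp: lookup_add lookup_single when_def algebra_simps simp flip: single_add)
  finally show ?case .
qed

lemma lookup_pdiff:
  "Poly_Mapping.lookup (pdiff v p) \<beta>
     = of_nat (Suc (Poly_Mapping.lookup \<beta> v)) * Poly_Mapping.lookup p (Poly_Mapping.single v 1 + \<beta>)"
proof (induct p rule: mpoly_single_induct)
  case (single \<alpha> c)
  let ?e = "Poly_Mapping.single v (1::nat)"
  show ?case
  proof (cases "\<alpha> = ?e + \<beta>")
    case True
    then show ?thesis by (simp add: pdiff_single lookup_add lookup_single)
  next
    case False
    then have "Poly_Mapping.lookup \<alpha> v = 0 \<or> \<alpha> - ?e \<noteq> \<beta>" using exponent_split by metis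
    then show ?thesis using False by (auto simp: pdiff_single lookup_single when_def)
  qed
qed (simp_all add: derivation_add[OF pdiff(1)] lookup_add algebra_simps)

lemma degree_le_pdiff:
  assumes "degree_le (Suc n) p"
  shows "degree_le n (pdiff v p)"
  unfolding degree_le_def
proof
  fix \<beta> assume "\<beta> \<in> Poly_Mapping.keys (pdiff v p)"
  then have "Poly_Mapping.single v 1 + \<beta> \<in> Poly_Mapping.keys p"
    by (auto simp: in_keys_iff lookup_pdiff)
  then have "exponent_degree (Poly_Mapping.single v 1 + \<beta>) \<le> Suc n" using assms by (auto simp: degree_le_def)
  then show "exponent_degree \<beta> \<le> n" by (simp only: exponent_degree_add_var)
qed

lemma CHAR_0_of_nat_eq_0:
  assumes "CHAR('a::semiring_1) = 0"
  shows "(of_nat n :: 'a) = 0 \<longleftrightarrow> n = 0"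
  using assms by (simp add: of_nat_eq_0_iff_char_dvd)

text \<open>A nonzero coefficient at an exponent that involves v reappears in the derivative by v,
  multiplied by a positive integer, which is nonzero in characteristic 0.\<close>

lemma pdiff_all_zero_imp_const:
  fixes p :: "('v \<Rightarrow>\<^sub>0 nat) \<Rightarrow>\<^sub>0 'a::idom"
  assumes char: "CHAR('a) = 0" and zero: "\<And>v. pdiff v p = 0"
  shows "p = pconst (Poly_Mapping.lookup p 0)"
proof (rule poly_mapping_eqI)
  fix \<alpha>
  show "Poly_Mapping.lookup p \<alpha> = Poly_Mapping.lookup (pconst (Poly_Mapping.lookup p 0)) \<alpha>"
  proof (cases "\<alpha> = 0")
    case False
    then obtain v where v: "Poly_Mapping.lookup \<alpha> v \<noteq> 0"
      by (metis lookup_zero poly_mapping_eqI)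
    have "Poly_Mapping.lookup p \<alpha> = 0"
      using lookup_pdiff[of v p "\<alpha> - Poly_Mapping.single v 1"] CHAR_0_of_nat_eq_0[OF char]
      unfolding exponent_split[OF v] zero by (metis lookup_zero mult_eq_0_iff nat.distinct(1))
    then show ?thesis using False by (simp add: pconst_def lookup_single)
  qed (simp add: pconst_def)
qed

definition ratdiff :: "'v::linorder \<Rightarrow> ('v, 'a::field) ratfun \<Rightarrow> ('v, 'a) ratfun" where
  "ratdiff v = extend_derivation (\<lambda>_. 0) (\<lambda>u. if u = v then 1 else 0)"

lemma ratdiff:
  fixes v :: "'a::linorder"
  shows "derivation (ratdiff v :: ('a, 'b::field) ratfun \<Rightarrow> _)"
    and "ratdiff v (ratconst a :: ('a, 'b) ratfun) = 0" and "ratdiff v (ratvar u :: ('a, 'b) ratfun) = (if u = v then 1 else 0)"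
proof -
  interpret r: field_hom "ratconst :: 'b \<Rightarrow> ('a, 'b) ratfun" by (rule field_hom_ratconst)
  show "derivation (ratdiff v)" unfolding ratdiff_def by (rule extend_derivation(1)[OF derivation_0])
  show "ratdiff v (ratconst a) = 0" unfolding ratdiff_def extend_derivation(2)[OF derivation_0] by (rule r.hom_zero)
  show "ratdiff v (ratvar u) = (if u = v then 1 else 0)" unfolding ratdiff_def by (rule extend_derivation(3)[OF derivation_0])
qed

lemma ratdiff_Fract:
  fixes p :: "('v::linorder \<Rightarrow>\<^sub>0 nat) \<Rightarrow>\<^sub>0 'a::field"
  shows "ratdiff v (Fract p 1) = Fract (pdiff v p) 1"
proof -
  interpret t: comm_ring_hom "\<lambda>p::('v \<Rightarrow>\<^sub>0 nat) \<Rightarrow>\<^sub>0 'a. Fract p 1" by (rule comm_ring_hom_to_fract)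
  show ?thesis
  proof (induct p rule: mpoly_induct)
    case (const c)
    show ?case using ratdiff(2)[of v c] by (simp only: ratconst_pconst pdiff t.hom_zero)
  next
    case (add p q)
    then show ?case by (simp only: t.hom_add derivation_add[OF ratdiff(1)] derivation_add[OF pdiff(1)])
  next
    case (var u p)
    have "ratdiff v (Fract (pvar u) 1) = (Fract (pdiff v (pvar u)) 1 :: ('v, 'a) ratfun)"
      using ratdiff(3)[of v u] by (simp only: ratvar_pvar pdiff if_distrib[of "\<lambda>p. Fract p 1"] t.hom_zero t.hom_one)
    with var show ?case by (simp only: t.hom_add t.hom_mult derivation_mult[OF ratdiff(1)] derivation_mult[OF pdiff(1)])
  qed
qed

text \<open>If \<open>f = p / q\<close> is killed by a derivation \<open>d\<close> with \<open>d q \<noteq> 0\<close>, then also \<open>f = d p / d q\<close>, and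
  partial derivatives lower the degree.\<close>

lemma ratdiff_all_zero_imp_const:
  fixes f :: "('v::linorder, 'a::field) ratfun"
  assumes char: "CHAR('a) = 0" and zero: "\<And>v. ratdiff v f = 0"
  shows "f \<in> range ratconst"
proof -
  interpret r: field_hom "ratconst :: 'a \<Rightarrow> ('v, 'a) ratfun" by (rule field_hom_ratconst)
  let ?t = "\<lambda>p::('v \<Rightarrow>\<^sub>0 nat) \<Rightarrow>\<^sub>0 'a. Fract p 1"
  have t0: "?t p = 0 \<longleftrightarrow> p = 0" for p by (rule Fract_eq_0_iff)
  have *: "f \<in> range ratconst" if "degree_le n q" "q \<noteq> 0" "f * ?t q = ?t p" for n p q
    using that
  proof (induct n arbitrary: p q)
    case base: 0
    have diff: "f * ?t (pdiff v q) = ?t (pdiff v p)" for v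
      using arg_cong[OF base(3), of "ratdiff v"] by (simp only: derivation_mult[OF ratdiff(1)] zero ratdiff_Fract) simp
    have q: "q = pconst (Poly_Mapping.lookup q 0)" by (rule degree_le_0_imp_const) fact
    have "pdiff v p = 0" for v
    proof -
      have "pdiff v q = 0" by (subst q) (rule pdiff(2))
      then have "?t (pdiff v p) = 0" using diff[of v] t0[of 0] by simp
      then show ?thesis by (simp only: t0)
    qed
    then have p: "p = pconst (Poly_Mapping.lookup p 0)" by (rule pdiff_all_zero_imp_const[OF char])
    have "f * ratconst (Poly_Mapping.lookup q 0) = ratconst (Poly_Mapping.lookup p 0)"
      using base(3) p q by (simp only: ratconst_pconst)
    moreover have "ratconst (Poly_Mapping.lookup q 0) \<noteq> (0 :: ('v, 'a) ratfun)" using base(2) q t0[of q] by (metis ratconst_pconst)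
    ultimately have "f = ratconst (Poly_Mapping.lookup p 0 / Poly_Mapping.lookup q 0)"
      unfolding r.hom_div using eq_divide_imp by blast
    then show ?case by blast
  next
    case (Suc n)
    have diff: "f * ?t (pdiff v q) = ?t (pdiff v p)" for v
      using arg_cong[OF Suc(4), of "ratdiff v"] by (simp only: derivation_mult[OF ratdiff(1)] zero ratdiff_Fract) simp
    show ?case
    proof (cases "\<exists>v. pdiff v q \<noteq> 0")
      case True
      then obtain v where "pdiff v q \<noteq> 0" by blast
      then show ?thesis using Suc(1)[OF degree_le_pdiff[OF Suc(2)] _ diff] by blast
    next
      case False
      \<comment> \<open>All partial derivatives of the denominator vanish, so it is constant and has
        degree 0; the induction hypothesis applies to the same fraction.\<close>
      then have "q = pconst (Poly_Mapping.lookup q 0)" by (intro pdiff_all_zero_imp_const[OF char]) blast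
      then have "degree_le 0 q" by (rule ssubst) (rule degree_le_pconst)
      then have "degree_le n q" by (auto simp: degree_le_def)
      then show ?thesis using Suc by blast
    qed
  qed
  obtain p q where f: "f = Fract p q" "q \<noteq> 0" by (cases f)
  obtain n where "degree_le n q" using degree_le_exists by blast
  moreover have "f * ?t q = ?t p" using f by (simp add: eq_fract)
  ultimately show ?thesis using * f(2) by blast
qed

section \<open>Linear independence over a subfield\<close>

definition is_subfield :: "'a::field set \<Rightarrow> bool" where
  "is_subfield S \<longleftrightarrow> 0 \<in> S \<and> 1 \<in> S \<and> (\<forall>x\<in>S. \<forall>y\<in>S. x + y \<in> S \<and> x - y \<in> S \<and> x * y \<in> S) \<and> (\<forall>x\<in>S. inverse x \<in> S)"

lemma is_subfieldD:
  assumes "is_subfield S"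
  shows "0 \<in> S" "1 \<in> S" "x \<in> S \<Longrightarrow> y \<in> S \<Longrightarrow> x + y \<in> S" "x \<in> S \<Longrightarrow> y \<in> S \<Longrightarrow> x - y \<in> S"
    "x \<in> S \<Longrightarrow> y \<in> S \<Longrightarrow> x * y \<in> S" "x \<in> S \<Longrightarrow> inverse x \<in> S" "x \<in> S \<Longrightarrow> - x \<in> S"
    "x \<in> S \<Longrightarrow> y \<in> S \<Longrightarrow> x / y \<in> S"
proof -
  show 1: "0 \<in> S" "1 \<in> S" "x \<in> S \<Longrightarrow> y \<in> S \<Longrightarrow> x + y \<in> S" "x \<in> S \<Longrightarrow> y \<in> S \<Longrightarrow> x - y \<in> S"
    "x \<in> S \<Longrightarrow> y \<in> S \<Longrightarrow> x * y \<in> S" "x \<in> S \<Longrightarrow> inverse x \<in> S" for x y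
    using assms by (auto simp: is_subfield_def)
  show "x \<in> S \<Longrightarrow> - x \<in> S" using 1(4)[of 0 x] 1(1) by simp
  show "x \<in> S \<Longrightarrow> y \<in> S \<Longrightarrow> x / y \<in> S" using 1(5)[of x "inverse y"] 1(6)[of y] by (simp add: divide_inverse)
qed

lemma is_subfield_sum:
  assumes "is_subfield S" "\<And>i. i \<in> I \<Longrightarrow> f i \<in> S"
  shows "sum f I \<in> S"
  using assms(2) by (induct I rule: infinite_finite_induct) (auto intro: is_subfieldD[OF assms(1)])

lemma is_subfield_range:
  assumes "field_hom h"
  shows "is_subfield (range h)"
proof -
  interpret field_hom h by fact
  show ?thesis unfolding is_subfield_def
    by (auto simp flip: hom_add hom_mult hom_minus hom_inverse intro: range_eqI[of _ _ 0] range_eqI[of _ _ 1])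
qed

lemma is_subfield_constants:
  assumes "derivation D"
  shows "is_subfield (constants D)"
  unfolding is_subfield_def constants_def
  by (auto simp: derivation_add[OF assms] derivation_mult[OF assms] derivation_zero[OF assms]
      derivation_one[OF assms] derivation_diff[OF assms] derivation_inverse[OF assms])

definition lin_indep :: "'a::field set \<Rightarrow> 'i set \<Rightarrow> ('i \<Rightarrow> 'a) \<Rightarrow> bool" where
  "lin_indep S J e \<longleftrightarrow> (\<forall>c. (\<forall>j\<in>J. c j \<in> S) \<and> (\<Sum>j\<in>J. c j * e j) = 0 \<longrightarrow> (\<forall>j\<in>J. c j = 0))"

lemma lin_indepD:
  "lin_indep S J e \<Longrightarrow> (\<And>j. j \<in> J \<Longrightarrow> c j \<in> S) \<Longrightarrow> (\<Sum>j\<in>J. c j * e j) = 0 \<Longrightarrow> j \<in> J \<Longrightarrow> c j = 0"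
  unfolding lin_indep_def by blast

lemma lin_indep_subset:
  assumes "lin_indep S J e" "finite J" "K \<subseteq> J" "0 \<in> S"
  shows "lin_indep S K e"
  unfolding lin_indep_def
proof (intro allI impI, elim conjE)
  fix c assume c: "\<forall>j\<in>K. c j \<in> S" "(\<Sum>j\<in>K. c j * e j) = 0"
  have "(\<Sum>j\<in>J. (if j \<in> K then c j else 0) * e j) = (\<Sum>j\<in>K. c j * e j)"
    using assms by (intro sum.mono_neutral_cong_right) auto
  then have "(if j \<in> K then c j else 0) = 0" if "j \<in> J" for j
    using lin_indepD[OF assms(1), of "\<lambda>j. if j \<in> K then c j else 0" j] c assms that by auto
  then show "\<forall>j\<in>K. c j = 0" using assms(3) by (metis subsetD)
qed

text \<open>Allows a finite sum of products to be rewritten with independent left factors, as is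
  needed both for \<open>specialises_indep\<close> and for the Hilbert 90 argument.\<close>

lemma lin_indep_reduce:
  assumes S: "is_subfield S" and "finite I"
  shows "\<exists>J\<subseteq>I. lin_indep S J e \<and> (\<forall>i\<in>I. \<exists>c. (\<forall>j\<in>J. c j \<in> S) \<and> e i = (\<Sum>j\<in>J. c j * e j))"
  using assms(2)
proof induct
  case empty
  show ?case by (auto simp: lin_indep_def)
next
  case (insert a I)
  then obtain J where J: "J \<subseteq> I" "lin_indep S J e"
    "\<And>i. i \<in> I \<Longrightarrow> \<exists>c. (\<forall>j\<in>J. c j \<in> S) \<and> e i = (\<Sum>j\<in>J. c j * e j)" by blast
  have fin: "finite J" and a: "a \<notin> J" using J insert finite_subset by auto
  show ?case
  proof (cases "\<exists>c. (\<forall>j\<in>J. c j \<in> S) \<and> e a = (\<Sum>j\<in>J. c j * e j)")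
    case True
    then show ?thesis using J by (intro exI[of _ J]) auto
  next
    case False
    have "lin_indep S (insert a J) e"
      unfolding lin_indep_def
    proof (intro allI impI, elim conjE)
      fix c assume c: "\<forall>j\<in>insert a J. c j \<in> S" "(\<Sum>j\<in>insert a J. c j * e j) = 0"
      have s: "c a * e a + (\<Sum>j\<in>J. c j * e j) = 0" using c fin a by simp
      have "c a = 0"
      proof (rule ccontr)
        assume n: "c a \<noteq> 0"
        have "e a = - (\<Sum>j\<in>J. c j * e j) / c a" using s n by (simp add: field_simps eq_neg_iff_add_eq_0)
        also have "\<dots> = (\<Sum>j\<in>J. (- c j / c a) * e j)"
          by (simp add: sum_divide_distrib sum_negf)
        finally have e1: "e a = (\<Sum>j\<in>J. (- c j / c a) * e j)" .
        have e2: "- c j / c a \<in> S" if "j \<in> J" for j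
          using is_subfieldD(8)[OF S is_subfieldD(7)[OF S, of "c j"], of "c a"] c(1) that by blast
        have "\<exists>c. (\<forall>j\<in>J. c j \<in> S) \<and> e a = (\<Sum>j\<in>J. c j * e j)"
          by (rule exI[of _ "\<lambda>j. - c j / c a"], rule conjI[OF ballI[OF e2] e1])
        with False show False by (rule notE)
      qed
      moreover from this have "(\<Sum>j\<in>J. c j * e j) = 0" using s by simp
      then have "c j = 0" if "j \<in> J" for j using lin_indepD[OF J(2), of c j] c(1) that by blast
      ultimately show "\<forall>j\<in>insert a J. c j = 0" by blast
    qed
    moreover have "\<exists>c. (\<forall>j\<in>insert a J. c j \<in> S) \<and> e i = (\<Sum>j\<in>insert a J. c j * e j)" if "i \<in> insert a I" for i
    proof (cases "i = a")
      case True
      have "(\<Sum>j\<in>J. (if j = a then 1 else 0) * e j) = 0" using a by (intro sum.neutral) auto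
      then show ?thesis using True fin a is_subfieldD(1,2)[OF S]
        by (intro exI[of _ "\<lambda>j. if j = a then 1 else 0"]) auto
    next
      case False
      then obtain c where c: "\<forall>j\<in>J. c j \<in> S" "e i = (\<Sum>j\<in>J. c j * e j)" using J(3) \<open>i \<in> insert a I\<close> by auto
      have "(\<Sum>j\<in>J. (if j = a then 0 else c j) * e j) = e i" unfolding c(2) using a by (intro sum.cong) auto
      then show ?thesis using fin a is_subfieldD(1)[OF S] c
        by (intro exI[of _ "\<lambda>j. if j = a then 0 else c j"]) auto
    qed
    ultimately show ?thesis using J(1) by (intro exI[of _ "insert a J"]) auto
  qed
qed

text \<open>The nonvanishing of the Wronskian: a relation between the columns is normalised to have a
  coefficient \<open>1\<close>; differentiating it makes it shorter, so the other coefficients are constants.\<close>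

lemma wronskian_indep:
  fixes D :: "'e::field \<Rightarrow> 'e"
  assumes D: "derivation D"
  shows "finite K \<Longrightarrow> lin_indep (constants D) K y \<Longrightarrow> (\<And>i. (\<Sum>k\<in>K. c k * (D ^^ i) (y k)) = 0) \<Longrightarrow> k \<in> K \<Longrightarrow> c k = 0"
proof (induct "card K" arbitrary: K c k)
  case 0
  then show ?case by simp
next
  case (Suc n)
  note C = is_subfield_constants[OF D]
  show ?case
  proof (rule ccontr)
    assume ck: "c k \<noteq> 0"
    define b where "b j = c j / c k" for j
    have b: "(\<Sum>j\<in>K. b j * (D ^^ i) (y j)) = 0" for i
      using Suc.prems(3)[of i] by (simp add: b_def sum_divide_distrib[symmetric])
    have bk: "b k = 1" using ck by (simp add: b_def)
    have "(\<Sum>j\<in>K - {k}. D (b j) * (D ^^ i) (y j)) = 0" for i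
    proof -
      have "0 = D (\<Sum>j\<in>K. b j * (D ^^ i) (y j))" using b by (simp add: derivation_zero[OF D])
      also have "\<dots> = (\<Sum>j\<in>K. D (b j) * (D ^^ i) (y j)) + (\<Sum>j\<in>K. b j * (D ^^ Suc i) (y j))"
        by (simp add: derivation_sum[OF D] derivation_mult[OF D] sum.distrib)
      also have "(\<Sum>j\<in>K. D (b j) * (D ^^ i) (y j)) = (\<Sum>j\<in>K - {k}. D (b j) * (D ^^ i) (y j))"
        using Suc.prems bk by (subst sum.remove[of K k]) (auto simp: derivation_one[OF D])
      finally show ?thesis using b[of "Suc i"] by simp
    qed
    then have Db: "D (b j) = 0" if "j \<in> K - {k}" for j
      using Suc.hyps(1)[of "K - {k}" "\<lambda>j. D (b j)" j] Suc.hyps(2) Suc.prems that is_subfieldD(1)[OF C]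
        lin_indep_subset[OF Suc.prems(2,1), of "K - {k}"] by auto
    then have "b j \<in> constants D" if "j \<in> K" for j
      using that bk by (cases "j = k") (auto simp: constants_def derivation_one[OF D])
    then have "b k = 0" using lin_indepD[OF Suc.prems(2), of b k] b[of 0] Suc.prems by auto
    then show False using bk by simp
  qed
qed

section \<open>Specialising finitely generated algebras over an algebraically closed field\<close>

definition is_ideal :: "'t::comm_ring_1 set \<Rightarrow> bool" where
  "is_ideal J \<longleftrightarrow> 0 \<in> J \<and> (\<forall>x\<in>J. \<forall>y\<in>J. x + y \<in> J) \<and> (\<forall>r. \<forall>x\<in>J. r * x \<in> J)"

lemma is_idealD:
  assumes "is_ideal J"
  shows "0 \<in> J" "x \<in> J \<Longrightarrow> y \<in> J \<Longrightarrow> x + y \<in> J" "x \<in> J \<Longrightarrow> r * x \<in> J" "x \<in> J \<Longrightarrow> x * r \<in> J"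
    "x \<in> J \<Longrightarrow> - x \<in> J" "x \<in> J \<Longrightarrow> y \<in> J \<Longrightarrow> x - y \<in> J"
proof -
  show 1: "0 \<in> J" "x \<in> J \<Longrightarrow> y \<in> J \<Longrightarrow> x + y \<in> J" "x \<in> J \<Longrightarrow> r * x \<in> J" for x y r
    using assms by (auto simp: is_ideal_def)
  show "x \<in> J \<Longrightarrow> x * r \<in> J" using 1(3)[of x r] by (simp add: mult.commute)
  show 2: "x \<in> J \<Longrightarrow> - x \<in> J" for x using 1(3)[of x "-1"] by simp
  show "x \<in> J \<Longrightarrow> y \<in> J \<Longrightarrow> x - y \<in> J" using 1(2)[of x "- y"] 2[of y] by simp
qed

lemma is_ideal_sum:
  assumes "is_ideal J" "\<And>i. i \<in> I \<Longrightarrow> f i \<in> J"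
  shows "sum f I \<in> J"
  using assms(2) by (induct I rule: infinite_finite_induct) (auto intro: is_idealD[OF assms(1)])

definition is_prime_ideal :: "'t::comm_ring_1 set \<Rightarrow> bool" where
  "is_prime_ideal P \<longleftrightarrow> is_ideal P \<and> 1 \<notin> P \<and> (\<forall>x y. x * y \<in> P \<longrightarrow> x \<in> P \<or> y \<in> P)"

text \<open>An ideal over J that is maximal among those avoiding all powers of q is prime: if x and
  y lie outside it, then powers of q lie in P + (x) and in P + (y), and their product lies in P + (x
  y).\<close>

lemma prime_ideal_avoiding_powers:
  fixes J :: "'t::comm_ring_1 set"
  assumes J: "is_ideal J" and q: "\<And>n. q ^ n \<notin> J"
  obtains P where "is_prime_ideal P" "J \<subseteq> P" "q \<notin> P"
proof -
  let ?A = "{I. is_ideal I \<and> J \<subseteq> I \<and> (\<forall>n. q ^ n \<notin> I)}"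
  have "\<exists>P\<in>?A. \<forall>X\<in>?A. P \<subseteq> X \<longrightarrow> X = P"
  proof (rule subset_Zorn_nonempty)
    show "?A \<noteq> {}" using J q by blast
    fix \<C> assume ne: "\<C> \<noteq> {}" and ch: "subset.chain ?A \<C>"
    have sub: "\<C> \<subseteq> ?A" and tot: "\<And>X Y. X \<in> \<C> \<Longrightarrow> Y \<in> \<C> \<Longrightarrow> X \<subseteq> Y \<or> Y \<subseteq> X"
      using ch by (auto simp: subset.chain_def)
    have "is_ideal (\<Union>\<C>)"
      unfolding is_ideal_def
    proof (intro conjI ballI allI)
      show "0 \<in> \<Union>\<C>" using ne sub by (auto intro: is_idealD(1))
      fix x assume "x \<in> \<Union>\<C>"
      then obtain X where X: "X \<in> \<C>" "x \<in> X" by blast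
      have "is_ideal X" using X sub by blast
      then show "r * x \<in> \<Union>\<C>" for r using X is_idealD(3)[of X x r] by blast
      fix y assume "y \<in> \<Union>\<C>"
      then obtain Y where Y: "Y \<in> \<C>" "y \<in> Y" by blast
      have "is_ideal Y" using Y sub by blast
      from tot[OF X(1) Y(1)] show "x + y \<in> \<Union>\<C>"
      proof
        assume "X \<subseteq> Y"
        then show ?thesis using X Y by (intro UnionI[OF Y(1)] is_idealD(2)[OF \<open>is_ideal Y\<close>]) auto
      next
        assume "Y \<subseteq> X"
        then show ?thesis using X Y by (intro UnionI[OF X(1)] is_idealD(2)[OF \<open>is_ideal X\<close>]) auto
      qed
    qed
    then show "\<Union>\<C> \<in> ?A" using ne sub by blast
  qed
  then obtain P where PA: "P \<in> ?A" and mA: "\<forall>X\<in>?A. P \<subseteq> X \<longrightarrow> X = P" by (rule bexE)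
  have P: "is_ideal P" "J \<subseteq> P" "\<And>n. q ^ n \<notin> P" using PA by simp_all
  have max: "X = P" if "is_ideal X" "J \<subseteq> X" "\<forall>n. q ^ n \<notin> X" "P \<subseteq> X" for X
    using mA that by simp
  note D = is_idealD[OF P(1)]
  have ext: "\<exists>n p r. p \<in> P \<and> q ^ n = p + r * x" if x: "x \<notin> P" for x
  proof (rule ccontr)
    assume no: "\<not> ?thesis"
    let ?X = "{p + r * x | p r. p \<in> P}"
    have "is_ideal ?X"
      unfolding is_ideal_def
    proof (intro conjI ballI allI)
      show "0 \<in> ?X" using D(1) by (intro CollectI exI[of _ 0]) simp
      fix a assume "a \<in> ?X"
      then obtain p r where a: "a = p + r * x" "p \<in> P" by blast
      show "s * a \<in> ?X" for s
        using a D(3)[of p s] by (auto simp: algebra_simps) (metis mult.assoc mult.commute)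
      fix b assume "b \<in> ?X"
      then obtain p' r' where b: "b = p' + r' * x" "p' \<in> P" by blast
      have "a + b = (p + p') + (r + r') * x" using a b by (simp add: algebra_simps)
      then show "a + b \<in> ?X" using a b D(2) by blast
    qed
    moreover have PX: "P \<subseteq> ?X"
    proof
      fix p assume "p \<in> P"
      then show "p \<in> ?X" by (intro CollectI exI[of _ p] exI[of _ 0]) simp
    qed
    moreover have "\<forall>n. q ^ n \<notin> ?X" using no by blast
    ultimately have "?X = P" using P(2) by (intro max) auto
    moreover have "x \<in> ?X" using D(1) by (intro CollectI exI[of _ 0] exI[of _ 1]) simp
    ultimately show False using x by blast
  qed
  have "x \<in> P \<or> y \<in> P" if xy: "x * y \<in> P" for x y
  proof (rule ccontr)
    assume "\<not> ?thesis"
    then obtain n p r m p' r' where e: "p \<in> P" "q ^ n = p + r * x" "p' \<in> P" "q ^ m = p' + r' * y"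
      using ext by metis
    have "q ^ (n + m) = p * (p' + r' * y) + (r * x) * p' + (r * r') * (x * y)"
      unfolding power_add e by (simp add: algebra_simps)
    also have "\<dots> \<in> P" by (intro D(2) D(4)[OF e(1)] D(3)[OF e(3)] D(3)[OF xy])
    finally show False using P(3) by blast
  qed
  moreover have "1 \<notin> P" "q \<notin> P" using P(3)[of 0] P(3)[of 1] by simp_all
  ultimately show ?thesis using that P unfolding is_prime_ideal_def by blast
qed

section \<open>Polynomials over a subring, modulo a prime ideal\<close>

definition is_subring :: "'t::comm_ring_1 set \<Rightarrow> bool" where
  "is_subring A \<longleftrightarrow> 0 \<in> A \<and> 1 \<in> A \<and> (\<forall>x\<in>A. \<forall>y\<in>A. x + y \<in> A \<and> x - y \<in> A \<and> x * y \<in> A)"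

lemma is_subringD:
  assumes "is_subring A"
  shows "0 \<in> A" "1 \<in> A" "x \<in> A \<Longrightarrow> y \<in> A \<Longrightarrow> x + y \<in> A" "x \<in> A \<Longrightarrow> y \<in> A \<Longrightarrow> x - y \<in> A"
    "x \<in> A \<Longrightarrow> y \<in> A \<Longrightarrow> x * y \<in> A"
  using assms by (auto simp: is_subring_def)

lemma is_subring_sum:
  assumes "is_subring A" "\<And>i. i \<in> I \<Longrightarrow> f i \<in> A"
  shows "sum f I \<in> A"
  using assms(2) by (induct I rule: infinite_finite_induct) (auto intro: is_subringD[OF assms(1)])

lemma is_subring_power: "is_subring A \<Longrightarrow> x \<in> A \<Longrightarrow> x ^ n \<in> A"
  by (induct n) (auto intro: is_subringD)

definition polys_over :: "'t::comm_ring_1 set \<Rightarrow> 't poly set" where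
  "polys_over A = {p. \<forall>i. coeff p i \<in> A}"

lemma is_subring_polys_over:
  assumes A: "is_subring A"
  shows "is_subring (polys_over A)"
proof -
  note D = is_subringD[OF A]
  have "coeff (1 :: 'a poly) i \<in> A" for i using D(1,2) by (simp add: coeff_1)
  then show ?thesis using D
    by (auto simp: is_subring_def polys_over_def coeff_mult intro!: is_subring_sum[OF A])
qed

lemma polys_over_intros:
  assumes A: "is_subring A"
  shows "a \<in> A \<Longrightarrow> monom a n \<in> polys_over A" "a \<in> A \<Longrightarrow> [:a:] \<in> polys_over A"
    "a \<in> A \<Longrightarrow> p \<in> polys_over A \<Longrightarrow> smult a p \<in> polys_over A"
    "p \<in> polys_over A \<Longrightarrow> poly_cutoff n p \<in> polys_over A"
    "p \<in> polys_over A \<Longrightarrow> coeff p i \<in> A"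
  using is_subringD[OF A] by (auto simp: polys_over_def coeff_poly_cutoff coeff_pCons split: nat.split)

definition adjoin :: "'t::comm_ring_1 set \<Rightarrow> 't \<Rightarrow> 't set" where
  "adjoin A z = (\<lambda>p. poly p z) ` polys_over A"

lemma is_subring_adjoin:
  assumes A: "is_subring A"
  shows "is_subring (adjoin A z)" "A \<subseteq> adjoin A z" "z \<in> adjoin A z"
proof -
  note P = is_subringD[OF is_subring_polys_over[OF A]]
  have e: "poly 0 z = 0" "poly 1 z = 1" "poly p z + poly q z = poly (p + q) z"
     "poly p z - poly q z = poly (p - q) z" "poly p z * poly q z = poly (p * q) z" for p q by simp_all
  show "is_subring (adjoin A z)"
    unfolding is_subring_def adjoin_def using P
    by (auto simp only: e intro!: imageI) (metis e(1,2) imageI)+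
  show "A \<subseteq> adjoin A z"
  proof
    fix a assume "a \<in> A"
    then have "[:a:] \<in> polys_over A" by (rule polys_over_intros[OF A])
    then show "a \<in> adjoin A z" unfolding adjoin_def by (rule rev_image_eqI) simp
  qed
  have "monom 1 1 \<in> polys_over A" by (rule polys_over_intros[OF A]) (rule is_subringD[OF A])
  then show "z \<in> adjoin A z" unfolding adjoin_def by (rule rev_image_eqI) (simp add: poly_monom)
qed

text \<open>A is only a ring, so division by the leading coefficient is replaced by multiplication
  with its powers. Later these are harmless: they lie outside P and their values at the chosen point
  are nonzero.\<close>

lemma pseudo_division_over:
  fixes f :: "'t::comm_ring_1 poly"
  assumes A: "is_subring A" and f: "f \<in> polys_over A" "degree f > 0"
  shows "h \<in> polys_over A \<Longrightarrow> \<exists>k u r. u \<in> polys_over A \<and> r \<in> polys_over A \<and>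
    smult (lead_coeff f ^ k) h = f * u + r \<and> degree r < degree f"
proof (induct "degree h" arbitrary: h rule: less_induct)
  case less
  note P = is_subringD[OF is_subring_polys_over[OF A]]
  note I = polys_over_intros[OF A]
  show ?case
  proof (cases "degree h < degree f")
    case True
    then show ?thesis using less(2) P(1)
      by (intro exI[of _ 0] exI[of _ 0] exI[of _ h]) auto
  next
    case False
    let ?m = "monom (lead_coeff h) (degree h - degree f)"
    define g where "g = smult (lead_coeff f) h - ?m * f"
    have m: "?m \<in> polys_over A" by (rule I(1)) (rule I(5)[OF less(2)])
    have gA: "g \<in> polys_over A" unfolding g_def
      using less(2) m f I(3)[OF I(5)[OF f(1)] less(2)] P by blast
    have "degree g \<le> degree h" unfolding g_def
    proof (rule degree_diff_le)
      show "degree (smult (lead_coeff f) h) \<le> degree h" by (rule degree_smult_le)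
      have "degree (?m * f) \<le> degree ?m + degree f" by (rule degree_mult_le)
      also have "\<dots> \<le> degree h" using False degree_monom_le[of "lead_coeff h" "degree h - degree f"] by simp
      finally show "degree (?m * f) \<le> degree h" .
    qed
    moreover have "coeff g (degree h) = 0"
      unfolding g_def coeff_diff coeff_smult coeff_monom_mult using False by (simp add: mult.commute)
    moreover have "degree h > 0" using False f by simp
    ultimately have "degree g < degree h"
      using eq_zero_or_degree_less by fastforce
    from less(1)[OF this gA] obtain k u r where r: "u \<in> polys_over A" "r \<in> polys_over A"
      "smult (lead_coeff f ^ k) g = f * u + r" "degree r < degree f" by blast
    let ?l = "lead_coeff f ^ k"
    have "smult (lead_coeff f ^ Suc k) h = smult ?l (g + ?m * f)"
      unfolding g_def by (simp add: mult.commute)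
    also have "\<dots> = f * (u + smult ?l ?m) + r"
      using r(3) by (simp add: smult_add_right algebra_simps)
    finally have "smult (lead_coeff f ^ Suc k) h = f * (u + smult ?l ?m) + r" .
    moreover have "u + smult ?l ?m \<in> polys_over A"
      by (intro P(3) r I(3) m is_subring_power[OF A] I(5)[OF f(1)])
    ultimately show ?thesis using r by blast
  qed
qed

lemma poly_in_ideal:
  assumes "is_ideal P" "\<And>i. coeff f i \<in> P"
  shows "poly f z \<in> P"
  unfolding poly_altdef using assms by (intro is_ideal_sum) (auto intro: is_idealD)

text \<open>All computations stay in A instead of A / P. Dropping the top coefficients that lie in P
  makes the degree and the leading coefficient those of the polynomial modulo P.\<close>

lemma cutoff_leading:
  fixes P :: "'t::comm_ring_1 set"
  assumes P: "is_ideal P" and A: "is_subring A" and f: "f \<in> polys_over A" "\<exists>i. coeff f i \<notin> P"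
  obtains f' where "f' \<in> polys_over A" "lead_coeff f' \<notin> P" "degree f' \<le> degree f"
    "\<And>i. coeff f i - coeff f' i \<in> P" "\<And>z. poly f z - poly f' z \<in> P"
proof -
  define d where "d = (GREATEST i. coeff f i \<notin> P)"
  have b: "coeff f i \<notin> P \<Longrightarrow> i \<le> degree f" for i
    by (rule le_degree) (use is_idealD(1)[OF P] in metis)
  have d: "coeff f d \<notin> P" unfolding d_def using f(2) b by (metis (no_types, lifting) GreatestI_ex_nat)
  have dmax: "coeff f i \<notin> P \<Longrightarrow> i \<le> d" for i
    unfolding d_def using b by (metis (no_types, lifting) Greatest_le_nat)
  let ?f = "poly_cutoff (Suc d) f"
  have c: "coeff ?f i = (if i \<le> d then coeff f i else 0)" for i by (simp add: coeff_poly_cutoff less_Suc_eq_le)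
  have "coeff ?f d \<noteq> 0" using d c is_idealD(1)[OF P] by auto
  then have deg: "degree ?f = d"
    by (intro antisym degree_le le_degree) (auto simp: c)
  have co: "coeff (f - ?f) i \<in> P" for i using dmax[of i] is_idealD(1)[OF P] by (auto simp: c)
  show ?thesis
  proof (rule that[of ?f])
    show "?f \<in> polys_over A" by (rule polys_over_intros(4)[OF A f(1)])
    show "lead_coeff ?f \<notin> P" using d deg by (simp add: c)
    show "degree ?f \<le> degree f" using deg b[OF d] by simp
    show "coeff f i - coeff ?f i \<in> P" for i using co[of i] by simp
    show "poly f z - poly ?f z \<in> P" for z using poly_in_ideal[OF P co, of z] by simp
  qed
qed

text \<open>\<open>point_on C \<kappa> P A \<theta>\<close>: a \<open>C\<close>-rational point of the affine variety with coordinate ring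
  \<open>A / (P \<inter> A)\<close>, where \<open>\<kappa>\<close> embeds \<open>C\<close>.\<close>

definition point_on :: "'e::field set \<Rightarrow> ('e \<Rightarrow> 't::comm_ring_1) \<Rightarrow> 't set \<Rightarrow> 't set \<Rightarrow> ('t \<Rightarrow> 'e) \<Rightarrow> bool" where
  "point_on C \<kappa> P A \<theta> \<longleftrightarrow> (\<forall>x\<in>A. \<theta> x \<in> C) \<and> (\<forall>c\<in>C. \<theta> (\<kappa> c) = c) \<and> (\<forall>x\<in>A \<inter> P. \<theta> x = 0) \<and>
     (\<forall>x\<in>A. \<forall>y\<in>A. \<theta> (x + y) = \<theta> x + \<theta> y \<and> \<theta> (x * y) = \<theta> x * \<theta> y)"

lemma point_onD:
  assumes "point_on C \<kappa> P A \<theta>"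
  shows "x \<in> A \<Longrightarrow> \<theta> x \<in> C" "c \<in> C \<Longrightarrow> \<theta> (\<kappa> c) = c" "x \<in> A \<Longrightarrow> x \<in> P \<Longrightarrow> \<theta> x = 0"
    "x \<in> A \<Longrightarrow> y \<in> A \<Longrightarrow> \<theta> (x + y) = \<theta> x + \<theta> y" "x \<in> A \<Longrightarrow> y \<in> A \<Longrightarrow> \<theta> (x * y) = \<theta> x * \<theta> y"
  using assms by (auto simp: point_on_def)

context
  fixes C :: "'e::field set" and \<kappa> :: "'e \<Rightarrow> 't::comm_ring_1" and P :: "'t set"
  assumes C: "is_subfield C" "infinite C" "algebraically_closed_subfield C"
    and \<kappa>: "comm_ring_hom \<kappa>" and P: "is_prime_ideal P"
begin

interpretation \<kappa>: comm_ring_hom \<kappa> by (fact \<kappa>)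

lemma prime_facts: "is_ideal P" "1 \<notin> P" "x * y \<in> P \<Longrightarrow> x \<in> P \<or> y \<in> P"
  using P by (auto simp: is_prime_ideal_def)

lemma prime_power: "x \<notin> P \<Longrightarrow> x ^ n \<notin> P"
  by (induct n) (auto simp: prime_facts dest: prime_facts(3))

text \<open>P contains no unit, hence no \<kappa>(c) with c nonzero. So \<kappa> is injective and
  its inverse is the point.\<close>

lemma point_on_base:
  obtains \<theta> where "point_on C \<kappa> P (\<kappa> ` C) \<theta>"
proof -
  have K: "c = 0" if "\<kappa> c \<in> P" for c
  proof (rule ccontr)
    assume "c \<noteq> 0"
    then have "1 = \<kappa> (inverse c) * \<kappa> c" by (simp flip: \<kappa>.hom_mult)
    then show False using prime_facts is_idealD(3)[OF prime_facts(1) that] by metis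
  qed
  have "inj \<kappa>"
  proof (rule injI)
    fix x y assume "\<kappa> x = \<kappa> y"
    then have "\<kappa> (x - y) \<in> P" using is_idealD(1)[OF prime_facts(1)] by (simp add: \<kappa>.hom_minus)
    then show "x = y" using K by fastforce
  qed
  then have i: "inv_into UNIV \<kappa> (\<kappa> c) = c" for c by simp
  show ?thesis
    by (rule that[of "inv_into UNIV \<kappa>"]) (auto simp: point_on_def i K simp flip: \<kappa>.hom_add \<kappa>.hom_mult)
qed

text \<open>The extension sends z to t. \<open>kills\<close> asks that every relation of z over A
  modulo P become a relation of t; as 0 lies in P, exact relations are covered too, and \<theta>'
  does not depend on the polynomial chosen to represent an element.\<close>

lemma point_on_adjoin:
  assumes A: "is_subring A" "\<kappa> ` C \<subseteq> A" and \<theta>: "point_on C \<kappa> P A \<theta>" and t: "t \<in> C"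
    and kills: "\<And>p. p \<in> polys_over A \<Longrightarrow> poly p z \<in> P \<Longrightarrow> poly (map_poly \<theta> p) t = 0"
  obtains \<theta>' where "point_on C \<kappa> P (adjoin A z) \<theta>'"
    "\<And>p. p \<in> polys_over A \<Longrightarrow> \<theta>' (poly p z) = poly (map_poly \<theta> p) t"
proof -
  note X = point_onD[OF \<theta>]
  note S = is_subringD[OF A(1)] and PS = is_subringD[OF is_subring_polys_over[OF A(1)]]
  have c0: "\<theta> 0 = 0" using X(2)[of 0] is_subfieldD(1)[OF C(1)] by simp
  have csum: "\<theta> (\<Sum>i\<in>I. f i) = (\<Sum>i\<in>I. \<theta> (f i))" if "\<And>i. i \<in> I \<Longrightarrow> f i \<in> A" for I and f :: "nat \<Rightarrow> 't"
    using that by (induct I rule: infinite_finite_induct) (auto simp: c0 X(4) is_subring_sum[OF A(1)])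
  have add: "map_poly \<theta> (p + q) = map_poly \<theta> p + map_poly \<theta> q"
    if "p \<in> polys_over A" "q \<in> polys_over A" for p q
    using that X(4) by (intro poly_eqI) (auto simp: coeff_map_poly c0 polys_over_def)
  have mult: "map_poly \<theta> (p * q) = map_poly \<theta> p * map_poly \<theta> q"
    if "p \<in> polys_over A" "q \<in> polys_over A" for p q
  proof (rule poly_eqI)
    fix n
    have "\<theta> (coeff (p * q) n) = (\<Sum>i\<le>n. \<theta> (coeff p i * coeff q (n - i)))"
      unfolding coeff_mult using that S by (intro csum) (auto simp: polys_over_def)
    also have "\<dots> = coeff (map_poly \<theta> p * map_poly \<theta> q) n"
      unfolding coeff_mult using that X(5) by (intro sum.cong) (auto simp: coeff_map_poly c0 polys_over_def)
    finally show "coeff (map_poly \<theta> (p * q)) n = coeff (map_poly \<theta> p * map_poly \<theta> q) n"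
      by (simp add: coeff_map_poly c0)
  qed
  define \<theta>' where "\<theta>' x = poly (map_poly \<theta> (SOME p. p \<in> polys_over A \<and> x = poly p z)) t" for x
  have val: "\<theta>' (poly p z) = poly (map_poly \<theta> p) t" if p: "p \<in> polys_over A" for p
  proof -
    let ?Q = "\<lambda>p'. p' \<in> polys_over A \<and> poly p z = poly p' z"
    let ?p = "SOME p'. ?Q p'"
    have Q: "?Q ?p" by (rule someI[of ?Q p]) (simp add: p)
    have d: "?p - p \<in> polys_over A" using Q p PS by blast
    have "poly (?p - p) z \<in> P" using Q is_idealD(1)[OF prime_facts(1)] by simp
    then have "poly (map_poly \<theta> (?p - p)) t = 0" using kills d by blast
    moreover have "map_poly \<theta> ?p = map_poly \<theta> (?p - p) + map_poly \<theta> p"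
      using add[OF d p] by simp
    ultimately show ?thesis unfolding \<theta>'_def by simp
  qed
  have "point_on C \<kappa> P (adjoin A z) \<theta>'"
    unfolding point_on_def
  proof (intro conjI ballI)
    fix x assume "x \<in> adjoin A z"
    then obtain p where p: "p \<in> polys_over A" "x = poly p z" by (auto simp: adjoin_def)
    have "coeff (map_poly \<theta> p) i \<in> C" for i using p X(1) by (auto simp: coeff_map_poly c0 polys_over_def)
    moreover have tn: "t ^ n \<in> C" for n by (induct n) (auto intro: is_subfieldD[OF C(1)] t)
    ultimately show "\<theta>' x \<in> C" unfolding p(2) val[OF p(1)] unfolding poly_altdef
      by (intro is_subfield_sum[OF C(1)] is_subfieldD(5)[OF C(1)])
    fix y assume "y \<in> adjoin A z"
    then obtain q where q: "q \<in> polys_over A" "y = poly q z" by (auto simp: adjoin_def)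
    have "x + y = poly (p + q) z" "x * y = poly (p * q) z" using p q by simp_all
    then show "\<theta>' (x + y) = \<theta>' x + \<theta>' y" "\<theta>' (x * y) = \<theta>' x * \<theta>' y"
      using p q val PS add mult by (metis poly_add, metis poly_mult)
  next
    fix c assume c: "c \<in> C"
    have "[:\<kappa> c:] \<in> polys_over A" using polys_over_intros(2)[OF A(1)] A(2) c by blast
    from val[OF this] show "\<theta>' (\<kappa> c) = c" using X(2)[OF c] by (simp add: c0 map_poly_pCons)
  next
    fix x assume "x \<in> adjoin A z \<inter> P"
    then obtain p where p: "p \<in> polys_over A" "x = poly p z" "x \<in> P" by (auto simp: adjoin_def)
    then show "\<theta>' x = 0" using val kills by simp
  qed
  then show ?thesis using that val by blast
qed

text \<open>If \<open>z\<close> is algebraic modulo \<open>P\<close> over \<open>A\<close>, with minimal relation \<open>f\<close>, then the elements of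
  \<open>A[z]\<close> outside \<open>P\<close> divide elements of \<open>A\<close> outside \<open>P\<close>.\<close>

lemma divides_base_element:
  assumes A: "is_subring A" and f: "f \<in> polys_over A" "poly f z \<in> P" "lead_coeff f \<notin> P" "degree f > 0"
    and min: "\<And>r. r \<in> polys_over A \<Longrightarrow> poly r z \<in> P \<Longrightarrow> degree r < degree f \<Longrightarrow> (\<forall>i. coeff r i \<in> P)"
    and h: "h \<in> polys_over A" "poly h z \<notin> P"
  obtains w v where "w \<in> A" "w \<notin> P" "v \<in> polys_over A" "w - poly v z * poly h z \<in> P"
proof -
  note I = is_idealD[OF prime_facts(1)]
  note PO = polys_over_intros[OF A] and S = is_subringD[OF A] and PS = is_subringD[OF is_subring_polys_over[OF A]]
  \<comment> \<open>N collects the polynomials of degree below f, not vanishing modulo P, that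
    represent multiples of h(z). As in the Euclidean algorithm, a member of least degree turns out
    to be a constant w.\<close>
  define N where "N r \<longleftrightarrow> r \<in> polys_over A \<and> lead_coeff r \<notin> P \<and> degree r < degree f \<and>
      (\<exists>v\<in>polys_over A. poly r z - poly v z * poly h z \<in> P)" for r
  have cut: "\<exists>r'. N r' \<and> degree r' \<le> degree r" if r: "r \<in> polys_over A" "\<exists>i. coeff r i \<notin> P" "degree r < degree f"
      "v \<in> polys_over A" "poly r z - poly v z * poly h z \<in> P" for r v
  proof -
    obtain r' where r': "r' \<in> polys_over A" "lead_coeff r' \<notin> P" "degree r' \<le> degree r" "poly r z - poly r' z \<in> P"
      using cutoff_leading[OF prime_facts(1) A r(1,2)] by metis
    have "poly r' z - poly v z * poly h z = (poly r z - poly v z * poly h z) - (poly r z - poly r' z)" by simp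
    then have "poly r' z - poly v z * poly h z \<in> P" using I(6)[OF r(5) r'(4)] by simp
    then show ?thesis unfolding N_def using r r' by (intro exI[of _ r']) auto
  qed
  have "\<exists>r. N r"
  proof -
    obtain k u r where r: "u \<in> polys_over A" "r \<in> polys_over A"
      "smult (lead_coeff f ^ k) h = f * u + r" "degree r < degree f"
      using pseudo_division_over[OF A f(1,4) h(1)] by blast
    have e: "lead_coeff f ^ k * poly h z = poly f z * poly u z + poly r z"
      using arg_cong[OF r(3), of "\<lambda>p. poly p z"] by simp
    have "poly r z \<notin> P"
    proof
      assume "poly r z \<in> P"
      then have "lead_coeff f ^ k * poly h z \<in> P" unfolding e using I f by blast
      then show False using prime_facts(3) prime_power[OF f(3)] h by blast
    qed
    then have "\<exists>i. coeff r i \<notin> P" using poly_in_ideal[OF prime_facts(1)] by blast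
    moreover have "poly r z - poly [:lead_coeff f ^ k:] z * poly h z = - (poly f z * poly u z)"
      using e by simp
    moreover have "- (poly f z * poly u z) \<in> P" using I f by blast
    moreover have "[:lead_coeff f ^ k:] \<in> polys_over A" by (intro PO is_subring_power[OF A] f)
    ultimately show ?thesis using cut[OF r(2) _ r(4)] by metis
  qed
  then obtain r where r: "N r" and rmin: "\<And>r'. N r' \<Longrightarrow> degree r \<le> degree r'"
    using ex_has_least_nat[of N _ degree] by metis
  obtain v where v: "v \<in> polys_over A" "poly r z - poly v z * poly h z \<in> P"
    and r': "r \<in> polys_over A" "lead_coeff r \<notin> P" "degree r < degree f" using r by (auto simp: N_def)
  have rz: "poly r z \<notin> P" using min[OF r'(1)] r' by blast
  \<comment> \<open>Otherwise divide f by r. By minimality of r the remainder vanishes modulo P, so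
    f is r s modulo P up to a factor outside P. Then s(z) lies in P, so s has at least the degree of
    f by minimality of f, and r s has too large a degree.\<close>
  have "degree r = 0"
  proof (rule ccontr)
    assume "degree r \<noteq> 0"
    then have "degree r > 0" by simp
    then obtain k s r2 where s: "s \<in> polys_over A" "r2 \<in> polys_over A"
      "smult (lead_coeff r ^ k) f = r * s + r2" "degree r2 < degree r"
      using pseudo_division_over[OF A r'(1) _ f(1)] by blast
    have e: "lead_coeff r ^ k * poly f z = poly r z * poly s z + poly r2 z"
      using arg_cong[OF s(3), of "\<lambda>p. poly p z"] by simp
    have r2P: "coeff r2 i \<in> P" for i
    proof (rule ccontr)
      assume n: "coeff r2 i \<notin> P"
      have "poly r2 z - poly (- (s * v)) z * poly h z
          = lead_coeff r ^ k * poly f z - poly s z * (poly r z - poly v z * poly h z)"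
        unfolding e by (simp add: algebra_simps)
      also have "\<dots> \<in> P" by (intro I(6) I(3) f(2) v(2))
      finally have "poly r2 z - poly (- (s * v)) z * poly h z \<in> P" .
      moreover have "- (s * v) \<in> polys_over A" using PS(4)[OF PS(1) PS(5)[OF s(1) v(1)]] by simp
      ultimately obtain r3 where "N r3" "degree r3 \<le> degree r2"
        using cut[OF s(2) _ _ , of "- (s * v)"] n s(4) r'(3) by force
      then show False using rmin s(4) by fastforce
    qed
    then have "poly r2 z \<in> P" by (rule poly_in_ideal[OF prime_facts(1)])
    moreover have "poly r z * poly s z = lead_coeff r ^ k * poly f z - poly r2 z" using e by simp
    ultimately have "poly r z * poly s z \<in> P" using I f by metis
    then have sz: "poly s z \<in> P" using prime_facts(3) rz by blast
    have lf: "lead_coeff r ^ k * lead_coeff f \<notin> P" using prime_facts(3) prime_power[OF r'(2)] f(3) by blast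
    have cf: "coeff (smult (lead_coeff r ^ k) f - r * s) i \<in> P" for i using s(3) r2P by simp
    have "\<exists>i. coeff s i \<notin> P"
    proof (rule ccontr)
      assume "\<nexists>i. coeff s i \<notin> P"
      then have "coeff (r * s) (degree f) \<in> P" unfolding coeff_mult by (intro is_ideal_sum[OF prime_facts(1)] I(3)) auto
      then have "lead_coeff r ^ k * lead_coeff f \<in> P" using I(2)[OF cf[of "degree f"]] by fastforce
      then show False using lf by blast
    qed
    then obtain s' where s': "s' \<in> polys_over A" "lead_coeff s' \<notin> P" "\<And>i. coeff s i - coeff s' i \<in> P"
      "poly s z - poly s' z \<in> P"
      using cutoff_leading[OF prime_facts(1) A s(1)] by metis
    have "poly s' z \<in> P" using I(6)[OF sz s'(4)] by simp
    then have ds: "degree s' \<ge> degree f" using min[OF s'(1)] s'(2) by force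
    let ?n = "degree r + degree s'"
    have "coeff (r * s) ?n - coeff (r * s') ?n = coeff (r * (s - s')) ?n" by (simp add: right_diff_distrib)
    also have "\<dots> \<in> P" unfolding coeff_mult using s'(3) by (intro is_ideal_sum[OF prime_facts(1)] I(3)) auto
    finally have 1: "coeff (r * s) ?n - coeff (r * s') ?n \<in> P" .
    have "coeff f ?n = 0" using ds \<open>degree r > 0\<close> by (intro coeff_eq_0) simp
    then have "coeff (r * s) ?n \<in> P" using I(5)[OF cf[of ?n]] by simp
    then have "coeff (r * s') ?n \<in> P" using I(6)[OF _ 1] by fastforce
    then show False using prime_facts(3) r'(2) s'(2) by (auto simp: coeff_mult_degree_sum)
  qed
  then obtain w where w: "r = [:w:]" by (meson degree_eq_zeroE)
  show ?thesis
    using that[of w v] r' v PO(5)[OF r'(1), of 0] unfolding w by auto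
qed

text \<open>If z satisfies no relation over A modulo P, any t in the infinite field C that is not a
  root of the specialised h will do. Otherwise take a relation f of least degree and, by
  \<open>divides_base_element\<close>, a multiple w of q in A; a point of A with
  \<open>lead_coeff f * w\<close> nonzero extends by a root t of the specialised f, and \<theta>(w)
  nonzero forces \<theta>'(q) nonzero.\<close>

lemma point_on_extend:
  assumes A: "is_subring A" "\<kappa> ` C \<subseteq> A"
    and IH: "\<And>q. q \<in> A \<Longrightarrow> q \<notin> P \<Longrightarrow> \<exists>\<theta>. point_on C \<kappa> P A \<theta> \<and> \<theta> q \<noteq> 0"
    and q: "q \<in> adjoin A z" "q \<notin> P"
  shows "\<exists>\<theta>. point_on C \<kappa> P (adjoin A z) \<theta> \<and> \<theta> q \<noteq> 0"
proof -
  note I = is_idealD[OF prime_facts(1)]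
  note PO = polys_over_intros[OF A(1)] and S = is_subringD[OF A(1)] and PS = is_subringD[OF is_subring_polys_over[OF A(1)]]
  obtain h where h: "h \<in> polys_over A" "q = poly h z" using q(1) by (auto simp: adjoin_def)
  have zero: "\<theta> 0 = 0" if "point_on C \<kappa> P A \<theta>" for \<theta>
    using point_onD(2)[OF that, of 0] is_subfieldD(1)[OF C(1)] by simp
  show ?thesis
  proof (cases "\<forall>f\<in>polys_over A. poly f z \<in> P \<longrightarrow> (\<forall>i. coeff f i \<in> P)")
    case True
    obtain i where i: "coeff h i \<notin> P" using q(2) h poly_in_ideal[OF prime_facts(1)] by blast
    obtain \<theta> where \<theta>: "point_on C \<kappa> P A \<theta>" "\<theta> (coeff h i) \<noteq> 0" using IH[OF PO(5)[OF h(1)] i] by blast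
    have "map_poly \<theta> h \<noteq> 0" using \<theta> zero[OF \<theta>(1)] by (metis coeff_0 coeff_map_poly)
    then have "finite {t. poly (map_poly \<theta> h) t = 0}" by (rule poly_roots_finite)
    then obtain t where t: "t \<in> C" "poly (map_poly \<theta> h) t \<noteq> 0"
      using C(2) by (metis (mono_tags, lifting) finite_subset mem_Collect_eq subsetI)
    have "poly (map_poly \<theta> p) t = 0" if "p \<in> polys_over A" "poly p z \<in> P" for p
    proof -
      have "map_poly \<theta> p = 0" using True that point_onD(3)[OF \<theta>(1)] zero[OF \<theta>(1)]
        by (intro poly_eqI) (auto simp: coeff_map_poly polys_over_def)
      then show ?thesis by simp
    qed
    from point_on_adjoin[OF A \<theta>(1) t(1) this] show ?thesis using t h by metis
  next
    case False
    define M where "M f \<longleftrightarrow> f \<in> polys_over A \<and> poly f z \<in> P \<and> lead_coeff f \<notin> P" for f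
    have cut: "\<exists>f'. M f' \<and> degree f' \<le> degree f" if f: "f \<in> polys_over A" "poly f z \<in> P" "\<exists>i. coeff f i \<notin> P" for f
    proof -
      obtain f' where "f' \<in> polys_over A" "lead_coeff f' \<notin> P" "degree f' \<le> degree f" "poly f z - poly f' z \<in> P"
        using cutoff_leading[OF prime_facts(1) A(1) f(1,3)] by metis
      then show ?thesis using I(6)[OF f(2), of "poly f z - poly f' z"] by (auto simp: M_def)
    qed
    have "\<exists>f. M f" using False cut by blast
    then obtain f where f: "M f" and fmin: "\<And>f'. M f' \<Longrightarrow> degree f \<le> degree f'"
      using ex_has_least_nat[of M _ degree] by metis
    have f': "f \<in> polys_over A" "poly f z \<in> P" "lead_coeff f \<notin> P" using f by (auto simp: M_def)
    have min: "coeff r i \<in> P" if "r \<in> polys_over A" "poly r z \<in> P" "degree r < degree f" for r i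
      using cut[OF that(1,2)] fmin that(3) by force
    have pos: "degree f > 0"
    proof (rule ccontr)
      assume "\<not> degree f > 0"
      then obtain a where "f = [:a:]" using degree_eq_zeroE by auto
      then show False using f' by simp
    qed
    obtain w v where w: "w \<in> A" "w \<notin> P" "v \<in> polys_over A" "w - poly v z * poly h z \<in> P"
      using divides_base_element[OF A(1) f' pos _ h(1)] min h q by blast
    have "lead_coeff f * w \<notin> P" using prime_facts(3) f' w by blast
    then obtain \<theta> where \<theta>: "point_on C \<kappa> P A \<theta>" "\<theta> (lead_coeff f * w) \<noteq> 0"
      using IH S(5)[OF PO(5)[OF f'(1)] w(1)] by blast
    note X = point_onD[OF \<theta>(1)] and z0 = zero[OF \<theta>(1)]
    have nz: "\<theta> (lead_coeff f) \<noteq> 0" "\<theta> w \<noteq> 0" using \<theta>(2) X(5)[OF PO(5)[OF f'(1)] w(1)] by auto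
    have "degree (map_poly \<theta> f) = degree f" using nz(1) z0
      by (intro antisym degree_le le_degree) (auto simp: coeff_map_poly coeff_eq_0)
    moreover have "coeff (map_poly \<theta> f) i \<in> C" for i using f'(1) X(1) z0 by (auto simp: coeff_map_poly polys_over_def)
    ultimately obtain t where t: "t \<in> C" "poly (map_poly \<theta> f) t = 0"
      using C(3) pos unfolding algebraically_closed_subfield_def by metis
    have csum: "\<theta> (\<Sum>i\<in>I. f i) = (\<Sum>i\<in>I. \<theta> (f i))" if "\<And>i. i \<in> I \<Longrightarrow> f i \<in> A" for I and f :: "nat \<Rightarrow> 't"
      using that by (induct I rule: infinite_finite_induct) (auto simp: z0 X(4) is_subring_sum[OF A(1)])
    have mult: "map_poly \<theta> (p * q) = map_poly \<theta> p * map_poly \<theta> q" if "p \<in> polys_over A" "q \<in> polys_over A" for p q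
    proof (rule poly_eqI)
      fix n
      have "\<theta> (coeff (p * q) n) = (\<Sum>i\<le>n. \<theta> (coeff p i * coeff q (n - i)))"
        unfolding coeff_mult using that S by (intro csum) (auto simp: polys_over_def)
      also have "\<dots> = coeff (map_poly \<theta> p * map_poly \<theta> q) n"
        unfolding coeff_mult using that X(5) by (intro sum.cong) (auto simp: coeff_map_poly z0 polys_over_def)
      finally show "coeff (map_poly \<theta> (p * q)) n = coeff (map_poly \<theta> p * map_poly \<theta> q) n"
        by (simp add: coeff_map_poly z0)
    qed
    \<comment> \<open>Pseudo-division by f leaves a remainder whose coefficients lie in P, by
      minimality of f. Applying \<theta> gives a multiple of the specialised f, which vanishes at t,
      and the power of the leading coefficient can be cancelled.\<close>
    have kills: "poly (map_poly \<theta> p) t = 0" if p: "p \<in> polys_over A" "poly p z \<in> P" for p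
    proof -
      obtain k u r where r: "u \<in> polys_over A" "r \<in> polys_over A"
        "smult (lead_coeff f ^ k) p = f * u + r" "degree r < degree f"
        using pseudo_division_over[OF A(1) f'(1) pos p(1)] by blast
      have "lead_coeff f ^ k * poly p z = poly f z * poly u z + poly r z"
        using arg_cong[OF r(3), of "\<lambda>p. poly p z"] by simp
      then have "poly r z = lead_coeff f ^ k * poly p z - poly f z * poly u z" by simp
      then have "poly r z \<in> P" using I p f' by metis
      then have rP: "\<And>i. coeff r i \<in> P" using min[OF r(2)] r(4) by blast
      let ?l = "[:lead_coeff f ^ k:]"
      have lk: "lead_coeff f ^ k \<in> A" by (intro is_subring_power[OF A(1)] PO f')
      have l: "?l \<in> polys_over A" by (intro PO lk)
      have fu: "f * u \<in> polys_over A" using PS f' r by blast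
      have "map_poly \<theta> ?l * map_poly \<theta> p = map_poly \<theta> (?l * p)" using mult[OF l p(1)] by simp
      also have "?l * p = f * u + r" using r(3) by simp
      also have "map_poly \<theta> (f * u + r) = map_poly \<theta> (f * u)"
        using X(3,4) rP r(2) fu z0 by (intro poly_eqI) (auto simp: coeff_map_poly polys_over_def)
      also have "\<dots> = map_poly \<theta> f * map_poly \<theta> u" by (rule mult[OF f'(1) r(1)])
      finally have "poly (map_poly \<theta> ?l) t * poly (map_poly \<theta> p) t = 0" using t(2) by (metis mult_zero_left poly_mult)
      moreover have "\<theta> (lead_coeff f ^ k) \<noteq> 0"
      proof (induct k)
        case 0
        then show ?case using X(2)[of 1] is_subfieldD(2)[OF C(1)] \<kappa>.hom_one by simp
      next
        case (Suc k)
        then show ?case using X(5)[OF PO(5)[OF f'(1)] is_subring_power[OF A(1) PO(5)[OF f'(1)]]] nz(1) by simp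
      qed
      ultimately show ?thesis by (simp add: map_poly_pCons z0)
    qed
    obtain \<theta>' where \<theta>': "point_on C \<kappa> P (adjoin A z) \<theta>'"
      "\<And>p. p \<in> polys_over A \<Longrightarrow> \<theta>' (poly p z) = poly (map_poly \<theta> p) t"
      using point_on_adjoin[OF A \<theta>(1) t(1) kills] by blast
    note X' = point_onD[OF \<theta>'(1)] and B = is_subringD[OF is_subring_adjoin(1)[OF A(1), of z]]
    have vq: "poly v z * q \<in> adjoin A z" using B(5)[of "poly v z" q] q(1) w(3) by (auto simp: adjoin_def)
    have wB: "w \<in> adjoin A z" using w is_subring_adjoin(2)[OF A(1)] by blast
    have "\<theta>' w = \<theta>' (w - poly v z * q) + \<theta>' (poly v z * q)"
      using X'(4)[OF B(4)[OF wB vq] vq] by simp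
    also have "\<theta>' (w - poly v z * q) = 0" using X'(3)[OF B(4)[OF wB vq]] w(4) h by simp
    also have "\<theta>' (poly v z * q) = \<theta>' (poly v z) * \<theta>' q" using X'(5) q(1) w(3) by (auto simp: adjoin_def)
    finally have "\<theta>' w = \<theta>' (poly v z) * \<theta>' q" by simp
    moreover have "\<theta>' w = \<theta> w" using \<theta>'(2)[OF PO(2)[OF w(1)]] by (simp add: map_poly_pCons z0)
    ultimately show ?thesis using \<theta>' nz by (intro exI[of _ \<theta>']) auto
  qed
qed

end

fun adjoin_list :: "'t::comm_ring_1 set \<Rightarrow> 't list \<Rightarrow> 't set" where
  "adjoin_list A [] = A"
| "adjoin_list A (z # zs) = adjoin (adjoin_list A zs) z"

lemma adjoin_list:
  assumes "is_subring A"
  shows "is_subring (adjoin_list A zs)" "A \<subseteq> adjoin_list A zs" "set zs \<subseteq> adjoin_list A zs"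
  using assms by (induct zs) (use is_subring_adjoin in \<open>auto, blast+\<close>)

text \<open>A form of Hilbert's Nullstellensatz.\<close>

theorem rational_point_exists:
  fixes C :: "'e::field set" and \<kappa> :: "'e \<Rightarrow> 't::comm_ring_1"
  assumes C: "is_subfield C" "infinite C" "algebraically_closed_subfield C" and \<kappa>: "comm_ring_hom \<kappa>"
    and J: "is_ideal J" and q: "q \<in> adjoin_list (\<kappa> ` C) zs" "\<And>n. q ^ n \<notin> J"
  obtains \<theta> where "point_on C \<kappa> J (adjoin_list (\<kappa> ` C) zs) \<theta>" "\<theta> q \<noteq> 0"
proof -
  interpret \<kappa>: comm_ring_hom \<kappa> by (fact \<kappa>)
  obtain P where P: "is_prime_ideal P" "J \<subseteq> P" "q \<notin> P" using prime_ideal_avoiding_powers[OF J q(2)] by blast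
  have sub: "is_subring (\<kappa> ` C)"
    unfolding is_subring_def using is_subfieldD[OF C(1)]
    by (auto simp flip: \<kappa>.hom_add \<kappa>.hom_mult \<kappa>.hom_minus) (metis \<kappa>.hom_zero \<kappa>.hom_one imageI)+
  have "\<exists>\<theta>. point_on C \<kappa> P (adjoin_list (\<kappa> ` C) zs) \<theta> \<and> \<theta> q \<noteq> 0"
    using q(1) P(3)
  proof (induct zs arbitrary: q)
    case Nil
    obtain \<theta> where \<theta>: "point_on C \<kappa> P (\<kappa> ` C) \<theta>" using point_on_base[OF C \<kappa> P(1)] by blast
    obtain c where c: "c \<in> C" "q = \<kappa> c" using Nil by auto
    then have "c \<noteq> 0" using Nil(2) is_idealD(1)[of P] P(1) by (auto simp: is_prime_ideal_def)
    then show ?case using \<theta> c point_onD(2)[OF \<theta> c(1)] by (intro exI[of _ \<theta>]) auto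
  next
    case (Cons z zs)
    show ?case using point_on_extend[OF C \<kappa> P(1) adjoin_list(1,2)[OF sub] Cons(1)] Cons(2,3) by auto
  qed
  then show ?thesis using that P(2) unfolding point_on_def by blast
qed

section \<open>The tensor square of a differential field extension\<close>

lemma adjoin_list_minimal:
  assumes "is_subring S" "A \<subseteq> S" "set zs \<subseteq> S"
  shows "adjoin_list A zs \<subseteq> S"
  using assms(3)
proof (induct zs)
  case (Cons z zs)
  then have sub: "adjoin_list A zs \<subseteq> S" and z: "z \<in> S" by auto
  show ?case
  proof
    fix x assume "x \<in> adjoin_list A (z # zs)"
    then obtain p where p: "\<And>i. coeff p i \<in> adjoin_list A zs" "x = poly p z"
      by (auto simp: adjoin_def polys_over_def)
    then show "x \<in> S" unfolding p(2) poly_altdef using sub z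
      by (intro is_subring_sum[OF assms(1)] is_subringD(5)[OF assms(1)] is_subring_power[OF assms(1)]) auto
  qed
qed (use assms in simp)

lemma lin_indep_nonzero:
  assumes e: "lin_indep S I e" and fin: "finite I" and k: "k \<in> I" and S: "0 \<in> S" "1 \<in> S"
  shows "e k \<noteq> 0"
proof
  assume "e k = 0"
  then have "(\<Sum>j\<in>I. (if j = k then 1 else 0) * e j) = 0" by (intro sum.neutral) auto
  then have "(if k = k then 1 else 0 :: 'a) = 0" by (rule lin_indepD[OF e, rotated]) (use S k in auto)
  then show False by simp
qed

lemma map_poly_ring_hom:
  assumes "comm_ring_hom h"
  shows "map_poly h (p + q) = map_poly h p + map_poly h q" "map_poly h (p * q) = map_poly h p * map_poly h q"
proof -
  interpret comm_ring_hom h by fact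
  show "map_poly h (p + q) = map_poly h p + map_poly h q"
    by (rule poly_eqI) (simp add: coeff_map_poly hom_add)
  show "map_poly h (p * q) = map_poly h p * map_poly h q"
    by (rule poly_eqI) (simp add: coeff_map_poly coeff_mult hom_sum hom_mult)
qed

lemma poly_altdef_le:
  fixes p :: "'a::comm_ring_1 poly"
  assumes "degree p \<le> n"
  shows "poly p x = (\<Sum>i\<le>n. coeff p i * x ^ i)"
  unfolding poly_altdef using assms by (intro sum.mono_neutral_left) (auto simp: coeff_eq_0)

lemma vector_space_field_hom:
  assumes "field_hom (\<iota> :: 'k::field \<Rightarrow> 'e::field)"
  shows "vector_space (\<lambda>c x. \<iota> c * x)"
proof -
  interpret field_hom \<iota> by fact
  show ?thesis by unfold_locales (auto simp: algebra_simps hom_add hom_mult)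
qed

definition klinear :: "('k::field \<Rightarrow> 'e::field) \<Rightarrow> ('e \<Rightarrow> 'e) \<Rightarrow> bool" where
  "klinear \<iota> f \<longleftrightarrow> (\<forall>x y. f (x + y) = f x + f y) \<and> (\<forall>c x. f (\<iota> c * x) = \<iota> c * f x)"

lemma klinearD:
  assumes "klinear \<iota> f"
  shows "f (x + y) = f x + f y" "f (\<iota> c * x) = \<iota> c * f x" "f 0 = 0"
proof -
  show 1: "f (x + y) = f x + f y" "f (\<iota> c * x) = \<iota> c * f x" for x y using assms by (auto simp: klinear_def)
  show "f 0 = 0" using 1(1)[of 0 0] by (metis add_0_right add_left_cancel)
qed

text \<open>Extends {x} to a K-basis of E. Applied to coefficients, such a functional turns a
  polynomial over E into a nonzero one over K.\<close>

lemma separating_functional: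
  fixes \<iota> :: "'k::field \<Rightarrow> 'e::field"
  assumes \<iota>: "field_hom \<iota>" and x: "x \<noteq> 0"
  obtains g :: "'e \<Rightarrow> 'k" where "g x = 1" "klinear \<iota> (\<lambda>y. \<iota> (g y))"
proof -
  interpret field_hom \<iota> by fact
  interpret V: vector_space "\<lambda>c x. \<iota> c * x" by (rule vector_space_field_hom[OF \<iota>])
  interpret V2: vector_space_pair "\<lambda>c x. \<iota> c * x" "(*) :: 'k \<Rightarrow> 'k \<Rightarrow> 'k" by unfold_locales (auto simp: algebra_simps)
  have "V.independent {x}" using x by simp
  from V2.linear_independent_extend[OF this, of "\<lambda>_. 1"]
  obtain g where g: "Vector_Spaces.linear (\<lambda>c x. \<iota> c * x) (*) g" "g x = 1" by auto
  have "klinear \<iota> (\<lambda>y. \<iota> (g y))" unfolding klinear_def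
    using V2.linear_add[OF g(1)] V2.linear_scale[OF g(1)] by (simp add: hom_add hom_mult)
  then show ?thesis using that g by blast
qed

text \<open>In the polynomial ring over \<open>E\<close> with one variable for each element of \<open>E\<close>, the variable of \<open>e\<close>
  stands for \<open>1 \<otimes> e\<close> and the scalar \<open>e\<close> for \<open>e \<otimes> 1\<close>.  The polynomials which vanish in
  \<open>E \<otimes>\<^sub>K E\<close> are detected by the maps \<open>\<lambda> \<otimes> 1\<close>, for \<open>K\<close>-linear \<open>\<lambda>\<close>, followed by multiplication.\<close>

definition tensor_kernel :: "('k::field \<Rightarrow> 'e::field) \<Rightarrow> (('e \<Rightarrow>\<^sub>0 nat) \<Rightarrow>\<^sub>0 'e) set" where
  "tensor_kernel \<iota> = {h. \<forall>f. klinear \<iota> f \<longrightarrow> peval f (\<lambda>x. x) h = 0}"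

lemma peval_klinear:
  assumes "klinear \<iota> f"
  shows "peval f x (p + q) = peval f x p + peval f x q" "peval f x (pconst c) = f c"
    "peval f x (pvar v * p) = x v * peval f x p" "peval f x 0 = 0" "peval f x (p - q) = peval f x p - peval f x q"
    "peval f x (pvar v) = x v * f 1" "peval f x (- p) = - peval f x p"
proof -
  note L = klinearD[OF assms]
  show 1: "peval f x (p + q) = peval f x p + peval f x q" for p q by (rule peval_add[of f, OF L(3,1)])
  show "peval f x (pconst c) = f c" by (rule peval_pconst[of f, OF L(3,1)])
  show 2: "peval f x (pvar v * p) = x v * peval f x p" for p by (rule peval_pvar_mult[of f, OF L(3,1)])
  show "peval f x 0 = 0" by (simp add: peval_def)
  show 3: "peval f x (p - q) = peval f x p - peval f x q" for p q using 1[of "p - q" q] by (simp add: eq_diff_eq)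
  show "peval f x (- p) = - peval f x p" using 3[of 0 p] by (simp add: peval_def[of f x 0])
  have "peval f x (pconst 1) = f 1" by (rule peval_pconst[of f, OF L(3,1)])
  then show "peval f x (pvar v) = x v * f 1" using 2[of 1] by (simp add: pconst_def)
qed

lemma klinear_mult_left: "klinear \<iota> f \<Longrightarrow> klinear \<iota> (\<lambda>x. f (e * x))"
  unfolding klinear_def by (auto simp: distrib_left) (metis mult.left_commute)

text \<open>A scalar factor is absorbed by the functional, which stays K-linear. Quantifying over
  all functionals is what makes \<open>tensor_kernel\<close> an ideal.\<close>

lemma peval_klinear_pconst_mult:
  assumes f: "klinear \<iota> f"
  shows "peval f x (pconst c * p) = peval (\<lambda>y. f (c * y)) x p"
proof (induct p rule: mpoly_induct)
  case (const a)
  interpret comm_ring_hom "pconst :: 'b \<Rightarrow> ('c \<Rightarrow>\<^sub>0 nat) \<Rightarrow>\<^sub>0 'b" by (rule comm_ring_hom_pconst)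
  show ?case
    by (simp only: hom_mult[symmetric] peval_klinear(2)[OF f] peval_klinear(2)[OF klinear_mult_left[OF f]])
next
  case (add p q)
  then show ?case by (simp only: distrib_left peval_klinear(1)[OF f] peval_klinear(1)[OF klinear_mult_left[OF f]])
next
  case (var v p)
  then show ?case
    by (simp only: mult.left_commute[of _ "pvar v"] peval_klinear(3)[OF f] peval_klinear(3)[OF klinear_mult_left[OF f]])
qed

lemma is_ideal_tensor_kernel: "is_ideal (tensor_kernel \<iota>)"
  unfolding is_ideal_def
proof (intro conjI ballI allI)
  show "0 \<in> tensor_kernel \<iota>" by (simp add: tensor_kernel_def peval_def)
  fix p assume p: "p \<in> tensor_kernel \<iota>"
  show "q \<in> tensor_kernel \<iota> \<Longrightarrow> p + q \<in> tensor_kernel \<iota>" for q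
    using p by (auto simp: tensor_kernel_def peval_klinear)
  show "r * p \<in> tensor_kernel \<iota>" for r
  proof (induct r rule: mpoly_induct)
    case (const c)
    show ?case using p by (auto simp: tensor_kernel_def peval_klinear_pconst_mult klinear_mult_left)
  qed (use p in \<open>auto simp: tensor_kernel_def distrib_right peval_klinear mult.assoc\<close>)
qed

locale differential_tensor_square =
  fixes DK :: "'k::field \<Rightarrow> 'k" and DE :: "'e::field \<Rightarrow> 'e" and \<iota> :: "'k \<Rightarrow> 'e"
  assumes extension: "differential_extension DK DE \<iota>" and char_0: "CHAR('e) = 0"
begin

lemma \<iota>: "field_hom \<iota>" and DE: "derivation DE" and DE_\<iota>: "DE (\<iota> x) = \<iota> (DK x)"
  using extension by (auto simp: differential_extension_def)

sublocale \<iota>: field_hom \<iota> by (rule \<iota>)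

abbreviation J :: "(('e \<Rightarrow>\<^sub>0 nat) \<Rightarrow>\<^sub>0 'e) set" where "J \<equiv> tensor_kernel \<iota>"

abbreviation l :: "'e \<Rightarrow> ('e \<Rightarrow>\<^sub>0 nat) \<Rightarrow>\<^sub>0 'e" where "l \<equiv> pconst"

abbreviation r :: "'e \<Rightarrow> ('e \<Rightarrow>\<^sub>0 nat) \<Rightarrow>\<^sub>0 'e" where "r \<equiv> pvar"

lemma l_hom: "comm_ring_hom l" by (rule comm_ring_hom_pconst)

sublocale l: comm_ring_hom l by (rule l_hom)

lemmas J_ideal = is_idealD[OF is_ideal_tensor_kernel[of \<iota>]]

text \<open>Equality in E \<otimes> E. The quotient ring is not formed as a type; all identities are
  congruences in the polynomial ring.\<close>

definition eqJ (infix "\<approx>" 50) where "x \<approx> y \<longleftrightarrow> x - y \<in> J"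

lemma eqJ_refl [simp]: "x \<approx> x" using J_ideal(1) by (simp add: eqJ_def)

lemma eqJ_sym: "x \<approx> y \<Longrightarrow> y \<approx> x" using J_ideal(5)[of "x - y"] by (simp add: eqJ_def)

lemma eqJ_trans [trans]: "x \<approx> y \<Longrightarrow> y \<approx> z \<Longrightarrow> x \<approx> z"
  using J_ideal(2)[of "x - y" "y - z"] by (simp add: eqJ_def)

lemma eqJ_add: "x \<approx> y \<Longrightarrow> x' \<approx> y' \<Longrightarrow> x + x' \<approx> y + y'"
  using J_ideal(2)[of "x - y" "x' - y'"] by (simp add: eqJ_def algebra_simps)

lemma eqJ_minus: "x \<approx> y \<Longrightarrow> - x \<approx> - y"
  using J_ideal(5)[of "x - y"] by (simp add: eqJ_def)

lemma eqJ_diff: "x \<approx> y \<Longrightarrow> x' \<approx> y' \<Longrightarrow> x - x' \<approx> y - y'"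
  using eqJ_add[of x y "- x'" "- y'"] eqJ_minus by simp

lemma eqJ_mult: "x \<approx> y \<Longrightarrow> x' \<approx> y' \<Longrightarrow> x * x' \<approx> y * y'"
proof -
  assume "x \<approx> y" "x' \<approx> y'"
  then have "(x - y) * x' + y * (x' - y') \<in> J"
    unfolding eqJ_def by (intro J_ideal(2) J_ideal(3) J_ideal(4))
  then show ?thesis by (simp add: eqJ_def algebra_simps)
qed

lemma eqJ_power: "x \<approx> y \<Longrightarrow> x ^ n \<approx> y ^ n"
  by (induct n) (auto intro: eqJ_mult)

lemma eqJ_sum: "(\<And>i. i \<in> I \<Longrightarrow> f i \<approx> g i) \<Longrightarrow> sum f I \<approx> sum g I"
  by (induct I rule: infinite_finite_induct) (auto intro: eqJ_add)

lemma eqJ_in_J: "x \<approx> y \<Longrightarrow> y \<in> J \<Longrightarrow> x \<in> J"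
  using J_ideal(2)[of "x - y" y] by (simp add: eqJ_def)

lemma in_J_iff: "x \<in> J \<longleftrightarrow> x \<approx> 0" by (simp add: eqJ_def)

lemma eqJI: "(\<And>f. klinear \<iota> f \<Longrightarrow> peval f (\<lambda>x. x) p = peval f (\<lambda>x. x) q) \<Longrightarrow> p \<approx> q"
  by (simp add: eqJ_def tensor_kernel_def peval_klinear)

text \<open>\<open>l\<close> is a ring homomorphism, but \<open>r\<close> only names variables.
  Modulo J it becomes a ring homomorphism that agrees with \<open>l\<close> on K, which is the
  content of this and the next lemmas.\<close>

lemma r_add: "r (a + b) \<approx> r a + r b"
  by (rule eqJI) (simp add: peval_klinear distrib_right)

lemma r_mult: "r (a * b) \<approx> r a * r b"
  by (rule eqJI) (simp add: peval_klinear)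

lemma r_\<iota>: "r (\<iota> k) \<approx> l (\<iota> k)"
  by (rule eqJI) (use klinearD(2)[of \<iota> _ k 1] in \<open>simp add: peval_klinear\<close>)

lemma r_1: "r 1 \<approx> 1"
  using r_\<iota>[of 1] by simp

lemma r_0: "r 0 \<approx> 0"
  using r_\<iota>[of 0] by simp

lemma r_sum: "r (sum f I) \<approx> (\<Sum>i\<in>I. r (f i))"
proof (induct I rule: infinite_finite_induct)
  case (insert x F)
  then show ?case using eqJ_trans[OF r_add eqJ_add[OF eqJ_refl insert(3)]] by simp
qed (simp_all add: r_0)

lemma r_minus: "r (- a) \<approx> - r a"
  by (rule eqJI) (simp add: peval_klinear)

text \<open>The identity functional corresponds to the multiplication E \<otimes> E -> E, which
  sends 1 to 1.\<close>

lemma one_not_in_J: "1 \<notin> J"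
proof
  assume "1 \<in> J"
  moreover have "klinear \<iota> (\<lambda>x. x)" by (simp add: klinear_def)
  moreover from this have "peval (\<lambda>x. x) (\<lambda>x. x) (l 1) = (1::'e)" by (rule peval_klinear(2))
  ultimately show False by (auto simp: tensor_kernel_def)
qed

text \<open>A lift of D \<otimes> 1 + 1 \<otimes> D to the polynomial ring.\<close>

definition dT where
  "dT = (SOME d. derivation d \<and> (\<forall>a. d (l a) = l (DE a)) \<and> (\<forall>v. d (r v) = r (DE v)))"

lemma dT: "derivation dT" "dT (l a) = l (DE a)" "dT (r v) = r (DE v)"
  using someI_ex[OF mpoly_derivation_exists[OF DE, of "\<lambda>v. r (DE v)"]] unfolding dT_def by blast+

text \<open>For K-linear f the commutator \<open>?br f\<close> of f with \<open>DE\<close> is again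
  K-linear, although f after \<open>DE\<close> alone need not be. The identity * reduces the
  functional f on \<open>dT h\<close> to functionals on h itself.\<close>

lemma dT_J:
  assumes "h \<in> J"
  shows "dT h \<in> J"
  unfolding tensor_kernel_def
proof (intro CollectI allI impI)
  let ?br = "\<lambda>f x. f (DE x) - DE (f x)"
  have br: "klinear \<iota> (?br f)" if "klinear \<iota> f" for f
    using klinearD[OF that] unfolding klinear_def
    by (auto simp: derivation_add[OF DE] derivation_mult[OF DE] DE_\<iota> algebra_simps)
  have *: "peval f (\<lambda>x. x) (dT h) = DE (peval f (\<lambda>x. x) h) + peval (?br f) (\<lambda>x. x) h"
    if f: "klinear \<iota> f" for f h
  proof (induct h rule: mpoly_induct)
    case (const c)
    show ?case by (simp add: dT peval_klinear(2)[OF f] peval_klinear(2)[OF br[OF f]])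
  next
    case (add p q)
    then show ?case
      by (simp add: derivation_add[OF dT(1)] derivation_add[OF DE] peval_klinear(1)[OF f] peval_klinear(1)[OF br[OF f]])
  next
    case (var v p)
    then show ?case
      by (simp add: derivation_mult[OF dT(1)] derivation_mult[OF DE] dT peval_klinear(1,3)[OF f]
          peval_klinear(3)[OF br[OF f]] distrib_left add.assoc)
  qed
  fix f assume f: "klinear \<iota> f"
  show "peval f (\<lambda>x. x) (dT h) = 0"
    using assms f br[OF f] unfolding *[OF f] by (simp add: tensor_kernel_def derivation_zero[OF DE])
qed

text \<open>Linear disjointness of E \<otimes> 1 and the constants of the tensor square over the
  constants of E. As for the Wronskian, one left factor is normalised to 1 and the relation
  differentiated, which shortens it because \<open>dT\<close> sends each q i into J.\<close>

lemma indep_coefficients_in_J: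
  assumes "finite I" "lin_indep (constants DE) I e" "(\<Sum>i\<in>I. l (e i) * q i) \<in> J" "\<And>i. i \<in> I \<Longrightarrow> dT (q i) \<in> J" "k \<in> I"
  shows "q k \<in> J"
  using assms
proof (induct "card I" arbitrary: I e k)
  case 0
  then show ?case by simp
next
  case (Suc n)
  note C = is_subfield_constants[OF DE]
  have *: "q k \<in> J" if k: "k \<in> I" and oth: "\<And>j. j \<in> I - {k} \<Longrightarrow> q j \<in> J" for k
  proof -
    have ek: "e k \<noteq> 0" by (rule lin_indep_nonzero[OF Suc.prems(2,1) k is_subfieldD(1,2)[OF C]])
    have "(\<Sum>i\<in>I. l (e i) * q i) = l (e k) * q k + (\<Sum>i\<in>I - {k}. l (e i) * q i)"
      using Suc.prems(1) k by (rule sum.remove)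
    then have "l (e k) * q k = (\<Sum>i\<in>I. l (e i) * q i) - (\<Sum>i\<in>I - {k}. l (e i) * q i)" by simp
    also have "\<dots> \<in> J"
      by (intro J_ideal(6) Suc.prems(3) is_ideal_sum[OF is_ideal_tensor_kernel] J_ideal(3) oth)
    finally have "l (inverse (e k)) * (l (e k) * q k) \<in> J" by (rule J_ideal(3))
    then show ?thesis using ek by (simp flip: mult.assoc l.hom_mult)
  qed
  obtain k0 where k0: "k0 \<in> I" using Suc.prems(5) by blast
  have e0: "e k0 \<noteq> 0" by (rule lin_indep_nonzero[OF Suc.prems(2,1) k0 is_subfieldD(1,2)[OF C]])
  define b where "b j = e j / e k0" for j
  have b0: "b k0 = 1" using e0 by (simp add: b_def)
  have bJ: "(\<Sum>i\<in>I. l (b i) * q i) \<in> J"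
  proof -
    have "(\<Sum>i\<in>I. l (b i) * q i) = l (inverse (e k0)) * (\<Sum>i\<in>I. l (e i) * q i)"
      by (simp add: sum_distrib_left b_def divide_inverse l.hom_mult mult_ac)
    then show ?thesis using J_ideal(3)[OF Suc.prems(3)] by simp
  qed
  have "(\<Sum>i\<in>I - {k0}. l (DE (b i)) * q i) = dT (\<Sum>i\<in>I. l (b i) * q i) - (\<Sum>i\<in>I. l (b i) * dT (q i))"
  proof -
    have "dT (\<Sum>i\<in>I. l (b i) * q i) = (\<Sum>i\<in>I. l (DE (b i)) * q i) + (\<Sum>i\<in>I. l (b i) * dT (q i))"
      by (simp add: derivation_sum[OF dT(1)] derivation_mult[OF dT(1)] dT sum.distrib)
    also have "(\<Sum>i\<in>I. l (DE (b i)) * q i) = (\<Sum>i\<in>I - {k0}. l (DE (b i)) * q i)"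
      by (subst sum.remove[OF Suc.prems(1) k0]) (simp add: b0 derivation_one[OF DE])
    finally show ?thesis by simp
  qed
  also have "\<dots> \<in> J"
    by (intro J_ideal(6) dT_J bJ is_ideal_sum[OF is_ideal_tensor_kernel] J_ideal(3) Suc.prems(4))
  finally have 1: "(\<Sum>i\<in>I - {k0}. l (DE (b i)) * q i) \<in> J" .
  \<comment> \<open>A constant combination of the \<open>DE (b j)\<close> is the derivative of the
    same combination c0 of the b j. If it vanishes then c0 is a constant, and c0 times b k0 = 1
    completes a relation among all the e j.\<close>
  have 2: "lin_indep (constants DE) (I - {k0}) (\<lambda>i. DE (b i))"
    unfolding lin_indep_def
  proof (intro allI impI, elim conjE)
    fix c assume c: "\<forall>j\<in>I - {k0}. c j \<in> constants DE" "(\<Sum>j\<in>I - {k0}. c j * DE (b j)) = 0"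
    define c0 where "c0 = (\<Sum>j\<in>I - {k0}. c j * b j)"
    have "DE c0 = (\<Sum>j\<in>I - {k0}. c j * DE (b j))"
      unfolding c0_def derivation_sum[OF DE] using c(1) by (intro sum.cong) (auto simp: derivation_mult[OF DE] constants_def)
    then have c0: "c0 \<in> constants DE" using c(2) by (simp add: constants_def)
    let ?c = "\<lambda>j. if j = k0 then - c0 else c j"
    have "(\<Sum>j\<in>I. ?c j * e j) = - c0 * e k0 + (\<Sum>j\<in>I - {k0}. c j * e j)"
      by (subst sum.remove[OF Suc.prems(1) k0]) simp
    also have "(\<Sum>j\<in>I - {k0}. c j * e j) = c0 * e k0"
      using e0 by (simp add: c0_def b_def sum_distrib_right)
    finally have "(\<Sum>j\<in>I. ?c j * e j) = 0" by simp
    then have "?c j = 0" if "j \<in> I" for j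
      by (rule lin_indepD[OF Suc.prems(2), rotated]) (use that c(1) c0 is_subfieldD(7)[OF C] in auto)
    then show "\<forall>j\<in>I - {k0}. c j = 0" by (metis DiffE singletonI)
  qed
  have oth: "q j \<in> J" if "j \<in> I - {k0}" for j
    by (rule Suc.hyps(1)[OF _ _ 2 1 _ that]) (use Suc.hyps(2) Suc.prems(1,4) k0 in auto)
  show ?case
  proof (cases "k = k0")
    case True
    then show ?thesis using *[OF k0] oth by blast
  next
    case False
    then show ?thesis using oth Suc.prems(5) by blast
  qed
qed

section \<open>Nilpotents in the tensor square\<close>

text \<open>The map E[t] -> E \<otimes> E with coefficients in the left factor and t \<mapsto> 1
  \<otimes> a. It turns statements on powers of 1 \<otimes> a - a \<otimes> 1 into statements on
  divisibility in E[t].\<close>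

definition rpoly :: "'e \<Rightarrow> 'e poly \<Rightarrow> ('e \<Rightarrow>\<^sub>0 nat) \<Rightarrow>\<^sub>0 'e" where
  "rpoly a f = poly (map_poly l f) (r a)"

lemma rpoly_hom: "rpoly a (f * g) = rpoly a f * rpoly a g" "rpoly a (f + g) = rpoly a f + rpoly a g"
  "rpoly a 1 = 1" "rpoly a [:- a, 1:] = r a - l a"
proof -
  show "rpoly a (f * g) = rpoly a f * rpoly a g" "rpoly a (f + g) = rpoly a f + rpoly a g" "rpoly a 1 = 1"
    by (simp_all add: rpoly_def map_poly_ring_hom[OF l_hom])
  show "rpoly a [:- a, 1:] = r a - l a" by (simp add: rpoly_def map_poly_pCons l.hom_uminus)
qed

lemma rpoly_power: "rpoly a (f ^ n) = rpoly a f ^ n"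
  by (induct n) (simp_all add: rpoly_hom)

lemma peval_rpoly:
  assumes f: "klinear \<iota> f"
  shows "peval f (\<lambda>x. x) (rpoly a p) = (\<Sum>i\<le>degree p. f (coeff p i) * a ^ i)"
proof -
  have pow: "peval f (\<lambda>x. x) (r a ^ n * l c) = a ^ n * f c" for n c
    by (induct n) (simp_all add: mult.assoc peval_klinear[OF f])
  have "rpoly a p = (\<Sum>i\<le>degree p. r a ^ i * l (coeff p i))"
  proof -
    have "rpoly a p = (\<Sum>i\<le>degree p. coeff (map_poly l p) i * r a ^ i)"
      unfolding rpoly_def by (rule poly_altdef_le) (rule degree_le, simp add: coeff_map_poly coeff_eq_0)
    then show ?thesis by (simp add: coeff_map_poly mult.commute)
  qed
  moreover have "peval f (\<lambda>x. x) (\<Sum>i\<in>I. g i) = (\<Sum>i\<in>I. peval f (\<lambda>x. x) (g i))" for I :: "nat set" and g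
    by (induct I rule: infinite_finite_induct) (simp_all add: peval_klinear[OF f])
  ultimately show ?thesis by (simp only: pow mult.commute[of "f _"])
qed

text \<open>As s does not vanish at a, its cofactor does, and one factor t - a cancels on both
  sides.\<close>

lemma dvd_linear_power_root:
  fixes s :: "'e poly"
  assumes "s dvd [:- a, 1:] ^ n" "poly s a \<noteq> 0"
  shows "degree s = 0"
  using assms(1)
proof (induct n)
  case 0
  then show ?case by (auto simp: is_unit_poly_iff)
next
  case (Suc n)
  then obtain t where t: "[:- a, 1:] ^ Suc n = s * t" by (auto elim: dvdE)
  have "poly ([:- a, 1:] ^ Suc n) a = 0" by simp
  then have "poly t a = 0" using assms(2) unfolding t by simp
  then obtain u where u: "t = [:- a, 1:] * u" by (auto simp: poly_eq_0_iff_dvd elim: dvdE)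
  have "[:- a, 1:] * [:- a, 1:] ^ n = [:- a, 1:] * (s * u)" using t unfolding u by (simp only: power_Suc mult.left_commute)
  then have "[:- a, 1:] ^ n = s * u" by (subst (asm) mult_left_cancel) auto
  then show ?case using Suc(1) by (metis dvd_triv_left)
qed

text \<open>A nilpotent \<open>1 \<otimes> a - a \<otimes> 1\<close> makes the minimal polynomial of \<open>a\<close> over \<open>K\<close> a divisor of
  \<open>(t - a)\<^sup>n\<close>, while it is separable.\<close>

lemma tensor_diff_not_nilpotent:
  assumes a: "a \<notin> range \<iota>"
  shows "(r a - l a) ^ n \<notin> J"
proof
  assume nil: "(r a - l a) ^ n \<in> J"
  let ?f = "[:- a, 1:] ^ n"
  have fJ: "rpoly a ?f \<in> J" using nil by (simp add: rpoly_power rpoly_hom)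
  have deg: "degree (map_poly \<iota> p) = degree p" for p by (rule degree_map_poly) auto
  have map0: "map_poly \<iota> p = 0 \<longleftrightarrow> p = 0" for p by (simp add: poly_eq_iff coeff_map_poly)
  have pJ: "rpoly a (map_poly \<iota> p) \<in> J" if p: "poly (map_poly \<iota> p) a = 0" for p
    unfolding tensor_kernel_def
  proof (intro CollectI allI impI)
    fix f assume f: "klinear \<iota> f"
    have "(\<Sum>i\<le>degree p. f (\<iota> (coeff p i)) * a ^ i) = (\<Sum>i\<le>degree p. f 1 * (\<iota> (coeff p i) * a ^ i))"
      using klinearD(2)[OF f, of _ 1] by (intro sum.cong) (auto simp: mult_ac)
    also have "\<dots> = f 1 * poly (map_poly \<iota> p) a"
      by (simp add: poly_altdef deg coeff_map_poly sum_distrib_left)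
    finally show "peval f (\<lambda>x. x) (rpoly a (map_poly \<iota> p)) = 0"
      using p by (simp add: peval_rpoly[OF f] deg coeff_map_poly)
  qed
  \<comment> \<open>If g has a nonzero coefficient, a functional that is 1 there yields a nonzero
    polynomial over K, of no larger degree, which vanishes at a. For transcendental a the degree
    condition is empty, so g = 0 outright.\<close>
  have small: "g = 0" if g: "rpoly a g \<in> J" and min: "\<And>p. p \<noteq> 0 \<Longrightarrow> poly (map_poly \<iota> p) a = 0 \<Longrightarrow> degree g < degree p" for g
  proof (rule poly_eqI)
    fix i
    show "coeff g i = coeff 0 i"
    proof (rule ccontr)
      assume "coeff g i \<noteq> coeff 0 i"
      then have ci: "coeff g i \<noteq> 0" by simp
      obtain \<phi> :: "'e \<Rightarrow> 'k" where \<phi>: "\<phi> (coeff g i) = 1" "klinear \<iota> (\<lambda>y. \<iota> (\<phi> y))"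
        using separating_functional[OF \<iota> ci] by blast
      have z: "\<phi> 0 = 0" using klinearD(3)[OF \<phi>(2)] by simp
      let ?p = "map_poly \<phi> g"
      have c: "coeff ?p j = \<phi> (coeff g j)" for j by (simp add: coeff_map_poly z)
      have "degree ?p \<le> degree g" by (rule degree_le) (simp add: c z coeff_eq_0)
      moreover have "poly (map_poly \<iota> ?p) a = (\<Sum>j\<le>degree g. \<iota> (\<phi> (coeff g j)) * a ^ j)"
        using \<open>degree ?p \<le> degree g\<close> by (subst poly_altdef_le[of _ "degree g"]) (simp_all add: deg coeff_map_poly c z)
      moreover have "\<dots> = 0" using g \<phi>(2) peval_rpoly[OF \<phi>(2), of a g] by (simp add: tensor_kernel_def)
      moreover have "?p \<noteq> 0" using c[of i] \<phi>(1) by auto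
      ultimately show False using min[of ?p] by simp
    qed
  qed
  have f0: "?f \<noteq> 0" by simp
  show False
  proof (cases "\<exists>p. p \<noteq> 0 \<and> poly (map_poly \<iota> p) a = 0")
    case False
    then show ?thesis using small[OF fJ] f0 by blast
  next
    case True
    define M where "M p \<longleftrightarrow> p \<noteq> 0 \<and> poly (map_poly \<iota> p) a = 0" for p
    obtain p where p: "M p" and min: "\<And>p'. M p' \<Longrightarrow> degree p \<le> degree p'"
      using True ex_has_least_nat[of M _ degree] unfolding M_def by metis
    let ?p = "map_poly \<iota> p"
    have p0: "?p \<noteq> 0" "poly ?p a = 0" using p by (auto simp: M_def map0)
    have pos: "degree p > 0"
    proof (rule ccontr)
      assume "\<not> degree p > 0"
      then obtain c where "p = [:c:]" using degree_eq_zeroE by auto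
      then show False using p by (auto simp: M_def map_poly_pCons)
    qed
    have "rpoly a (?f mod ?p) \<in> J"
    proof -
      have "rpoly a ?f = rpoly a (?p * (?f div ?p) + ?f mod ?p)" by simp
      then have "rpoly a (?f mod ?p) = rpoly a ?f - rpoly a ?p * rpoly a (?f div ?p)"
        by (simp only: rpoly_hom) simp
      then show ?thesis using J_ideal(6)[OF fJ J_ideal(4)[OF pJ[OF p0(2)]]] by simp
    qed
    moreover have "degree (?f mod ?p) < degree p'" if "p' \<noteq> 0" "poly (map_poly \<iota> p') a = 0" for p'
    proof -
      have "degree p \<le> degree p'" using min that by (auto simp: M_def)
      then show ?thesis using degree_mod_less'[OF p0(1), of ?f] pos by (cases "?f mod ?p = 0") (auto simp: deg)
    qed
    ultimately have "?f mod ?p = 0" by (rule small)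
    then have dvd: "?p dvd ?f" by (simp add: mod_eq_0_iff_dvd)
    obtain s where s: "?p = [:- a, 1:] * s" using p0(2) by (auto simp: poly_eq_0_iff_dvd elim: dvdE)
    have s0: "s \<noteq> 0" using p0 s by auto
    have ds: "degree p = Suc (degree s)" 
    proof -
      have "degree ?p = degree [:- a, 1:] + degree s" unfolding s by (rule degree_mult_eq) (use s0 in auto)
      then show ?thesis by (simp add: deg)
    qed
    \<comment> \<open>From p = (t - a) s the product rule gives s(a) = p'(a). This is nonzero, since
      in characteristic 0 the derivative p' is a nonzero polynomial over K of smaller degree than
      the minimal p.\<close>
    have sa: "poly s a = poly (pderiv ?p) a" unfolding s pderiv_mult by (simp add: pderiv_pCons)
    have "pderiv ?p = map_poly \<iota> (pderiv p)"
      by (rule poly_eqI) (simp add: coeff_pderiv coeff_map_poly \<iota>.hom_mult \<iota>.hom_of_nat del: of_nat_Suc)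
    have "poly s a \<noteq> 0"
    proof
      assume "poly s a = 0"
      then have "poly (map_poly \<iota> (pderiv p)) a = 0" using sa \<open>pderiv ?p = _\<close> by simp
      moreover have "pderiv p \<noteq> 0"
      proof
        assume "pderiv p = 0"
        then have "coeff (pderiv ?p) (degree s) = 0" using \<open>pderiv ?p = _\<close> by simp
        then have "(of_nat (Suc (degree s)) :: 'e) * coeff ?p (degree p) = 0" by (simp only: coeff_pderiv ds)
        moreover have "coeff ?p (degree p) \<noteq> 0" using p0(1) deg[of p] by (metis leading_coeff_0_iff)
        ultimately show False using CHAR_0_of_nat_eq_0[OF char_0] by (metis mult_eq_0_iff nat.distinct(1))
      qed
      ultimately have "degree p \<le> degree (pderiv p)" using min by (simp add: M_def)
      moreover have "degree (pderiv p) \<le> degree p - 1" by (rule degree_le) (auto simp: coeff_pderiv coeff_eq_0)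
      ultimately show False using pos by simp
    qed
    \<comment> \<open>Now s divides a power of t - a without vanishing at a, so it is constant; p is
      linear over K, and its root a lies in K.\<close>
    moreover have "s dvd ?f" using dvd s by (metis dvd_mult_right)
    ultimately have "degree s = 0" using dvd_linear_power_root by blast
    then obtain c where "s = [:c:]" using degree_eq_zeroE by blast
    then have "?p = [:- a * c, c:]" "c \<noteq> 0" using s s0 by simp_all
    then have c: "coeff ?p 1 = c" "coeff ?p 0 = - a * c" "c \<noteq> 0" by simp_all
    then have "a = - coeff ?p 0 / coeff ?p 1" by simp
    also have "\<dots> = \<iota> (- coeff p 0 / coeff p 1)" by (simp add: coeff_map_poly \<iota>.hom_div \<iota>.hom_uminus)
    finally show False using a by blast
  qed
qed

end

section \<open>The fixed field of the differential Galois group\<close>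

lemma hom_extend_to_fractions:
  fixes s :: "'e::field \<Rightarrow> 'e"
  assumes R: "is_subring R" and frac: "\<And>x. \<exists>a\<in>R. \<exists>b\<in>R. b \<noteq> 0 \<and> x = a / b"
    and add: "\<And>x y. x \<in> R \<Longrightarrow> y \<in> R \<Longrightarrow> s (x + y) = s x + s y"
    and mult: "\<And>x y. x \<in> R \<Longrightarrow> y \<in> R \<Longrightarrow> s (x * y) = s x * s y"
    and one: "s 1 = 1" and inj: "\<And>x. x \<in> R \<Longrightarrow> s x = 0 \<Longrightarrow> x = 0"
  obtains S where "field_hom S" "\<And>x. x \<in> R \<Longrightarrow> S x = s x"
proof -
  note RD = is_subringD[OF R]
  define S where "S x = (SOME y. \<exists>a\<in>R. \<exists>b\<in>R. b \<noteq> 0 \<and> x = a / b \<and> y = s a / s b)" for x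
  have S: "S (a / b) = s a / s b" if ab: "a \<in> R" "b \<in> R" "b \<noteq> 0" for a b
  proof -
    have "\<exists>y. \<exists>a'\<in>R. \<exists>b'\<in>R. b' \<noteq> 0 \<and> a / b = a' / b' \<and> y = s a' / s b'" using ab by blast
    then have "\<exists>a'\<in>R. \<exists>b'\<in>R. b' \<noteq> 0 \<and> a / b = a' / b' \<and> S (a / b) = s a' / s b'"
      unfolding S_def by (rule someI_ex)
    then obtain a' b' where *: "a' \<in> R" "b' \<in> R" "b' \<noteq> 0" "a / b = a' / b'" "S (a / b) = s a' / s b'" by blast
    then have "a * b' = a' * b" using ab by (simp add: frac_eq_eq)
    then have "s a * s b' = s a' * s b" using mult[OF ab(1) *(2)] mult[OF *(1) ab(2)] by simp
    moreover have "s b \<noteq> 0" "s b' \<noteq> 0" using inj ab * by auto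
    ultimately show ?thesis using *(5) by (simp add: frac_eq_eq)
  qed
  have s0: "s 0 = 0" using add[OF RD(1) RD(1)] by (metis add_0_right add_left_cancel)
  have Ss: "S x = s x" if "x \<in> R" for x using S[OF that RD(2)] one by simp
  have "field_hom S"
  proof
    show "S 0 = 0" "S 1 = 1" using Ss RD s0 one by auto
    fix x y
    obtain a b where x: "a \<in> R" "b \<in> R" "b \<noteq> 0" "x = a / b" using frac by blast
    obtain a' b' where y: "a' \<in> R" "b' \<in> R" "b' \<noteq> 0" "y = a' / b'" using frac by blast
    have nz: "s b \<noteq> 0" "s b' \<noteq> 0" using inj x y by auto
    have e: "x + y = (a * b' + a' * b) / (b * b')" "x * y = (a * a') / (b * b')"
      using x y by (simp_all add: add_frac_eq)
    have bb: "b * b' \<in> R" "b * b' \<noteq> 0" using x y RD by auto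
    have "S (x + y) = s (a * b' + a' * b) / s (b * b')" "S (x * y) = s (a * a') / s (b * b')"
      unfolding e by (rule S; use bb x(1,2) y(1,2) RD(3,5) in simp)+
    moreover have "s (a * b' + a' * b) = s a * s b' + s a' * s b" "s (b * b') = s b * s b'" "s (a * a') = s a * s a'"
      using x y RD by (simp_all add: add mult)
    moreover have "S x = s a / s b" "S y = s a' / s b'" unfolding x(4) y(4) using S x(1-3) y(1-3) by simp_all
    ultimately show "S (x + y) = S x + S y" "S (x * y) = S x * S y"
      using nz by (simp_all add: add_frac_eq)
  qed
  then show ?thesis using that Ss by blast
qed

text \<open>If s x = 0 with x nonzero, complete x to a basis T of the span. The images of T without
  x would still span, which are too few vectors. Linearity of s is asked for only on the span,
  because the map to which this is applied is a partial one.\<close>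

lemma (in vector_space) surjective_imp_injective_on_span:
  assumes fin: "finite B"
    and add: "\<And>x y. x \<in> span B \<Longrightarrow> y \<in> span B \<Longrightarrow> s (x + y) = s x + s y"
    and scale: "\<And>c x. x \<in> span B \<Longrightarrow> s (scale c x) = scale c (s x)"
    and surj: "span B \<subseteq> s ` span B" and x: "x \<in> span B" "s x = 0"
  shows "x = 0"
proof (rule ccontr)
  assume "x \<noteq> 0"
  then have "independent {x}" by simp
  then obtain T where T: "{x} \<subseteq> T" "T \<subseteq> span B" "independent T" "span B \<subseteq> span T"
    using maximal_independent_subset_extend[of "{x}" "span B"] x(1) by auto
  have finT: "finite T" using independent_span_bound[OF fin T(3,2)] by blast
  have s0: "s 0 = 0" using scale[OF span_zero, of 0] by simp
  have *: "w \<in> span B \<and> s w \<in> span (s ` (T - {x}))" if "w \<in> span T" for w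
    using that
  proof (induct rule: span_induct_alt)
    case base
    show ?case by (simp add: s0 span_zero)
  next
    case (step c t w)
    have t: "t \<in> span B" using step T by blast
    have "s t \<in> span (s ` (T - {x}))"
      using step(1) x(2) by (cases "t = x") (auto simp: span_zero intro: span_base)
    then have "s (scale c t + w) \<in> span (s ` (T - {x}))"
      using step t by (simp add: add scale span_scale span_add)
    then show ?case using t step by (simp add: span_add span_scale)
  qed
  have "T \<subseteq> span (s ` (T - {x}))"
  proof
    fix t assume "t \<in> T"
    then obtain w where "w \<in> span B" "t = s w" using T(2) surj by blast
    then show "t \<in> span (s ` (T - {x}))" using * T(4) by blast
  qed
  then have "card T \<le> card (s ` (T - {x}))"
    using independent_span_bound[OF finite_imageI[OF finite_Diff[OF finT]] T(3)] by blast
  also have "\<dots> \<le> card (T - {x})" using finT by (intro card_image_le) simp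
  also have "\<dots> < card T" using finT T(1) by (intro psubset_card_mono) auto
  finally show False by simp
qed

lemma nilpotent_add:
  assumes J: "is_ideal J" and x: "x ^ n \<in> J" and y: "y ^ k \<in> J"
  shows "(x + y) ^ (n + k) \<in> J"
  unfolding binomial_ring
proof (rule is_ideal_sum[OF J])
  fix i assume i: "i \<in> {..n + k}"
  show "of_nat (n + k choose i) * x ^ i * y ^ (n + k - i) \<in> J"
  proof (cases "n \<le> i")
    case True
    then have "x ^ i = x ^ n * x ^ (i - n)" by (simp flip: power_add)
    then show ?thesis using is_idealD(3,4)[OF J] x by simp
  next
    case False
    then have "n + k - i = k + (n - i)" by simp
    then have "y ^ (n + k - i) = y ^ k * y ^ (n - i)" by (simp add: power_add)
    then show ?thesis using is_idealD(3,4)[OF J] y by simp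
  qed
qed

lemma nilpotent_sum:
  assumes J: "is_ideal J" and "finite I" "\<And>i. i \<in> I \<Longrightarrow> \<exists>n. f i ^ n \<in> J"
  shows "\<exists>n. sum f I ^ n \<in> J"
  using assms(2,3)
proof induct
  case empty
  then show ?case using is_idealD(1)[OF J] by (intro exI[of _ 1]) simp
next
  case (insert i I)
  obtain k where k: "sum f I ^ k \<in> J" using insert by blast
  obtain n where n: "f i ^ n \<in> J" using insert by blast
  from nilpotent_add[OF J n k] show ?case using insert(1,2) by auto
qed

lemma infinite_subfield_char_0:
  assumes "is_subfield (S :: 'e::field set)" "CHAR('e) = 0"
  shows "infinite S"
proof -
  have "inj (of_nat :: nat \<Rightarrow> 'e)"
  proof (rule linorder_injI)
    fix x y :: nat assume "x < y"
    then have "(of_nat y :: 'e) = of_nat x + of_nat (y - x)" by (metis of_nat_add le_add_diff_inverse less_imp_le)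
    moreover have "(of_nat (y - x) :: 'e) \<noteq> 0" unfolding CHAR_0_of_nat_eq_0[OF assms(2)] using \<open>x < y\<close> by simp
    ultimately show "of_nat x \<noteq> (of_nat y :: 'e)" by (metis add_cancel_left_right)
  qed
  moreover have "of_nat n \<in> S" for n by (induct n) (auto intro: is_subfieldD[OF assms(1)])
  then have "range (of_nat :: nat \<Rightarrow> 'e) \<subseteq> S" by (rule image_subsetI)
  ultimately show ?thesis using infinite_super[OF _ range_inj_infinite] by metis
qed

text \<open>Associativity of a product row times matrix times column, for matrices given as plain
  functions.\<close>

lemma sum_mult_assoc:
  fixes a :: "'i \<Rightarrow> 'a::comm_ring_1"
  shows "(\<Sum>q\<in>I. a q * (\<Sum>p\<in>L. b q p * c p)) = (\<Sum>p\<in>L. (\<Sum>q\<in>I. a q * b q p) * c p)"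
  unfolding sum_distrib_left sum_distrib_right mult.assoc by (rule sum.swap)

lemma sum_delta_mult:
  fixes f :: "nat \<Rightarrow> 'a::comm_ring_1"
  assumes "k < m"
  shows "(\<Sum>p<m. f p * (if p = k then 1 else 0)) = f k" "(\<Sum>p<m. (if k = p then 1 else 0) * f p) = f k"
proof -
  have "(\<Sum>p<m. f p * (if p = k then 1 else 0)) = (\<Sum>p<m. if p = k then f p else 0)"
    by (intro sum.cong) auto
  then show "(\<Sum>p<m. f p * (if p = k then 1 else 0)) = f k" using assms by simp
  have "(\<Sum>p<m. (if k = p then 1 else 0) * f p) = (\<Sum>p<m. if p = k then f p else 0)"
    by (intro sum.cong) auto
  then show "(\<Sum>p<m. (if k = p then 1 else 0) * f p) = f k" using assms by simp
qed

text \<open>A first-order system Y' = A Y with fundamental matrix Y, rather than a scalar equation,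
  and a base that is only required to contain the constants of E. The same Y can thus be used over F
  and over the intermediate field F(X).\<close>

locale matrix_extension = differential_tensor_square DK DE \<iota>
  for DK :: "'k::field \<Rightarrow> 'k" and DE :: "'e::field \<Rightarrow> 'e" and \<iota> :: "'k \<Rightarrow> 'e" +
  fixes m :: nat and Y Yi :: "nat \<Rightarrow> nat \<Rightarrow> 'e" and A :: "nat \<Rightarrow> nat \<Rightarrow> 'k"
  assumes constants_in_base: "constants DE \<subseteq> range \<iota>" and alg_closed: "algebraically_closed_subfield (constants DE)"
    and inv1: "\<And>i j. i < m \<Longrightarrow> j < m \<Longrightarrow> (\<Sum>p<m. Yi i p * Y p j) = (if i = j then 1 else 0)"
    and inv2: "\<And>i j. i < m \<Longrightarrow> j < m \<Longrightarrow> (\<Sum>p<m. Y i p * Yi p j) = (if i = j then 1 else 0)"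
    and ode: "\<And>i j. i < m \<Longrightarrow> j < m \<Longrightarrow> DE (Y i j) = (\<Sum>p<m. \<iota> (A i p) * Y p j)"
    and generated: "\<And>S. is_subfield S \<Longrightarrow> range \<iota> \<subseteq> S \<Longrightarrow> (\<And>i j. i < m \<Longrightarrow> j < m \<Longrightarrow> Y i j \<in> S) \<Longrightarrow> S = UNIV"
begin

abbreviation C where "C \<equiv> constants DE"

lemmas C_subfield = is_subfield_constants[OF DE]
lemmas C_D = is_subfieldD[OF C_subfield]

lemma eqJ_eq_trans [trans]: "x \<approx> y \<Longrightarrow> y = w \<Longrightarrow> x \<approx> w"
  by simp

lemma eq_eqJ_trans [trans]: "x = y \<Longrightarrow> y \<approx> w \<Longrightarrow> x \<approx> w"
  by simp

text \<open>Differentiating Y^-1 Y = 1 shows f Y = 0, and multiplication by Y^-1 on the right shows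
  f = 0.\<close>

lemma ode_inverse:
  assumes "i < m" "k < m"
  shows "DE (Yi i k) = - (\<Sum>q<m. Yi i q * \<iota> (A q k))"
proof -
  define f where "f p = DE (Yi i p) + (\<Sum>q<m. Yi i q * \<iota> (A q p))" for p
  have z: "(\<Sum>p<m. f p * Y p j) = 0" if j: "j < m" for j
  proof -
    have "0 = DE (\<Sum>p<m. Yi i p * Y p j)"
      using inv1[OF assms(1) j] by (simp add: derivation_zero[OF DE] derivation_one[OF DE])
    also have "\<dots> = (\<Sum>p<m. DE (Yi i p) * Y p j) + (\<Sum>q<m. Yi i q * (\<Sum>p<m. \<iota> (A q p) * Y p j))"
      using j by (simp add: derivation_sum[OF DE] derivation_mult[OF DE] sum.distrib ode)
    also have "(\<Sum>q<m. Yi i q * (\<Sum>p<m. \<iota> (A q p) * Y p j)) = (\<Sum>p<m. (\<Sum>q<m. Yi i q * \<iota> (A q p)) * Y p j)"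
      by (rule sum_mult_assoc)
    finally show ?thesis by (simp add: f_def distrib_right sum.distrib)
  qed
  have "f k = (\<Sum>p<m. f p * (if p = k then 1 else 0))" using sum_delta_mult(1)[OF assms(2), of f] by simp
  also have "\<dots> = (\<Sum>p<m. f p * (\<Sum>j<m. Y p j * Yi j k))" using assms by (intro sum.cong) (auto simp: inv2)
  also have "\<dots> = (\<Sum>j<m. (\<Sum>p<m. f p * Y p j) * Yi j k)"
    by (rule sum_mult_assoc)
  also have "\<dots> = 0" using z by simp
  finally show ?thesis by (simp add: f_def eq_neg_iff_add_eq_0)
qed

text \<open>The matrices \<open>Y\<^sup>-\<^sup>1 \<otimes> Y\<close> and \<open>Y \<otimes> Y\<^sup>-\<^sup>1\<close>, inverse to each other, with constant entries.\<close>

definition z where "z i j = (\<Sum>p<m. l (Yi i p) * r (Y p j))"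

definition zi where "zi i j = (\<Sum>p<m. r (Yi i p) * l (Y p j))"

text \<open>The entries of A lie in K and pass through the tensor sign by \<open>r_\<iota>\<close>,
  so the terms - Y^-1 A \<otimes> Y and Y^-1 \<otimes> A Y of the product rule cancel.\<close>

lemma dT_z:
  assumes "i < m" "j < m"
  shows "dT (z i j) \<in> J"
proof -
  have 1: "l (DE (Yi i p)) = - (\<Sum>q<m. l (Yi i q) * l (\<iota> (A q p)))" if "p < m" for p
    using ode_inverse[OF assms(1) that] by (simp add: l.hom_uminus l.hom_sum l.hom_mult)
  have 2: "r (DE (Y p j)) \<approx> (\<Sum>q<m. l (\<iota> (A p q)) * r (Y q j))" if "p < m" for p
    unfolding ode[OF that assms(2)] by (rule eqJ_trans[OF r_sum eqJ_sum]) (rule eqJ_trans[OF r_mult eqJ_mult[OF r_\<iota> eqJ_refl]])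
  have "dT (z i j) = (\<Sum>p<m. l (DE (Yi i p)) * r (Y p j)) + (\<Sum>p<m. l (Yi i p) * r (DE (Y p j)))"
    by (simp add: z_def derivation_sum[OF dT(1)] derivation_mult[OF dT(1)] dT sum.distrib)
  also have "\<dots> \<approx> (\<Sum>p<m. (- (\<Sum>q<m. l (Yi i q) * l (\<iota> (A q p)))) * r (Y p j))
      + (\<Sum>p<m. l (Yi i p) * (\<Sum>q<m. l (\<iota> (A p q)) * r (Y q j)))"
    by (rule eqJ_add[OF eqJ_sum eqJ_sum]) (simp_all add: 1 eqJ_mult[OF eqJ_refl 2])
  also have "(\<Sum>p<m. (- (\<Sum>q<m. l (Yi i q) * l (\<iota> (A q p)))) * r (Y p j))
      + (\<Sum>p<m. l (Yi i p) * (\<Sum>q<m. l (\<iota> (A p q)) * r (Y q j))) = 0"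
    unfolding sum_mult_assoc by (simp add: sum_negf)
  finally show ?thesis by (simp add: in_J_iff)
qed

lemma dT_zi:
  assumes "i < m" "j < m"
  shows "dT (zi i j) \<in> J"
proof -
  have 1: "r (DE (Yi i p)) \<approx> - (\<Sum>q<m. r (Yi i q) * l (\<iota> (A q p)))" if "p < m" for p
    unfolding ode_inverse[OF assms(1) that]
    by (rule eqJ_trans[OF r_minus eqJ_minus[OF eqJ_trans[OF r_sum eqJ_sum]]])
      (rule eqJ_trans[OF r_mult eqJ_mult[OF eqJ_refl r_\<iota>]])
  have 2: "l (DE (Y p j)) = (\<Sum>q<m. l (\<iota> (A p q)) * l (Y q j))" if "p < m" for p
    using ode[OF that assms(2)] by (simp add: l.hom_sum l.hom_mult)
  have "dT (zi i j) = (\<Sum>p<m. r (DE (Yi i p)) * l (Y p j)) + (\<Sum>p<m. r (Yi i p) * l (DE (Y p j)))"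
    by (simp add: zi_def derivation_sum[OF dT(1)] derivation_mult[OF dT(1)] dT sum.distrib)
  also have "\<dots> \<approx> (\<Sum>p<m. (- (\<Sum>q<m. r (Yi i q) * l (\<iota> (A q p)))) * l (Y p j))
      + (\<Sum>p<m. r (Yi i p) * (\<Sum>q<m. l (\<iota> (A p q)) * l (Y q j)))"
    by (rule eqJ_add[OF eqJ_sum eqJ_sum], rule eqJ_mult[OF 1 eqJ_refl], simp, simp add: 2)
  also have "(\<Sum>p<m. (- (\<Sum>q<m. r (Yi i q) * l (\<iota> (A q p)))) * l (Y p j))
      + (\<Sum>p<m. r (Yi i p) * (\<Sum>q<m. l (\<iota> (A p q)) * l (Y q j))) = 0"
    unfolding sum_mult_assoc by (simp add: sum_negf)
  finally show ?thesis by (simp add: in_J_iff)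
qed

lemma delta_sum_eqJ:
  assumes "\<And>i j. i < m \<Longrightarrow> j < m \<Longrightarrow> (\<Sum>p<m. f i p * g p j) = (if i = j then 1 else 0::'e)" "i < m" "j < m"
  shows "(\<Sum>p<m. r (f i p) * r (g p j)) \<approx> (if i = j then 1 else 0)"
proof -
  have "r (\<Sum>p<m. f i p * g p j) \<approx> (\<Sum>p<m. r (f i p) * r (g p j))"
    by (rule eqJ_trans[OF r_sum eqJ_sum]) (rule r_mult)
  from eqJ_sym[OF this] show ?thesis unfolding assms(1)[OF assms(2,3)]
    by (rule eqJ_trans) (use r_0 r_1 in auto)
qed

lemma z_zi:
  assumes "i < m" "k < m"
  shows "(\<Sum>j<m. z i j * zi j k) \<approx> (if i = k then 1 else 0)"
proof -
  have "(\<Sum>j<m. z i j * zi j k) = (\<Sum>j<m. \<Sum>p<m. \<Sum>q<m. l (Yi i p) * l (Y q k) * (r (Y p j) * r (Yi j q)))"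
    unfolding z_def zi_def sum_product by (simp add: mult_ac)
  also have "\<dots> = (\<Sum>p<m. \<Sum>j<m. \<Sum>q<m. l (Yi i p) * l (Y q k) * (r (Y p j) * r (Yi j q)))"
    by (rule sum.swap)
  also have "\<dots> = (\<Sum>p<m. \<Sum>q<m. l (Yi i p) * l (Y q k) * (\<Sum>j<m. r (Y p j) * r (Yi j q)))"
    unfolding sum_distrib_left by (rule sum.cong[OF refl]) (rule sum.swap)
  also have "\<dots> \<approx> (\<Sum>p<m. \<Sum>q<m. l (Yi i p) * l (Y q k) * (if p = q then 1 else 0))"
    by (intro eqJ_sum eqJ_mult[OF eqJ_refl delta_sum_eqJ[OF inv2]]) auto
  also have "\<dots> = (\<Sum>p<m. l (Yi i p) * l (Y p k))"
  proof (intro sum.cong refl)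
    fix p assume "p \<in> {..<m}"
    then have "p < m" by simp
    from sum_delta_mult(2)[OF this, of "\<lambda>q. l (Yi i p) * l (Y q k)"]
    show "(\<Sum>q<m. l (Yi i p) * l (Y q k) * (if p = q then 1 else 0)) = l (Yi i p) * l (Y p k)"
      by (simp only: mult.commute)
  qed
  also have "\<dots> = l (\<Sum>p<m. Yi i p * Y p k)" by (simp add: l.hom_sum l.hom_mult)
  also have "\<dots> = (if i = k then 1 else 0)" by (simp add: inv1[OF assms])
  finally show ?thesis .
qed

text \<open>In matrix form 1 \<otimes> Y = (Y \<otimes> 1) z. Hence, modulo J, E . B contains 1
  \<otimes> K[Y], and a point \<theta> prescribes the image Y \<theta>(z) of Y.\<close>

lemma r_Y_z:
  assumes "i < m" "j < m"
  shows "r (Y i j) = (\<Sum>p<m. l (Y i p) * z p j)"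
proof -
  have "(\<Sum>p<m. l (Y i p) * z p j) = (\<Sum>q<m. (\<Sum>p<m. l (Y i p) * l (Yi p q)) * r (Y q j))"
    unfolding z_def by (rule sum_mult_assoc)
  also have "\<dots> = (\<Sum>q<m. (if i = q then 1 else 0) * r (Y q j))"
  proof (intro sum.cong refl arg_cong2[of _ _ _ _ "(*)"])
    fix q assume "q \<in> {..<m}"
    then have "l (\<Sum>p<m. Y i p * Yi p q) = (if i = q then 1 else 0)" using inv2 assms by simp
    then show "(\<Sum>p<m. l (Y i p) * l (Yi p q)) = (if i = q then 1 else 0)" by (simp add: l.hom_sum l.hom_mult)
  qed
  also have "\<dots> = r (Y i j)" by (rule sum_delta_mult(2)[OF assms(1)])
  finally show ?thesis by simp
qed

definition zs where
  "zs = [z i j. i \<leftarrow> [0..<m], j \<leftarrow> [0..<m]] @ [zi i j. i \<leftarrow> [0..<m], j \<leftarrow> [0..<m]]"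

definition B where "B = adjoin_list (l ` C) zs"

lemma subring_lC: "is_subring (l ` C)"
  unfolding is_subring_def
proof (intro conjI ballI)
  show "0 \<in> l ` C" using C_D(1) l.hom_zero by (metis imageI)
  show "1 \<in> l ` C" using C_D(2) l.hom_one by (metis imageI)
  fix x y assume "x \<in> l ` C" "y \<in> l ` C"
  then show "x + y \<in> l ` C" "x - y \<in> l ` C" "x * y \<in> l ` C"
    using C_D(3,4,5) by (auto simp flip: l.hom_add l.hom_mult l.hom_minus)
qed

lemma B_subring: "is_subring B" unfolding B_def by (rule adjoin_list(1)[OF subring_lC])

lemmas B_D = is_subringD[OF B_subring]

lemma B_l: "c \<in> C \<Longrightarrow> l c \<in> B" unfolding B_def using adjoin_list(2)[OF subring_lC] by blast

lemma B_z: "i < m \<Longrightarrow> j < m \<Longrightarrow> z i j \<in> B" "i < m \<Longrightarrow> j < m \<Longrightarrow> zi i j \<in> B"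
proof -
  have "set zs \<subseteq> B" unfolding B_def by (rule adjoin_list(3)[OF subring_lC])
  moreover have "z i j \<in> set zs" if "i < m" "j < m"
    unfolding zs_def set_append by (rule UnI1) (use that in \<open>auto intro!: bexI[of _ i]\<close>)
  moreover have "zi i j \<in> set zs" if "i < m" "j < m"
    unfolding zs_def set_append by (rule UnI2) (use that in \<open>auto intro!: bexI[of _ i]\<close>)
  ultimately show "i < m \<Longrightarrow> j < m \<Longrightarrow> z i j \<in> B" "i < m \<Longrightarrow> j < m \<Longrightarrow> zi i j \<in> B" by auto
qed

lemma dT_B: "q \<in> B \<Longrightarrow> dT q \<in> J"
proof -
  have "is_subring {q. dT q \<in> J}"
    unfolding is_subring_def
    by (auto simp: derivation_zero[OF dT(1)] derivation_one[OF dT(1)] derivation_add[OF dT(1)]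
        derivation_diff[OF dT(1)] derivation_mult[OF dT(1)] J_ideal)
  moreover have "l ` C \<subseteq> {q. dT q \<in> J}" using J_ideal(1) by (auto simp: dT constants_def)
  moreover have "set zs \<subseteq> {q. dT q \<in> J}" unfolding zs_def using dT_z dT_zi by auto
  ultimately have "B \<subseteq> {q. dT q \<in> J}" unfolding B_def by (rule adjoin_list_minimal)
  then show "q \<in> B \<Longrightarrow> dT q \<in> J" by auto
qed

text \<open>A \<open>C\<close>-rational point \<open>\<theta>\<close> of \<open>B\<close> modulo \<open>J\<close> induces a specialisation \<open>e \<otimes> q \<mapsto> e \<theta>(q)\<close> on \<open>E \<cdot> B\<close>.\<close>

inductive specialises for \<theta> where
  in_J: "h \<in> J \<Longrightarrow> specialises \<theta> h 0"
| gen: "q \<in> B \<Longrightarrow> specialises \<theta> (l e * q) (e * \<theta> q)"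
| add: "specialises \<theta> h y \<Longrightarrow> specialises \<theta> h' y' \<Longrightarrow> specialises \<theta> (h + h') (y + y')"

abbreviation point where "point \<theta> \<equiv> point_on C l J B \<theta>"

lemma specialises_list:
  "specialises \<theta> h y \<Longrightarrow> \<exists>ps. (\<forall>x\<in>set ps. snd x \<in> B) \<and> h \<approx> (\<Sum>x\<leftarrow>ps. l (fst x) * snd x) \<and> y = (\<Sum>x\<leftarrow>ps. fst x * \<theta> (snd x))"
proof (induct rule: specialises.induct)
  case (in_J h)
  then show ?case by (intro exI[of _ "[]"]) (simp add: in_J_iff)
next
  case (gen q e)
  then show ?case by (intro exI[of _ "[(e, q)]"]) simp
next
  case (add h y h' y')
  then obtain ps ps' where "\<forall>x\<in>set ps. snd x \<in> B" "h \<approx> (\<Sum>x\<leftarrow>ps. l (fst x) * snd x)" "y = (\<Sum>x\<leftarrow>ps. fst x * \<theta> (snd x))"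
    "\<forall>x\<in>set ps'. snd x \<in> B" "h' \<approx> (\<Sum>x\<leftarrow>ps'. l (fst x) * snd x)" "y' = (\<Sum>x\<leftarrow>ps'. fst x * \<theta> (snd x))" by auto
  then show ?case by (intro exI[of _ "ps @ ps'"]) (auto intro: eqJ_add)
qed

lemma point_sum:
  assumes "point \<theta>" "\<And>i. i \<in> I \<Longrightarrow> f i \<in> B"
  shows "\<theta> (sum f I) = (\<Sum>i\<in>I. \<theta> (f i))"
proof -
  have "\<theta> 0 = 0" using point_onD(2)[OF assms(1) C_D(1)] by simp
  then show ?thesis using assms(2)
    by (induct I rule: infinite_finite_induct) (auto simp: point_onD(4)[OF assms(1)] is_subring_sum[OF B_subring])
qed

text \<open>The left factors are expressed through independent ones, and the constants that appear
  are moved into the right factors. The value is unchanged because \<theta> is multiplicative,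
  additive and the identity on C.\<close>

lemma specialises_indep:
  assumes "specialises \<theta> h y" and \<theta>: "point \<theta>"
  shows "\<exists>(I :: nat set) e q. finite I \<and> lin_indep C I e \<and> (\<forall>i\<in>I. q i \<in> B) \<and>
    h \<approx> (\<Sum>i\<in>I. l (e i) * q i) \<and> y = (\<Sum>i\<in>I. e i * \<theta> (q i))"
proof -
  obtain ps where ps: "\<And>x. x \<in> set ps \<Longrightarrow> snd x \<in> B" "h \<approx> (\<Sum>x\<leftarrow>ps. l (fst x) * snd x)" "y = (\<Sum>x\<leftarrow>ps. fst x * \<theta> (snd x))"
    using specialises_list[OF assms(1)] by blast
  define e where "e i = fst (ps ! i)" for i
  define q where "q i = snd (ps ! i)" for i
  let ?N = "{..<length ps}"
  have q: "q i \<in> B" if "i \<in> ?N" for i using that ps(1) by (auto simp: q_def)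
  have h: "h \<approx> (\<Sum>i\<in>?N. l (e i) * q i)" and y: "y = (\<Sum>i\<in>?N. e i * \<theta> (q i))"
    using ps(2,3) by (simp_all add: sum_list_sum_nth e_def q_def atLeast0LessThan)
  obtain I where I: "I \<subseteq> ?N" "lin_indep C I e" "\<forall>i\<in>?N. \<exists>c. (\<forall>j\<in>I. c j \<in> C) \<and> e i = (\<Sum>j\<in>I. c j * e j)"
    using lin_indep_reduce[OF C_subfield, of ?N e] by auto
  then obtain c where c: "\<And>i j. i \<in> ?N \<Longrightarrow> j \<in> I \<Longrightarrow> c i j \<in> C" "\<And>i. i \<in> ?N \<Longrightarrow> e i = (\<Sum>j\<in>I. c i j * e j)"
    by metis
  define q' where "q' j = (\<Sum>i\<in>?N. l (c i j) * q i)" for j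
  have fin: "finite I" using I(1) finite_subset by blast
  show ?thesis
  proof (intro exI conjI ballI)
    show "finite I" "lin_indep C I e" by (rule fin, rule I(2))
    show q': "q' j \<in> B" if "j \<in> I" for j
      unfolding q'_def using that c(1) q by (intro is_subring_sum[OF B_subring] B_D(5) B_l) auto
    have "(\<Sum>i\<in>?N. l (e i) * q i) = (\<Sum>i\<in>?N. \<Sum>j\<in>I. l (e j) * (l (c i j) * q i))"
      by (intro sum.cong refl) (subst c(2), assumption, simp add: l.hom_sum l.hom_mult sum_distrib_left sum_distrib_right mult_ac)
    also have "\<dots> = (\<Sum>j\<in>I. l (e j) * q' j)" by (subst sum.swap) (simp add: q'_def sum_distrib_left)
    finally show "h \<approx> (\<Sum>j\<in>I. l (e j) * q' j)" using h by simp
    have t: "\<theta> (q' j) = (\<Sum>i\<in>?N. c i j * \<theta> (q i))" if "j \<in> I" for j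
    proof -
      have "\<theta> (q' j) = (\<Sum>i\<in>?N. \<theta> (l (c i j) * q i))"
        unfolding q'_def using c(1) q that by (intro point_sum[OF \<theta>] B_D(5) B_l) auto
      also have "\<dots> = (\<Sum>i\<in>?N. c i j * \<theta> (q i))"
        using c(1) q that by (intro sum.cong refl) (simp add: point_onD(2,5)[OF \<theta>] B_l)
      finally show ?thesis .
    qed
    have "y = (\<Sum>i\<in>?N. \<Sum>j\<in>I. e j * (c i j * \<theta> (q i)))"
      unfolding y by (intro sum.cong refl) (subst c(2), assumption, simp add: sum_distrib_left sum_distrib_right mult_ac)
    also have "\<dots> = (\<Sum>j\<in>I. e j * \<theta> (q' j))" by (subst sum.swap) (simp add: t sum_distrib_left)
    finally show "y = (\<Sum>j\<in>I. e j * \<theta> (q' j))" .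
  qed
qed

context
  fixes \<theta> assumes \<theta>: "point \<theta>"
begin

lemmas \<theta>_D = point_onD[OF \<theta>]

text \<open>This is the well-definedness of the specialisation: with independent left factors each
  right factor lies in J by \<open>indep_coefficients_in_J\<close>, and \<theta> vanishes on B
  \<inter> J.\<close>

lemma specialises_J_unique:
  assumes "specialises \<theta> h y" "h \<in> J"
  shows "y = 0"
proof -
  obtain I :: "nat set" and e q where *: "finite I" "lin_indep C I e" "\<And>i. i \<in> I \<Longrightarrow> q i \<in> B"
    "h \<approx> (\<Sum>i\<in>I. l (e i) * q i)" "y = (\<Sum>i\<in>I. e i * \<theta> (q i))"
    using specialises_indep[OF assms(1) \<theta>] by blast
  have "(\<Sum>i\<in>I. l (e i) * q i) \<in> J" using eqJ_in_J[OF eqJ_sym[OF *(4)] assms(2)] .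
  then have "q i \<in> J" if "i \<in> I" for i
    by (rule indep_coefficients_in_J[OF *(1,2) _ dT_B[OF *(3)] that])
  then show ?thesis unfolding *(5) using \<theta>_D(3) *(3) by (intro sum.neutral) auto
qed

lemma specialises_J_mult: "h \<in> J \<Longrightarrow> specialises \<theta> (h * h') 0"
  by (intro specialises.in_J J_ideal(4))

lemma specialises_mult:
  assumes "specialises \<theta> h y" "specialises \<theta> h' y'"
  shows "specialises \<theta> (h * h') (y * y')"
  using assms(1)
proof (induct rule: specialises.induct)
  case (in_J h)
  then show ?case using specialises_J_mult by simp
next
  case (gen q e)
  from assms(2) show ?case
  proof (induct rule: specialises.induct)
    case (in_J h)
    then show ?case using specialises_J_mult[of h "l e * q"] by (simp add: mult.commute)
  next
    case (gen q' e')
    have "specialises \<theta> (l (e * e') * (q * q')) (e * e' * \<theta> (q * q'))"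
      using gen \<open>q \<in> B\<close> by (intro specialises.gen B_D(5))
    then show ?case using gen \<open>q \<in> B\<close> by (simp add: l.hom_mult \<theta>_D(5) mult_ac)
  next
    case (add h y h' y')
    then show ?case by (simp add: distrib_left specialises.add)
  qed
next
  case (add h y h' y')
  then show ?case by (simp add: distrib_right specialises.add)
qed

lemma specialises_l: "specialises \<theta> (l e) e"
  using specialises.gen[OF B_D(2), of \<theta> e] \<theta>_D(2)[OF C_D(2)] by simp

lemma specialises_eqJ:
  assumes "specialises \<theta> h y" "h' \<approx> h"
  shows "specialises \<theta> h' y"
  using specialises.add[OF assms(1) specialises.in_J[of "h' - h" \<theta>]] assms(2) by (simp add: eqJ_def)

lemma specialises_minus:
  assumes "specialises \<theta> h y"
  shows "specialises \<theta> (- h) (- y)"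
  using specialises_mult[OF specialises_l[of "-1"] assms] by (simp add: l.hom_uminus)

lemma specialises_diff:
  assumes "specialises \<theta> h y" "specialises \<theta> h' y'"
  shows "specialises \<theta> (h - h') (y - y')"
  using specialises.add[OF assms(1) specialises_minus[OF assms(2)]] by simp

lemma specialises_sum:
  assumes "\<And>i. i \<in> I \<Longrightarrow> specialises \<theta> (f i) (g i)"
  shows "specialises \<theta> (sum f I) (sum g I)"
  using assms by (induct I rule: infinite_finite_induct) (auto intro: specialises.add specialises.in_J J_ideal(1))

lemma specialises_unique:
  assumes "specialises \<theta> h y" "specialises \<theta> h y'"
  shows "y = y'"
  using specialises_J_unique[OF specialises_diff[OF assms]] J_ideal(1) by simp

text \<open>Right factors behave as constants before and after specialising: \<open>dT q\<close>
  lies in J and \<theta>(q) lies in C. This makes the induced map on E differential.\<close>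

lemma specialises_dT:
  assumes "specialises \<theta> h y"
  shows "specialises \<theta> (dT h) (DE y)"
  using assms
proof (induct rule: specialises.induct)
  case (in_J h)
  then show ?case by (simp add: derivation_zero[OF DE] specialises.in_J dT_J)
next
  case (gen q e)
  have "\<theta> q \<in> C" using gen \<theta>_D(1) by blast
  then have "DE (e * \<theta> q) = DE e * \<theta> q + 0" by (simp add: derivation_mult[OF DE] constants_def)
  moreover have "specialises \<theta> (l (DE e) * q + l e * dT q) (DE e * \<theta> q + 0)"
    using gen by (intro specialises.add specialises.gen specialises.in_J J_ideal(3) dT_B)
  ultimately show ?case by (simp add: derivation_mult[OF dT(1)] dT)
next
  case (add h y h' y')
  then show ?case by (simp add: derivation_add[OF dT(1)] derivation_add[OF DE] specialises.add)
qed

text \<open>The x for which 1 \<otimes> x lies in E . B modulo J. On them \<open>s\<close> is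
  already a ring homomorphism; it becomes the automorphism of E after extension to
  fractions.\<close>

definition R0 where "R0 = {x. \<exists>y. specialises \<theta> (r x) y}"

definition s where "s x = (THE y. specialises \<theta> (r x) y)"

lemma s_eq: "specialises \<theta> (r x) y \<Longrightarrow> s x = y"
  unfolding s_def using specialises_unique by blast

lemma s_R0: "x \<in> R0 \<Longrightarrow> specialises \<theta> (r x) (s x)"
  using s_eq by (auto simp: R0_def)

lemma s_add: "x \<in> R0 \<Longrightarrow> y \<in> R0 \<Longrightarrow> specialises \<theta> (r (x + y)) (s x + s y)"
  by (rule specialises_eqJ[OF specialises.add r_add]) (auto intro: s_R0)

lemma s_mult: "x \<in> R0 \<Longrightarrow> y \<in> R0 \<Longrightarrow> specialises \<theta> (r (x * y)) (s x * s y)"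
  by (rule specialises_eqJ[OF specialises_mult r_mult]) (auto intro: s_R0)

lemma s_\<iota>: "specialises \<theta> (r (\<iota> k)) (\<iota> k)"
  by (rule specialises_eqJ[OF specialises_l r_\<iota>])

lemma s_Y: "i < m \<Longrightarrow> j < m \<Longrightarrow> specialises \<theta> (r (Y i j)) (\<Sum>p<m. Y i p * \<theta> (z p j))"
  unfolding r_Y_z by (intro specialises_sum specialises.gen B_z) auto

lemma R0_subring: "is_subring R0"
proof -
  have "x - y \<in> R0" if "x \<in> R0" "y \<in> R0" for x y
  proof -
    have "\<iota> (-1) * y \<in> R0" using s_mult[of "\<iota> (-1)" y] s_\<iota>[of "-1"] that by (auto simp: R0_def)
    then show ?thesis using s_add[of x "\<iota> (-1) * y"] that by (auto simp: R0_def \<iota>.hom_uminus)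
  qed
  moreover have "0 \<in> R0" "1 \<in> R0" using s_\<iota>[of 0] s_\<iota>[of 1] by (auto simp: R0_def)
  moreover have "x + y \<in> R0" "x * y \<in> R0" if "x \<in> R0" "y \<in> R0" for x y
    using s_add[OF that] s_mult[OF that] unfolding R0_def by blast+
  ultimately show ?thesis by (simp add: is_subring_def)
qed

lemma z_zi_point:
  assumes "i < m" "k < m"
  shows "(\<Sum>j<m. \<theta> (z i j) * \<theta> (zi j k)) = (if i = k then 1 else 0)"
proof -
  let ?x = "\<Sum>j<m. z i j * zi j k" and ?d = "if i = k then 1 else 0 :: ('e \<Rightarrow>\<^sub>0 nat) \<Rightarrow>\<^sub>0 'e"
  have xB: "?x \<in> B" using assms by (intro is_subring_sum[OF B_subring] B_D(5) B_z) auto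
  have dB: "?d \<in> B" using B_D by simp
  have "\<theta> ?x = \<theta> ((?x - ?d) + ?d)" by simp
  also have "\<dots> = \<theta> (?x - ?d) + \<theta> ?d" by (rule \<theta>_D(4)[OF B_D(4)[OF xB dB] dB])
  also have "\<theta> (?x - ?d) = 0" using z_zi[OF assms] by (intro \<theta>_D(3) B_D(4) xB dB) (simp add: eqJ_def)
  also have "\<theta> ?d = (if i = k then 1 else 0)" using \<theta>_D(2)[OF C_D(1)] \<theta>_D(2)[OF C_D(2)] by simp
  also have "\<theta> ?x = (\<Sum>j<m. \<theta> (z i j * zi j k))" using assms by (intro point_sum[OF \<theta>] B_D(5) B_z) auto
  also have "\<dots> = (\<Sum>j<m. \<theta> (z i j) * \<theta> (zi j k))" using assms by (intro sum.cong \<theta>_D(5) B_z) auto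
  finally show ?thesis by simp
qed

end

section \<open>The ring K[Y] and the automorphism attached to a point\<close>

sublocale V: vector_space "\<lambda>c x. \<iota> c * x" by (rule vector_space_field_hom[OF \<iota>])

definition U where "U = insert 1 {Y i j | i j. i < m \<and> j < m}"

text \<open>The K-spans of words of bounded length filter K[Y] by finite-dimensional spaces, on
  which surjectivity implies injectivity. Having 1 in \<open>U\<close> makes the filtration
  increasing.\<close>

fun words :: "nat \<Rightarrow> 'e set" where
  "words 0 = {1}"
| "words (Suc d) = {b * u | b u. b \<in> words d \<and> u \<in> U}"

definition R1 where "R1 = (\<Union>d. V.span (words d))"

lemma span_times:
  assumes "\<And>a b. a \<in> S \<Longrightarrow> b \<in> T \<Longrightarrow> a * b \<in> V.span W" "x \<in> V.span S" "y \<in> V.span T"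
  shows "x * y \<in> V.span W"
proof -
  have 1: "x * b \<in> V.span W" if b: "b \<in> T" for b
    using assms(2)
  proof (induct rule: V.span_induct_alt)
    case (step c a x)
    then show ?case using V.span_add[OF V.span_scale[OF assms(1)[OF step(1) b]] step(2), of c]
      by (simp add: distrib_right mult.assoc)
  qed (simp add: V.span_zero)
  show ?thesis
    using assms(3)
  proof (induct rule: V.span_induct_alt)
    case (step c b y)
    then show ?case using V.span_add[OF V.span_scale[OF 1[OF step(1)]] step(2), of c]
      by (simp add: distrib_left mult.left_commute)
  qed (simp add: V.span_zero)
qed

lemma finite_words: "finite (words d)"
proof -
  have "{Y i j | i j. i < m \<and> j < m} = (\<lambda>(i, j). Y i j) ` ({..<m} \<times> {..<m})" by auto
  then have U: "finite U" by (simp add: U_def)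
  show ?thesis
  proof (induct d)
    case (Suc d)
    have "words (Suc d) = (\<lambda>(b, u). b * u) ` (words d \<times> U)" by auto
    then show ?case using Suc U by simp
  qed simp
qed

lemma words_mono: "words d \<subseteq> words (d + e)"
proof (induct e)
  case (Suc e)
  have "words (d + e) \<subseteq> words (d + Suc e)"
  proof
    fix b assume "b \<in> words (d + e)"
    then have "b = b * 1 \<and> b \<in> words (d + e) \<and> 1 \<in> U" by (simp add: U_def)
    then show "b \<in> words (d + Suc e)" unfolding add_Suc_right words.simps by blast
  qed
  then show ?case using Suc by blast
qed simp

lemma words_mult: "a \<in> words d \<Longrightarrow> b \<in> words e \<Longrightarrow> a * b \<in> words (d + e)"
proof (induct e arbitrary: b)
  case (Suc e)
  then obtain b' u where b: "b = b' * u" "b' \<in> words e" "u \<in> U" by auto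
  then have "a * b' \<in> words (d + e)" using Suc by blast
  then have "a * b = (a * b') * u \<and> a * b' \<in> words (d + e) \<and> u \<in> U" using b by (simp add: mult.assoc)
  then show ?case unfolding add_Suc_right words.simps by blast
qed simp

lemma R1_subring: "is_subring R1"
proof -
  have add: "x + y \<in> R1" "x - y \<in> R1" if xy: "x \<in> R1" "y \<in> R1" for x y
  proof -
    obtain d e where "x \<in> V.span (words d)" "y \<in> V.span (words e)" using xy by (auto simp: R1_def)
    moreover have "V.span (words d) \<subseteq> V.span (words (d + e))" "V.span (words e) \<subseteq> V.span (words (d + e))"
      using V.span_mono[OF words_mono[of d e]] V.span_mono[OF words_mono[of e d]] by (simp_all add: add.commute)
    ultimately have "x \<in> V.span (words (d + e))" "y \<in> V.span (words (d + e))" by auto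
    then show "x + y \<in> R1" "x - y \<in> R1" unfolding R1_def by (blast intro: V.span_add V.span_diff)+
  qed
  have mult: "x * y \<in> R1" if xy: "x \<in> R1" "y \<in> R1" for x y
  proof -
    obtain d e where "x \<in> V.span (words d)" "y \<in> V.span (words e)" using xy by (auto simp: R1_def)
    then have "x * y \<in> V.span (words (d + e))" by (rule span_times[rotated]) (intro V.span_base words_mult)
    then show ?thesis by (auto simp: R1_def)
  qed
  have "1 \<in> V.span (words 0)" by (intro V.span_base) simp
  then have "1 \<in> R1" unfolding R1_def by blast
  moreover from this have "0 \<in> R1" using add(2)[of 1 1] by simp
  ultimately show ?thesis using add mult by (auto simp: is_subring_def)
qed

lemma R1_gens: "\<iota> k \<in> R1" "i < m \<Longrightarrow> j < m \<Longrightarrow> Y i j \<in> R1"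
proof -
  have "\<iota> k * 1 \<in> V.span (words 0)" by (intro V.span_scale V.span_base) simp
  then have "\<iota> k \<in> V.span (words 0)" by (simp only: mult_1_right)
  then show "\<iota> k \<in> R1" unfolding R1_def by (rule UN_I[OF UNIV_I])
  assume "i < m" "j < m"
  then have "Y i j \<in> words 1" by (auto simp: U_def)
  then show "Y i j \<in> R1" unfolding R1_def by (blast intro: V.span_base)
qed

lemma R1_fractions: "\<exists>a\<in>R1. \<exists>b\<in>R1. b \<noteq> 0 \<and> x = a / b"
proof -
  note D = is_subringD[OF R1_subring]
  let ?F = "{a / b | a b. a \<in> R1 \<and> b \<in> R1 \<and> b \<noteq> 0}"
  have sub: "R1 \<subseteq> ?F"
  proof
    fix a assume "a \<in> R1"
    then show "a \<in> ?F" using D(2) by (intro CollectI exI[of _ a] exI[of _ 1]) simp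
  qed
  have "is_subfield ?F"
    unfolding is_subfield_def
  proof (intro conjI ballI)
    show "0 \<in> ?F" "1 \<in> ?F" by (rule subsetD[OF sub D(1)], rule subsetD[OF sub D(2)])
    fix x assume "x \<in> ?F"
    then obtain a b where x: "a \<in> R1" "b \<in> R1" "b \<noteq> 0" "x = a / b" by blast
    show "inverse x \<in> ?F"
    proof (cases "a = 0")
      case True
      then show ?thesis using subsetD[OF sub D(1)] x by simp
    next
      case False
      then show ?thesis using x by (intro CollectI exI[of _ b] exI[of _ a]) simp
    qed
    fix y assume "y \<in> ?F"
    then obtain a' b' where y: "a' \<in> R1" "b' \<in> R1" "b' \<noteq> 0" "y = a' / b'" by blast
    have bb: "b * b' \<in> R1" "b * b' \<noteq> 0" using x y D by auto
    have e: "x + y = (a * b' + a' * b) / (b * b')" "x - y = (a * b' - a' * b) / (b * b')" "x * y = (a * a') / (b * b')"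
      using x y by (simp_all add: add_frac_eq diff_frac_eq)
    have "a * b' + a' * b \<in> R1" "a * b' - a' * b \<in> R1" "a * a' \<in> R1" using x y D by simp_all
    then show "x + y \<in> ?F" "x - y \<in> ?F" "x * y \<in> ?F" unfolding e using bb by blast+
  qed
  from this have "?F = UNIV" by (rule generated) (use sub R1_gens in blast)+
  then have "x \<in> ?F" by blast
  then show ?thesis by blast
qed

lemma exists_point:
  assumes "q \<in> B" "\<And>n. q ^ n \<notin> J"
  obtains \<theta> where "point \<theta>" "\<theta> q \<noteq> 0"
  using rational_point_exists[OF C_subfield infinite_subfield_char_0[OF C_subfield char_0] alg_closed l_hom
      is_ideal_tensor_kernel, of q zs] assms
  unfolding B_def by blast

context
  fixes \<theta> assumes \<theta>: "point \<theta>"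
begin

lemma R1_R0: "R1 \<subseteq> R0 \<theta>"
proof -
  note D = is_subringD[OF R0_subring[OF \<theta>]]
  have \<iota>R: "\<iota> k \<in> R0 \<theta>" for k using s_\<iota>[OF \<theta>] by (auto simp: R0_def[OF \<theta>])
  have YR: "Y i j \<in> R0 \<theta>" if "i < m" "j < m" for i j using s_Y[OF \<theta> that] by (auto simp: R0_def[OF \<theta>])
  have "words d \<subseteq> R0 \<theta>" for d
    by (induct d) (use D(2,5) YR in \<open>auto simp: U_def\<close>)
  moreover have "x \<in> R0 \<theta>" if "x \<in> V.span S" "S \<subseteq> R0 \<theta>" for x S
    using that(1)
  proof (induct rule: V.span_induct_alt)
    case (step c x y)
    then show ?case using D(3,5) \<iota>R that(2) by blast
  qed (rule D(1))
  ultimately show ?thesis unfolding R1_def by blast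
qed

lemma s_hom:
  assumes "x \<in> R0 \<theta>" "y \<in> R0 \<theta>"
  shows "s \<theta> (x + y) = s \<theta> x + s \<theta> y" "s \<theta> (x * y) = s \<theta> x * s \<theta> y"
  using s_eq[OF \<theta> s_add[OF \<theta> assms]] s_eq[OF \<theta> s_mult[OF \<theta> assms]] by simp_all

lemma s_base: "s \<theta> (\<iota> k) = \<iota> k"
  by (rule s_eq[OF \<theta> s_\<iota>[OF \<theta>]])

text \<open>\<open>s\<close> multiplies Y on the right by the constant matrix \<theta>(z), whose
  inverse is \<theta>(zi) by \<open>z_zi_point\<close>. Constants lie in K, so Y \<theta>(zi)
  consists of K-combinations of entries of Y and is a preimage of Y; products of preimages handle
  longer words.\<close>

lemma s_span_words_surj: "V.span (words d) \<subseteq> s \<theta> ` V.span (words d)"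
proof -
  note D = is_subringD[OF R0_subring[OF \<theta>]]
  have spanR: "V.span (words d) \<subseteq> R0 \<theta>" for d using R1_R0 unfolding R1_def by blast
  have \<iota>R: "\<iota> k \<in> R0 \<theta>" for k using R1_gens(1) R1_R0 by blast
  have U_words: "U \<subseteq> words 1" by auto
  have U: "\<exists>v\<in>V.span (words 1). s \<theta> v = u" if u: "u \<in> U" for u
  proof -
    consider "u = 1" | i j where "u = Y i j" "i < m" "j < m" using u by (auto simp: U_def)
    then show ?thesis
    proof cases
      case 1
      then show ?thesis using V.span_base[of 1 "words 1"] U_words s_base[of 1] by (auto simp: U_def)
    next
      case 2
      have "\<exists>k. \<theta> (zi i' j) = \<iota> k" if "i' < m" for i'
        using constants_in_base point_onD(1)[OF \<theta> B_z(2)[OF that 2(3)]] by blast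
      then obtain h where h: "\<And>i'. i' < m \<Longrightarrow> \<theta> (zi i' j) = \<iota> (h i')" by metis
      let ?v = "\<Sum>p<m. \<iota> (h p) * Y i p"
      have Yw: "Y i p \<in> V.span (words 1)" if "p < m" for p
        using that 2(2) U_words by (intro V.span_base) (auto simp: U_def)
      have "s \<theta> ?v = (\<Sum>p<m. \<iota> (h p) * s \<theta> (Y i p))"
      proof -
        have "s \<theta> (\<Sum>p\<in>I. \<iota> (h p) * Y i p) = (\<Sum>p\<in>I. \<iota> (h p) * s \<theta> (Y i p)) \<and> (\<Sum>p\<in>I. \<iota> (h p) * Y i p) \<in> R0 \<theta>"
          if "finite I" "I \<subseteq> {..<m}" for I
          using that
        proof induct
          case empty
          then show ?case using s_base[of 0] D(1) by simp
        next
          case (insert p I)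
          have Yp: "Y i p \<in> R0 \<theta>" using insert(4) Yw spanR by blast
          then show ?case using insert D(3,5) \<iota>R s_hom s_base by simp
        qed
        then show ?thesis by blast
      qed
      also have "\<dots> = (\<Sum>p<m. (\<Sum>q<m. Y i q * \<theta> (z q p)) * \<theta> (zi p j))"
        using 2 h by (intro sum.cong) (auto simp: s_eq[OF \<theta> s_Y[OF \<theta>]] mult.commute)
      also have "\<dots> = (\<Sum>q<m. Y i q * (\<Sum>p<m. \<theta> (z q p) * \<theta> (zi p j)))" by (rule sum_mult_assoc[symmetric])
      also have "\<dots> = (\<Sum>q<m. Y i q * (if q = j then 1 else 0))"
        using 2(3) by (intro sum.cong refl) (simp add: z_zi_point[OF \<theta>])
      also have "\<dots> = Y i j" by (rule sum_delta_mult(1)[OF 2(3)])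
      finally show ?thesis using 2(1) Yw by (intro bexI[of _ ?v]) (auto intro!: V.span_sum V.span_scale)
    qed
  qed
  have words: "words d \<subseteq> s \<theta> ` V.span (words d)"
  proof (induct d)
    case 0
    show ?case using V.span_base[of 1 "words 0"] s_base[of 1] by (auto intro!: image_eqI[of _ _ 1])
  next
    case (Suc d)
    show ?case
    proof
      fix x assume "x \<in> words (Suc d)"
      then obtain b u where x: "x = b * u" "b \<in> words d" "u \<in> U" by auto
      obtain w where w: "w \<in> V.span (words d)" "b = s \<theta> w" using Suc x by blast
      obtain v where v: "v \<in> V.span (words 1)" "u = s \<theta> v" using U x by blast
      have "w * v \<in> V.span (words (d + 1))" using span_times[OF _ w(1) v(1)] words_mult V.span_base by blast
      moreover have "x = s \<theta> (w * v)" using s_hom(2)[OF subsetD[OF spanR w(1)] subsetD[OF spanR v(1)]] x(1) w(2) v(2) by simp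
      ultimately show "x \<in> s \<theta> ` V.span (words (Suc d))" by auto
    qed
  qed
  show ?thesis
  proof
    fix x assume "x \<in> V.span (words d)"
    then show "x \<in> s \<theta> ` V.span (words d)"
    proof (induct rule: V.span_induct_alt)
      case base
      show ?case using s_base[of 0] V.span_zero by (auto intro!: image_eqI[of _ _ 0])
    next
      case (step c b y)
      obtain w v where *: "w \<in> V.span (words d)" "b = s \<theta> w" "v \<in> V.span (words d)" "y = s \<theta> v"
        using step words by blast
      have "\<iota> c * b + y = s \<theta> (\<iota> c * w + v)"
        using * spanR \<iota>R D s_hom s_base by (simp add: subset_iff)
      then show ?case by (rule image_eqI) (intro V.span_add V.span_scale *)
    qed
  qed
qed

lemma s_inj_R1:
  assumes "x \<in> R1" "s \<theta> x = 0"
  shows "x = 0"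
proof -
  note D = is_subringD[OF R0_subring[OF \<theta>]]
  obtain d where d: "x \<in> V.span (words d)" using assms by (auto simp: R1_def)
  have spanR: "y \<in> R0 \<theta>" if "y \<in> V.span (words d)" for y using R1_R0 that unfolding R1_def by blast
  have \<iota>R: "\<iota> k \<in> R0 \<theta>" for k using R1_gens(1) R1_R0 by blast
  show ?thesis
  proof (rule V.surjective_imp_injective_on_span[OF finite_words _ _ s_span_words_surj d assms(2)])
    show "s \<theta> (x + y) = s \<theta> x + s \<theta> y" if "x \<in> V.span (words d)" "y \<in> V.span (words d)" for x y
      using s_hom(1) spanR that by blast
    show "s \<theta> (\<iota> c * x) = \<iota> c * s \<theta> x" if "x \<in> V.span (words d)" for c x
      using s_hom(2)[OF \<iota>R spanR[OF that]] s_base by simp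
  qed
qed

text \<open>The fractions of \<open>R0\<close> exhaust E because those of K[Y] do, and injectivity
  on \<open>R0\<close> follows by clearing denominators. The extension is onto because its range is
  a subfield containing K and Y.\<close>

lemma automorphism_of_point:
  obtains \<sigma> where "\<sigma> \<in> galois_group DE \<iota>" "\<And>x. x \<in> R0 \<theta> \<Longrightarrow> \<sigma> x = s \<theta> x"
proof -
  note D = is_subringD[OF R0_subring[OF \<theta>]]
  have frac: "\<exists>a\<in>R0 \<theta>. \<exists>b\<in>R0 \<theta>. b \<noteq> 0 \<and> x = a / b" for x using R1_fractions[of x] R1_R0 by blast
  have inj: "x = 0" if x: "x \<in> R0 \<theta>" "s \<theta> x = 0" for x
  proof -
    obtain a b where ab: "a \<in> R1" "b \<in> R1" "b \<noteq> 0" "x = a / b" using R1_fractions by blast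
    then have "a = b * x" by simp
    then have "s \<theta> a = 0" using s_hom(2)[of b x] x ab R1_R0 by auto
    then show ?thesis using s_inj_R1 ab by simp
  qed
  obtain \<sigma> where \<sigma>: "field_hom \<sigma>" "\<And>x. x \<in> R0 \<theta> \<Longrightarrow> \<sigma> x = s \<theta> x"
    using hom_extend_to_fractions[OF R0_subring[OF \<theta>] frac, of "s \<theta>"] s_hom s_base[of 1] inj by auto
  interpret \<sigma>: field_hom \<sigma> by fact
  have \<sigma>\<iota>: "\<sigma> (\<iota> k) = \<iota> k" for k using \<sigma>(2)[of "\<iota> k"] s_base R1_gens(1) R1_R0 by auto
  have comm: "\<sigma> (DE x) = DE (\<sigma> x)" for x
  proof -
    let ?S = "{x. \<sigma> (DE x) = DE (\<sigma> x)}"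
    have "is_subfield ?S"
      unfolding is_subfield_def
      by (auto simp: derivation_add[OF DE] derivation_mult[OF DE] derivation_diff[OF DE] derivation_zero[OF DE]
          derivation_one[OF DE] derivation_inverse[OF DE] \<sigma>.hom_add \<sigma>.hom_mult \<sigma>.hom_minus \<sigma>.hom_inverse \<sigma>.hom_uminus)
    moreover have "R0 \<theta> \<subseteq> ?S"
    proof
      fix x assume x: "x \<in> R0 \<theta>"
      have "specialises \<theta> (r (DE x)) (DE (s \<theta> x))"
        using specialises_dT[OF \<theta> s_R0[OF \<theta> x]] by (simp add: dT)
      then have "DE x \<in> R0 \<theta>" "s \<theta> (DE x) = DE (s \<theta> x)" using s_eq[OF \<theta>] by (auto simp: R0_def[OF \<theta>])
      then show "x \<in> ?S" using \<sigma>(2) x by simp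
    qed
    moreover obtain a b where "a \<in> R0 \<theta>" "b \<in> R0 \<theta>" "x = a / b" using frac by blast
    ultimately have "x \<in> ?S" using is_subfieldD(8)[of ?S a b] by blast
    then show ?thesis by blast
  qed
  have "range \<sigma> = UNIV"
  proof (rule generated[OF is_subfield_range[OF \<sigma>(1)]])
    show "range \<iota> \<subseteq> range \<sigma>" using \<sigma>\<iota> by (metis image_subsetI rangeI)
    fix i j assume ij: "i < m" "j < m"
    then have "Y i j \<in> V.span (words 1)" by (intro V.span_base) (auto simp: U_def)
    then obtain w where "w \<in> V.span (words 1)" "Y i j = s \<theta> w" using s_span_words_surj by blast
    moreover from this have "w \<in> R0 \<theta>" using R1_R0 unfolding R1_def by blast
    ultimately show "Y i j \<in> range \<sigma>" using \<sigma>(2)[of w] by (intro range_eqI[of _ _ w]) simp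
  qed
  then have "bij \<sigma>" using \<sigma>.inj_f by (simp add: bij_def)
  then have "\<sigma> \<in> galois_group DE \<iota>" using \<sigma>(1) comm \<sigma>\<iota> by (simp add: galois_group_def)
  then show ?thesis by (rule that[OF _ \<sigma>(2)])
qed

end

theorem galois_moves:
  assumes a: "a \<notin> range \<iota>"
  obtains \<sigma> where "\<sigma> \<in> galois_group DE \<iota>" "\<sigma> a \<noteq> a"
proof -
  obtain b c where bc: "b \<in> R1" "c \<in> R1" "c \<noteq> 0" "a = b / c" using R1_fractions by blast
  \<comment> \<open>Q is c \<otimes> c times 1 \<otimes> a - a \<otimes> 1, cleared of denominators
    so that it lies in E . B. The value of Q at a point vanishes if the resulting automorphism fixes
    a = b / c.\<close>
  define Q where "Q = r b * l c - l b * r c"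
  have Q: "specialises \<theta> Q (s \<theta> b * c - b * s \<theta> c)" if \<theta>: "point \<theta>" for \<theta>
    unfolding Q_def using R1_R0[OF \<theta>] bc
    by (intro specialises_diff[OF \<theta>] specialises_mult[OF \<theta>] specialises_l[OF \<theta>] s_R0[OF \<theta>]) auto
  \<comment> \<open>Any point yields an expansion of Q with independent e i. The expansion itself is
    a congruence free of \<theta>0, and the decisive point is chosen afterwards to suit one of the q
    i.\<close>
  obtain \<theta>0 where \<theta>0: "point \<theta>0" using exists_point[OF B_D(2)] one_not_in_J by auto
  obtain I :: "nat set" and e q where I: "finite I" "lin_indep C I e" "\<And>i. i \<in> I \<Longrightarrow> q i \<in> B"
    "Q \<approx> (\<Sum>i\<in>I. l (e i) * q i)"
    using specialises_indep[OF Q[OF \<theta>0] \<theta>0] by blast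
  have "\<exists>i\<in>I. \<forall>n. q i ^ n \<notin> J"
  proof (rule ccontr)
    assume "\<not> ?thesis"
    then have nil: "\<exists>n. q i ^ n \<in> J" if "i \<in> I" for i using that by blast
    have "\<exists>n. (l (e i) * q i) ^ n \<in> J" if i: "i \<in> I" for i
    proof -
      obtain n where "q i ^ n \<in> J" using nil[OF i] by blast
      then have "l (e i) ^ n * q i ^ n \<in> J" by (rule J_ideal(3))
      then show ?thesis by (auto simp: power_mult_distrib)
    qed
    then obtain n where n: "(\<Sum>i\<in>I. l (e i) * q i) ^ n \<in> J"
      using nilpotent_sum[OF is_ideal_tensor_kernel I(1), of "\<lambda>i. l (e i) * q i"] by blast
    have Qn: "Q ^ n \<in> J" using eqJ_in_J[OF eqJ_power[OF I(4)] n] .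
    have b: "b = a * c" using bc by simp
    have "Q \<approx> r a * r c * l c - l b * r c" unfolding Q_def b by (intro eqJ_diff eqJ_mult r_mult eqJ_refl)
    also have "\<dots> = r c * l c * (r a - l a)" by (simp add: b l.hom_mult algebra_simps)
    finally have "r c * l c * (r a - l a) \<approx> Q" by (rule eqJ_sym)
    then have "(r c * l c * (r a - l a)) ^ n \<in> J" using eqJ_in_J[OF eqJ_power Qn] by blast
    then have 1: "(r (inverse c) * l (inverse c)) ^ n * (r c * l c * (r a - l a)) ^ n \<in> J" by (rule J_ideal(3))
    have "r (inverse c) * r c \<approx> 1"
      using eqJ_trans[OF eqJ_sym[OF r_mult[of "inverse c" c]]] r_1 bc(3) by simp
    then have "r (inverse c) * r c * (l (inverse c) * l c) * (r a - l a) \<approx> 1 * 1 * (r a - l a)"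
      using bc(3) by (intro eqJ_mult) (auto simp flip: l.hom_mult)
    then have "r (inverse c) * l (inverse c) * (r c * l c * (r a - l a)) \<approx> r a - l a"
      by (simp add: mult_ac)
    from eqJ_power[OF eqJ_sym[OF this], of n] have "(r a - l a) ^ n \<in> J"
      using eqJ_in_J 1 by (simp add: power_mult_distrib)
    then show False using tensor_diff_not_nilpotent[OF a] by blast
  qed
  then obtain i where i: "i \<in> I" "\<And>n. q i ^ n \<notin> J" by blast
  obtain \<theta> where \<theta>: "point \<theta>" "\<theta> (q i) \<noteq> 0" using exists_point[OF I(3)[OF i(1)] i(2)] by blast
  have "specialises \<theta> Q (\<Sum>i\<in>I. e i * \<theta> (q i))"
    by (rule specialises_eqJ[OF \<theta>(1) specialises_sum[OF \<theta>(1)] I(4)]) (intro specialises.gen I(3))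
  then have eq: "s \<theta> b * c - b * s \<theta> c = (\<Sum>i\<in>I. \<theta> (q i) * e i)"
    using specialises_unique[OF \<theta>(1) Q[OF \<theta>(1)]] by (simp add: mult.commute)
  \<comment> \<open>The \<theta>(q i) are constants, not all zero, and the e i are independent over
    the constants.\<close>
  have ne: "(\<Sum>i\<in>I. \<theta> (q i) * e i) \<noteq> 0"
    using lin_indepD[OF I(2), of "\<lambda>i. \<theta> (q i)" i] \<theta>(2) i(1) point_onD(1)[OF \<theta>(1) I(3)] by blast
  obtain \<sigma> where \<sigma>: "\<sigma> \<in> galois_group DE \<iota>" "\<And>x. x \<in> R0 \<theta> \<Longrightarrow> \<sigma> x = s \<theta> x"
    using automorphism_of_point[OF \<theta>(1)] by blast
  interpret \<sigma>: field_hom \<sigma> using \<sigma>(1) by (simp add: galois_group_def)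
  have "\<sigma> a \<noteq> a"
  proof
    assume "\<sigma> a = a"
    moreover have "\<sigma> b = \<sigma> a * \<sigma> c" using bc by (simp flip: \<sigma>.hom_mult)
    moreover have "\<sigma> b = s \<theta> b" "\<sigma> c = s \<theta> c" using \<sigma>(2) R1_R0[OF \<theta>(1)] bc by auto
    ultimately have "s \<theta> b * c - b * s \<theta> c = 0" using bc(3,4) by (simp add: field_simps)
    then show False using eq ne by simp
  qed
  then show ?thesis using that \<sigma>(1) by blast
qed

end

section \<open>The Wronskian matrix of a Picard--Vessiot extension\<close>

lemma CHAR_0_field_hom:
  fixes h :: "'a::field \<Rightarrow> 'b::field"
  assumes "field_hom h" "CHAR('a) = 0"
  shows "CHAR('b) = 0"
  unfolding CHAR_eq0_iff
proof (intro allI impI)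
  interpret field_hom h by fact
  fix n :: nat assume "n > 0"
  then have "h (of_nat n) \<noteq> 0" using CHAR_0_of_nat_eq_0[OF assms(2), of n] by simp
  then show "(of_nat n :: 'b) \<noteq> 0" by (simp only: hom_of_nat not_False_eq_True)
qed

lemma mat_mult_entry:
  assumes "A \<in> carrier_mat n n" "B \<in> carrier_mat n n" "i < n" "j < n"
  shows "(A * B) $$ (i, j) = (\<Sum>p<n. A $$ (i, p) * B $$ (p, j))"
  using assms by (auto simp: scalar_prod_def atLeast0LessThan intro!: sum.cong)

definition inverse_entries :: "nat \<Rightarrow> (nat \<Rightarrow> nat \<Rightarrow> 'a::field) \<Rightarrow> (nat \<Rightarrow> nat \<Rightarrow> 'a) \<Rightarrow> bool" where
  "inverse_entries n A B \<longleftrightarrow> (\<forall>i<n. \<forall>j<n. (\<Sum>p<n. B i p * A p j) = (if i = j then 1 else 0) \<and>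
     (\<Sum>p<n. A i p * B p j) = (if i = j then 1 else 0))"

lemma inverse_entries_of_det:
  fixes A :: "'a::field Matrix.mat"
  assumes A: "A \<in> carrier_mat n n" and det: "Determinant.det A \<noteq> 0"
  shows "\<exists>B. inverse_entries n (\<lambda>i j. A $$ (i, j)) B"
proof -
  note adj = adj_mat[OF A]
  let ?Bi = "\<lambda>i j. adj_mat A $$ (i, j) / Determinant.det A"
  have "(\<Sum>p<n. ?Bi i p * A $$ (p, j)) = (if i = j then 1 else 0)" if ij: "i < n" "j < n" for i j
  proof -
    have "(\<Sum>p<n. ?Bi i p * A $$ (p, j)) = (\<Sum>p<n. adj_mat A $$ (i, p) * A $$ (p, j)) / Determinant.det A"
      by (simp add: sum_divide_distrib)
    also have "(\<Sum>p<n. adj_mat A $$ (i, p) * A $$ (p, j)) = (adj_mat A * A) $$ (i, j)"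
      by (rule mat_mult_entry[OF adj(1) A ij, symmetric])
    also have "\<dots> / Determinant.det A = (if i = j then 1 else 0)" unfolding adj(3) using ij det by simp
    finally show ?thesis .
  qed
  moreover have "(\<Sum>p<n. A $$ (i, p) * ?Bi p j) = (if i = j then 1 else 0)" if ij: "i < n" "j < n" for i j
  proof -
    have "(\<Sum>p<n. A $$ (i, p) * ?Bi p j) = (\<Sum>p<n. A $$ (i, p) * adj_mat A $$ (p, j)) / Determinant.det A"
      by (simp add: sum_divide_distrib)
    also have "(\<Sum>p<n. A $$ (i, p) * adj_mat A $$ (p, j)) = (A * adj_mat A) $$ (i, j)"
      by (rule mat_mult_entry[OF A adj(1) ij, symmetric])
    also have "\<dots> / Determinant.det A = (if i = j then 1 else 0)" unfolding adj(2) using ij det by simp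
    finally show ?thesis .
  qed
  ultimately have "inverse_entries n (\<lambda>i j. A $$ (i, j)) ?Bi" unfolding inverse_entries_def by blast
  then show ?thesis by blast
qed

lemma algebraically_closed_subfield_image:
  fixes \<iota> :: "'k::field \<Rightarrow> 'e::field"
  assumes "field_hom \<iota>" "algebraically_closed_subfield C"
  shows "algebraically_closed_subfield (\<iota> ` C)"
  unfolding algebraically_closed_subfield_def
proof (intro allI impI, elim conjE)
  interpret \<iota>: field_hom \<iota> by fact
  fix p :: "'e poly" assume p: "\<forall>i. coeff p i \<in> \<iota> ` C" "degree p > 0"
  define q where "q = map_poly (inv_into UNIV \<iota>) p"
  have inv0: "inv_into UNIV \<iota> 0 = 0" using inv_into_f_f[of \<iota> UNIV 0] \<iota>.inj_f by simp
  have c: "\<iota> (coeff q i) = coeff p i" "coeff q i \<in> C" for i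
  proof -
    obtain k where k: "coeff p i = \<iota> k" "k \<in> C" using p(1) by blast
    then have "coeff q i = k" using inv_into_f_f[of \<iota> UNIV k] \<iota>.inj_f by (simp add: q_def coeff_map_poly inv0)
    then show "\<iota> (coeff q i) = coeff p i" "coeff q i \<in> C" using k by auto
  qed
  have "map_poly \<iota> q = p" by (rule poly_eqI) (simp add: coeff_map_poly c)
  moreover have deg: "degree (map_poly \<iota> q) = degree q" by (rule degree_map_poly) auto
  ultimately have "degree q > 0" using p(2) by simp
  then obtain x where x: "x \<in> C" "poly q x = 0"
    using assms(2) c(2) unfolding algebraically_closed_subfield_def by blast
  have "poly (map_poly \<iota> q) (\<iota> x) = \<iota> (poly q x)"
    by (simp add: poly_altdef deg coeff_map_poly \<iota>.hom_sum \<iota>.hom_mult \<iota>.hom_power)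
  with \<open>map_poly \<iota> q = p\<close> show "\<exists>x\<in>\<iota> ` C. poly p x = 0" using x by auto
qed

text \<open>The equation and the basis are parameters and not chosen from
  \<open>picard_vessiot\<close>, because the coordinates on the Galois group in
  \<open>GL_galois_iso\<close> refer to one particular fundamental system.\<close>

locale fundamental_solutions =
  fixes DK :: "'k::field \<Rightarrow> 'k" and DE :: "'e::field \<Rightarrow> 'e" and \<iota> :: "'k \<Rightarrow> 'e"
    and m :: nat and y :: "nat \<Rightarrow> 'e" and a :: "nat \<Rightarrow> 'k"
  assumes pv: "picard_vessiot DK DE \<iota>"
    and basis: "basis_over (constants DK) \<iota> m y (ode_solutions DE \<iota> m a)"
    and hull: "differential_subfield DE hull (range \<iota> \<union> ode_solutions DE \<iota> m a) = UNIV"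
begin

lemma extension: "differential_extension DK DE \<iota>" and charK: "CHAR('k) = 0"
  and alg_closed_K: "algebraically_closed_subfield (constants DK)" and constants: "constants DE = \<iota> ` constants DK"
  using pv by (auto simp: picard_vessiot_def)

lemma \<iota>: "field_hom \<iota>" and DE: "derivation DE" and DK: "derivation DK" and DE_\<iota>: "DE (\<iota> x) = \<iota> (DK x)"
  using extension by (auto simp: differential_extension_def)

sublocale \<iota>: field_hom \<iota> by (rule \<iota>)

lemma char_0: "CHAR('e) = 0"
  by (rule CHAR_0_field_hom[OF \<iota> charK])

lemma alg_closed: "algebraically_closed_subfield (constants DE)"
  unfolding constants by (rule algebraically_closed_subfield_image[OF \<iota> alg_closed_K])

lemma solutions: "ode_solutions DE \<iota> m a = {\<Sum>i<m. \<iota> (c i) * y i | c. \<forall>i<m. c i \<in> constants DK}"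
  and basis_indep: "\<forall>i<m. c i \<in> constants DK \<Longrightarrow> (\<Sum>i<m. \<iota> (c i) * y i) = 0 \<Longrightarrow> i < m \<Longrightarrow> c i = 0"
  using basis unfolding basis_over_def by blast+

lemmas K_const = is_subfieldD[OF is_subfield_constants[OF DK]]

lemma y_solution: "j < m \<Longrightarrow> y j \<in> ode_solutions DE \<iota> m a"
proof -
  assume j: "j < m"
  have "(\<Sum>i<m. \<iota> (if i = j then 1 else 0) * y i) = (\<Sum>i<m. (if j = i then 1 else 0) * y i)"
    by (intro sum.cong) auto
  also have "\<dots> = y j" by (rule sum_delta_mult(2)[OF j])
  finally show ?thesis unfolding solutions using K_const(1,2)
    by (intro CollectI exI[of _ "\<lambda>i. if i = j then 1 else 0"]) auto
qed

lemma solution_ode: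
  assumes "x \<in> ode_solutions DE \<iota> m a"
  shows "(DE ^^ m) x = (\<Sum>i<m. - \<iota> (a i) * (DE ^^ i) x)"
  using assms by (simp add: ode_solutions_def eq_neg_iff_add_eq_0 sum_negf)

lemma lin_indep_y: "lin_indep (constants DE) {..<m} y"
  unfolding lin_indep_def
proof (intro allI impI, elim conjE)
  fix c assume c: "\<forall>j\<in>{..<m}. c j \<in> constants DE" "(\<Sum>j<m. c j * y j) = 0"
  then have "\<forall>j. \<exists>k. j < m \<longrightarrow> k \<in> constants DK \<and> c j = \<iota> k" unfolding constants by auto
  then obtain b where b: "\<And>j. j < m \<Longrightarrow> b j \<in> constants DK \<and> c j = \<iota> (b j)" by metis
  have "(\<Sum>j<m. \<iota> (b j) * y j) = 0" using c(2) b by simp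
  then have "b j = 0" if "j < m" for j using basis_indep[of b j] b that by blast
  then show "\<forall>j\<in>{..<m}. c j = 0" using b by simp
qed

definition Y where "Y i j = (DE ^^ i) (y j)"

definition Ym where "Ym = Matrix.mat m m (\<lambda>(i, j). Y i j)"

text \<open>The companion matrix of the scalar equation, so that the Wronskian matrix satisfies Y' =
  A Y.\<close>

definition A where "A i p = (if Suc i = m then - a p else if p = Suc i then 1 else 0)"

lemma Y_ode:
  assumes "i < m" "j < m"
  shows "DE (Y i j) = (\<Sum>p<m. \<iota> (A i p) * Y p j)"
proof (cases "Suc i = m")
  case True
  have "DE (Y i j) = (DE ^^ m) (y j)" using True by (auto simp: Y_def)
  also have "\<dots> = (\<Sum>p<m. - \<iota> (a p) * (DE ^^ p) (y j))" by (rule solution_ode[OF y_solution[OF assms(2)]])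
  finally show ?thesis using True by (simp add: A_def Y_def \<iota>.hom_uminus)
next
  case False
  then have i: "Suc i < m" using assms by simp
  have "(\<Sum>p<m. \<iota> (A i p) * Y p j) = (\<Sum>p<m. (if Suc i = p then 1 else 0) * Y p j)"
    using False by (intro sum.cong) (auto simp: A_def)
  also have "\<dots> = Y (Suc i) j" by (rule sum_delta_mult(2)[OF i])
  finally show ?thesis by (simp add: Y_def)
qed

text \<open>\<open>wronskian_indep\<close> wants a relation between the derivatives of every order,
  while a singular \<open>Ym\<close> gives one only below order m. The equation reduces the higher
  derivatives to the lower ones.\<close>

lemma higher_derivatives: "\<exists>b. \<forall>j<m. (DE ^^ i) (y j) = (\<Sum>p<m. b p * Y p j)"
proof (cases "m = 0")
  case False
  then have m: "0 < m" by simp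
  show ?thesis
  proof (induct i)
    case 0
    have "(DE ^^ 0) (y j) = (\<Sum>p<m. (if 0 = p then 1 else 0) * Y p j)" for j
      using sum_delta_mult(2)[OF m, of "\<lambda>p. Y p j"] by (simp add: Y_def)
    then show ?case by (intro exI[of _ "\<lambda>p. if 0 = p then 1 else 0"]) blast
  next
    case (Suc i)
    then obtain b where b: "\<And>j. j < m \<Longrightarrow> (DE ^^ i) (y j) = (\<Sum>p<m. b p * Y p j)" by blast
    have "(DE ^^ Suc i) (y j) = (\<Sum>p<m. (DE (b p) + (\<Sum>q<m. b q * \<iota> (A q p))) * Y p j)" if j: "j < m" for j
    proof -
      have "(DE ^^ Suc i) (y j) = (\<Sum>p<m. DE (b p) * Y p j) + (\<Sum>q<m. b q * DE (Y q j))"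
        using b[OF j] by (simp add: derivation_sum[OF DE] derivation_mult[OF DE] sum.distrib)
      also have "(\<Sum>q<m. b q * DE (Y q j)) = (\<Sum>q<m. b q * (\<Sum>p<m. \<iota> (A q p) * Y p j))"
        using j by (intro sum.cong) (auto simp: Y_ode)
      also have "\<dots> = (\<Sum>p<m. (\<Sum>q<m. b q * \<iota> (A q p)) * Y p j)" by (rule sum_mult_assoc)
      finally show ?thesis by (simp add: sum.distrib[symmetric] distrib_right)
    qed
    then show ?case by (intro exI[of _ "\<lambda>p. DE (b p) + (\<Sum>q<m. b q * \<iota> (A q p))"]) blast
  qed
qed simp

lemma Ym: "Ym \<in> carrier_mat m m" by (simp add: Ym_def)

lemma det_Ym: "Determinant.det Ym \<noteq> 0"
proof
  assume "Determinant.det Ym = 0"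
  then obtain v where v: "v \<in> carrier_vec m" "v \<noteq> 0\<^sub>v m" "Ym *\<^sub>v v = 0\<^sub>v m"
    using det_0_iff_vec_prod_zero_field[OF Ym] by blast
  have 0: "(\<Sum>j<m. Y i j * vec_index v j) = 0" if "i < m" for i
  proof -
    have "vec_index (Ym *\<^sub>v v) i = (\<Sum>j<m. Y i j * vec_index v j)"
      using that v(1) by (auto simp: Ym_def scalar_prod_def atLeast0LessThan)
    then show ?thesis using v(3) that by simp
  qed
  have "(\<Sum>j\<in>{..<m}. vec_index v j * (DE ^^ i) (y j)) = 0" for i
  proof -
    obtain b where b: "\<And>j. j < m \<Longrightarrow> (DE ^^ i) (y j) = (\<Sum>p<m. b p * Y p j)" using higher_derivatives by blast
    have "(\<Sum>j<m. vec_index v j * (DE ^^ i) (y j)) = (\<Sum>j<m. (\<Sum>p<m. b p * Y p j) * vec_index v j)"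
      using b by (intro sum.cong) auto
    also have "\<dots> = (\<Sum>p<m. b p * (\<Sum>j<m. Y p j * vec_index v j))" by (rule sum_mult_assoc[symmetric])
    also have "\<dots> = 0" using 0 by simp
    finally show ?thesis .
  qed
  then have "vec_index v j = 0" if "j < m" for j
    using wronskian_indep[OF DE, of "{..<m}" y "vec_index v" j] lin_indep_y that by simp
  then have "v = 0\<^sub>v m" using v(1) by (intro eq_vecI) auto
  then show False using v(2) by blast
qed

definition Yi where "Yi = (SOME B. inverse_entries m Y B)"

lemma Yi:
  assumes "i < m" "j < m"
  shows "(\<Sum>p<m. Yi i p * Y p j) = (if i = j then 1 else 0)" "(\<Sum>p<m. Y i p * Yi p j) = (if i = j then 1 else 0)"
proof -
  obtain B where "inverse_entries m (\<lambda>i j. Ym $$ (i, j)) B" using inverse_entries_of_det[OF Ym det_Ym] by blast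
  then have "inverse_entries m Y B" by (simp add: inverse_entries_def Ym_def)
  then have "inverse_entries m Y Yi" unfolding Yi_def by (rule someI[of "inverse_entries m Y"])
  then show "(\<Sum>p<m. Yi i p * Y p j) = (if i = j then 1 else 0)" "(\<Sum>p<m. Y i p * Yi p j) = (if i = j then 1 else 0)"
    using assms unfolding inverse_entries_def by blast+
qed

text \<open>The equation expresses the derivatives of Y through K and Y, so the smallest subfield
  containing both is already a differential subfield.\<close>

lemma generated_by_Y:
  assumes S: "is_subfield S" "range \<iota> \<subseteq> S" and Y: "\<And>i j. i < m \<Longrightarrow> j < m \<Longrightarrow> Y i j \<in> S"
  shows "S = UNIV"
proof -
  define F where "F = \<Inter>{S. is_subfield S \<and> range \<iota> \<subseteq> S \<and> (\<forall>i<m. \<forall>j<m. Y i j \<in> S)}"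
  have FS: "F \<subseteq> S'" if "is_subfield S'" "range \<iota> \<subseteq> S'" "\<And>i j. i < m \<Longrightarrow> j < m \<Longrightarrow> Y i j \<in> S'" for S'
    unfolding F_def using that by (intro Inter_lower) simp
  have F: "is_subfield F" unfolding F_def is_subfield_def by auto
  have F\<iota>: "\<iota> k \<in> F" for k unfolding F_def by auto
  have FY: "Y i j \<in> F" if "i < m" "j < m" for i j unfolding F_def using that by auto
  note FD = is_subfieldD[OF F]
  let ?G = "{x \<in> F. DE x \<in> F}"
  have "is_subfield ?G"
    unfolding is_subfield_def using FD
    by (auto simp: derivation_add[OF DE] derivation_mult[OF DE] derivation_diff[OF DE] derivation_zero[OF DE]
        derivation_one[OF DE] derivation_inverse[OF DE])
  moreover have "range \<iota> \<subseteq> ?G" using F\<iota> DE_\<iota> by auto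
  moreover have "Y i j \<in> ?G" if "i < m" "j < m" for i j
    using that FY F\<iota> FD(5) by (auto simp: Y_ode intro!: is_subfield_sum[OF F])
  ultimately have FG: "F \<subseteq> ?G" by (rule FS)
  have "differential_subfield DE F"
  proof -
    have "DE x \<in> F" if "x \<in> F" for x using FG that by blast
    then show ?thesis by (simp add: differential_subfield_def FD)
  qed
  moreover have "range \<iota> \<union> ode_solutions DE \<iota> m a \<subseteq> F"
  proof -
    have "(\<Sum>i<m. \<iota> (c i) * y i) \<in> F" for c
    proof (rule is_subfield_sum[OF F])
      fix i assume "i \<in> {..<m}"
      then have "Y 0 i \<in> F" by (intro FY) auto
      then show "\<iota> (c i) * y i \<in> F" using F\<iota> FD(5) by (simp add: Y_def)
    qed
    then show ?thesis using F\<iota> unfolding solutions by auto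
  qed
  ultimately have "UNIV \<subseteq> F" using hull_minimal[of _ F "differential_subfield DE"] hull by metis
  then show ?thesis using FS[OF S Y] by blast
qed

sublocale matrix_extension DK DE \<iota> m Y Yi A
proof unfold_locales
  show "differential_extension DK DE \<iota>" by (rule extension)
  show "CHAR('e) = 0" by (rule char_0)
  show "constants DE \<subseteq> range \<iota>" using constants by blast
  show "algebraically_closed_subfield (constants DE)" by (rule alg_closed)
qed (use Yi Y_ode generated_by_Y in auto)

subsection \<open>The matrix of a differential automorphism\<close>

abbreviation G where "G \<equiv> galois_group DE \<iota>"

lemma galois_hom:
  assumes "\<sigma> \<in> G"
  shows "field_hom \<sigma>" "\<sigma> (\<iota> k) = \<iota> k" "\<sigma> (DE x) = DE (\<sigma> x)" "\<sigma> ((DE ^^ i) x) = (DE ^^ i) (\<sigma> x)"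
proof -
  show 1: "field_hom \<sigma>" "\<sigma> (\<iota> k) = \<iota> k" "\<sigma> (DE x) = DE (\<sigma> x)" for k x using assms by (auto simp: galois_group_def)
  show "\<sigma> ((DE ^^ i) x) = (DE ^^ i) (\<sigma> x)" by (induct i) (simp_all add: 1)
qed

text \<open>The \<open>THE\<close> in the definition is justified: \<sigma> maps solutions to
  solutions, and coordinates in a basis are unique.\<close>

lemma galois_matrix:
  assumes \<sigma>: "\<sigma> \<in> G"
  shows "galois_matrix DK \<iota> m y \<sigma> \<in> carrier_mat m m"
    and "j < m \<Longrightarrow> \<sigma> (y j) = (\<Sum>i<m. \<iota> (galois_matrix DK \<iota> m y \<sigma> $$ (i, j)) * y i)"
    and "i < m \<Longrightarrow> j < m \<Longrightarrow> galois_matrix DK \<iota> m y \<sigma> $$ (i, j) \<in> constants DK"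
proof -
  interpret \<sigma>: field_hom \<sigma> using galois_hom(1)[OF \<sigma>] .
  let ?P = "\<lambda>B. B \<in> carrier_mat m m \<and> (\<forall>i<m. \<forall>j<m. B $$ (i, j) \<in> constants DK) \<and>
             (\<forall>j<m. \<sigma> (y j) = (\<Sum>i<m. \<iota> (B $$ (i, j)) * y i))"
  have "\<exists>c. (\<forall>i<m. c i \<in> constants DK) \<and> \<sigma> (y j) = (\<Sum>i<m. \<iota> (c i) * y i)" if j: "j < m" for j
  proof -
    have "(DE ^^ m) (\<sigma> (y j)) + (\<Sum>i<m. \<iota> (a i) * (DE ^^ i) (\<sigma> (y j)))
       = \<sigma> ((DE ^^ m) (y j) + (\<Sum>i<m. \<iota> (a i) * (DE ^^ i) (y j)))"
      by (simp add: \<sigma>.hom_add \<sigma>.hom_sum \<sigma>.hom_mult galois_hom[OF \<sigma>])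
    also have "\<dots> = 0" using y_solution[OF j] by (simp add: ode_solutions_def)
    finally have "\<sigma> (y j) \<in> ode_solutions DE \<iota> m a" by (simp add: ode_solutions_def)
    then show ?thesis unfolding solutions by blast
  qed
  then obtain c where c: "\<And>i j. j < m \<Longrightarrow> i < m \<Longrightarrow> c j i \<in> constants DK"
    "\<And>j. j < m \<Longrightarrow> \<sigma> (y j) = (\<Sum>i<m. \<iota> (c j i) * y i)" by metis
  let ?B = "Matrix.mat m m (\<lambda>(i, j). c j i)"
  have B: "?P ?B" using c by auto
  have "B = ?B" if B: "?P B" for B
  proof (rule eq_matI)
    fix i j assume ij: "i < dim_row ?B" "j < dim_col ?B"
    have "(\<Sum>i<m. \<iota> (B $$ (i, j) - c j i) * y i) = (\<Sum>i<m. \<iota> (B $$ (i, j)) * y i) - (\<Sum>i<m. \<iota> (c j i) * y i)"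
      by (simp add: \<iota>.hom_minus left_diff_distrib sum_subtractf)
    also have "\<dots> = 0" using B c(2)[of j] ij by simp
    finally have "B $$ (i, j) - c j i = 0"
      by (rule basis_indep[rotated]) (use B c(1) K_const(4) ij in auto)
    then show "B $$ (i, j) = ?B $$ (i, j)" using ij by simp
  qed (use B in auto)
  with B have "?P (galois_matrix DK \<iota> m y \<sigma>)"
    unfolding galois_matrix_def by (rule theI)
  then show "galois_matrix DK \<iota> m y \<sigma> \<in> carrier_mat m m"
    and "j < m \<Longrightarrow> \<sigma> (y j) = (\<Sum>i<m. \<iota> (galois_matrix DK \<iota> m y \<sigma> $$ (i, j)) * y i)"
    and "i < m \<Longrightarrow> j < m \<Longrightarrow> galois_matrix DK \<iota> m y \<sigma> $$ (i, j) \<in> constants DK" by blast+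
qed

lemma galois_matrix_Y:
  assumes \<sigma>: "\<sigma> \<in> G" and "p < m" "j < m"
  shows "\<sigma> (Y p j) = (\<Sum>i<m. Y p i * \<iota> (galois_matrix DK \<iota> m y \<sigma> $$ (i, j)))"
proof -
  have const: "DE (\<iota> (galois_matrix DK \<iota> m y \<sigma> $$ (i, j))) = 0" if "i < m" for i
  proof -
    have "constants DE = \<iota> ` constants DK" by (rule constants)
    moreover have "galois_matrix DK \<iota> m y \<sigma> $$ (i, j) \<in> constants DK"
      using galois_matrix(3)[OF \<sigma> that assms(3)] .
    ultimately show ?thesis by (auto simp: constants_def)
  qed
  have "(DE ^^ p) (\<Sum>i<m. \<iota> (galois_matrix DK \<iota> m y \<sigma> $$ (i, j)) * y i)
     = (\<Sum>i<m. \<iota> (galois_matrix DK \<iota> m y \<sigma> $$ (i, j)) * (DE ^^ p) (y i))"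
    by (induct p) (simp_all add: derivation_sum[OF DE] derivation_mult[OF DE] const)
  then show ?thesis using galois_matrix(2)[OF \<sigma> assms(3)] galois_hom(4)[OF \<sigma>] by (simp add: Y_def mult.commute)
qed

text \<open>Functions on the Galois group of the form \<open>\<sigma> \<mapsto> \<Sum> e\<^sub>k \<sigma>(r\<^sub>k)\<close>: the regular functions are among
  them, since the matrix of \<open>\<sigma>\<close> is \<open>Y\<^sup>-\<^sup>1 \<sigma>(Y)\<close>.\<close>

definition representable :: "(('e \<Rightarrow> 'e) \<Rightarrow> 'k) \<Rightarrow> bool" where
  "representable f \<longleftrightarrow> (\<exists>ps. \<forall>\<sigma>\<in>G. \<iota> (f \<sigma>) = (\<Sum>(e, x)\<leftarrow>ps. e * \<sigma> x))"

lemma representable_regular: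
  assumes "f \<in> function_algebra (constants DK) (galois_coordinates DK \<iota> m y)"
  shows "representable f"
  using assms
proof (induct rule: function_algebra.induct)
  case (const c)
  have "\<iota> c = (\<Sum>(e, x)\<leftarrow>[(1, \<iota> c)]. e * \<sigma> x)" if "\<sigma> \<in> G" for \<sigma>
    by (simp add: galois_hom(2)[OF that])
  then show ?case unfolding representable_def by blast
next
  case (gen f)
  consider i j where "i < m" "j < m" "f = (\<lambda>\<sigma>. galois_matrix DK \<iota> m y \<sigma> $$ (i, j))"
    | "f = (\<lambda>\<sigma>. inverse (Determinant.det (galois_matrix DK \<iota> m y \<sigma>)))"
    using gen by (auto simp: galois_coordinates_def)
  then show ?case
  proof cases
    case 1
    have "\<iota> (f \<sigma>) = (\<Sum>(e, x)\<leftarrow>map (\<lambda>p. (Yi i p, Y p j)) [0..<m]. e * \<sigma> x)" if \<sigma>: "\<sigma> \<in> G" for \<sigma>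
    proof -
      have "(\<Sum>p<m. Yi i p * \<sigma> (Y p j)) = (\<Sum>p<m. Yi i p * (\<Sum>q<m. Y p q * \<iota> (galois_matrix DK \<iota> m y \<sigma> $$ (q, j))))"
        using 1 by (intro sum.cong) (auto simp: galois_matrix_Y[OF \<sigma>])
      also have "\<dots> = (\<Sum>q<m. (\<Sum>p<m. Yi i p * Y p q) * \<iota> (galois_matrix DK \<iota> m y \<sigma> $$ (q, j)))" by (rule sum_mult_assoc)
      also have "\<dots> = (\<Sum>q<m. (if i = q then 1 else 0) * \<iota> (galois_matrix DK \<iota> m y \<sigma> $$ (q, j)))"
        using 1 by (intro sum.cong) (auto simp: Yi)
      also have "\<dots> = \<iota> (f \<sigma>)" using sum_delta_mult(2)[OF 1(1)] 1(3) by simp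
      finally show ?thesis by (simp add: o_def interv_sum_list_conv_sum_set_nat atLeast0LessThan)
    qed
    then show ?thesis unfolding representable_def by blast
  next
    case 2
    let ?d = "Determinant.det Ym"
    \<comment> \<open>From \<sigma>(Y) = Y M follows det M = \<sigma>(det Y) / det Y, so the inverse
      of det M is the single term det Y * \<sigma>(1 / det Y).\<close>
    have "\<iota> (f \<sigma>) = (\<Sum>(e, x)\<leftarrow>[(?d, inverse ?d)]. e * \<sigma> x)" if \<sigma>: "\<sigma> \<in> G" for \<sigma>
    proof -
      interpret \<sigma>: field_hom \<sigma> using galois_hom(1)[OF \<sigma>] .
      let ?M = "galois_matrix DK \<iota> m y \<sigma>"
      have M: "?M \<in> carrier_mat m m" by (rule galois_matrix(1)[OF \<sigma>])
      have "map_mat \<sigma> Ym = Ym * map_mat \<iota> ?M"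
      proof (rule eq_matI)
        fix i j assume "i < dim_row (Ym * map_mat \<iota> ?M)" "j < dim_col (Ym * map_mat \<iota> ?M)"
        then have ij: "i < m" "j < m" using M Ym by auto
        have "(Ym * map_mat \<iota> ?M) $$ (i, j) = (\<Sum>p<m. Ym $$ (i, p) * map_mat \<iota> ?M $$ (p, j))"
          by (rule mat_mult_entry[OF Ym _ ij]) (use M in auto)
        also have "\<dots> = \<sigma> (Y i j)" using ij M by (simp add: galois_matrix_Y[OF \<sigma>] Ym_def)
        finally show "map_mat \<sigma> Ym $$ (i, j) = (Ym * map_mat \<iota> ?M) $$ (i, j)" using ij by (simp add: Ym_def)
      qed (use M in \<open>auto simp: Ym_def\<close>)
      then have "Determinant.det (map_mat \<sigma> Ym) = Determinant.det Ym * Determinant.det (map_mat \<iota> ?M)"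
        using det_mult[OF Ym, of "map_mat \<iota> ?M"] M by simp
      then have "\<sigma> ?d = ?d * \<iota> (Determinant.det ?M)" by (simp add: \<sigma>.hom_det \<iota>.hom_det)
      then have "\<iota> (Determinant.det ?M) = \<sigma> ?d / ?d" using det_Ym by (simp add: nonzero_eq_divide_eq mult.commute)
      then show ?thesis using 2 by (simp add: \<iota>.hom_inverse \<sigma>.hom_inverse divide_inverse)
    qed
    then show ?thesis unfolding representable_def by blast
  qed
next
  case (add f g)
  then obtain ps qs where "\<forall>\<sigma>\<in>G. \<iota> (f \<sigma>) = (\<Sum>(e, x)\<leftarrow>ps. e * \<sigma> x)" "\<forall>\<sigma>\<in>G. \<iota> (g \<sigma>) = (\<Sum>(e, x)\<leftarrow>qs. e * \<sigma> x)"
    unfolding representable_def by blast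
  then have "\<forall>\<sigma>\<in>G. \<iota> (f \<sigma> + g \<sigma>) = (\<Sum>(e, x)\<leftarrow>ps @ qs. e * \<sigma> x)" by (simp add: \<iota>.hom_add)
  then show ?case unfolding representable_def by blast
next
  case (mult f g)
  then obtain ps qs where *: "\<forall>\<sigma>\<in>G. \<iota> (f \<sigma>) = (\<Sum>(e, x)\<leftarrow>ps. e * \<sigma> x)" "\<forall>\<sigma>\<in>G. \<iota> (g \<sigma>) = (\<Sum>(e, x)\<leftarrow>qs. e * \<sigma> x)"
    unfolding representable_def by blast
  let ?rs = "concat (map (\<lambda>(e, x). map (\<lambda>(e', x'). (e * e', x * x')) qs) ps)"
  have "\<iota> (f \<sigma> * g \<sigma>) = (\<Sum>(e, x)\<leftarrow>?rs. e * \<sigma> x)" if \<sigma>: "\<sigma> \<in> G" for \<sigma>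
  proof -
    interpret \<sigma>: field_hom \<sigma> using galois_hom(1)[OF \<sigma>] .
    have 1: "sum_list (map ((\<lambda>(e, x). e * \<sigma> x) \<circ> (\<lambda>(e', x'). (e * e', x * x'))) qs)
        = e * \<sigma> x * (\<Sum>(e, x)\<leftarrow>qs. e * \<sigma> x)" for e x
      by (induct qs) (auto simp: \<sigma>.hom_mult algebra_simps)
    have "(\<Sum>(e, x)\<leftarrow>?rs. e * \<sigma> x) = (\<Sum>(e, x)\<leftarrow>ps. e * \<sigma> x) * (\<Sum>(e, x)\<leftarrow>qs. e * \<sigma> x)"
      by (induct ps) (auto simp: 1 distrib_right)
    then show ?thesis using * \<sigma> by (simp add: \<iota>.hom_mult)
  qed
  then show ?case unfolding representable_def by blast
qed

end

section \<open>Triviality of the torsor\<close>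

text \<open>A Dedekind-Artin argument. Normalise one coefficient to 1 and subtract the relation for
  \<sigma> from that for \<sigma> after \<tau>: the result is shorter, so every coefficient is fixed
  by G and lies in K. The relation at the identity then contradicts independence of the e y.\<close>

lemma semilinear_independence:
  fixes e s :: "'i \<Rightarrow> 'e::field"
  assumes hom: "\<And>\<sigma>. \<sigma> \<in> G \<Longrightarrow> field_hom \<sigma>" and comp: "\<And>\<sigma> \<tau>. \<sigma> \<in> G \<Longrightarrow> \<tau> \<in> G \<Longrightarrow> (\<lambda>x. \<sigma> (\<tau> x)) \<in> G"
    and id: "(\<lambda>x. x) \<in> G" and fixed: "\<And>x. (\<And>\<sigma>. \<sigma> \<in> G \<Longrightarrow> \<sigma> x = x) \<Longrightarrow> x \<in> K" and K: "0 \<in> K" "1 \<in> K"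
  shows "finite J \<Longrightarrow> lin_indep K J e \<Longrightarrow> (\<And>\<sigma>. \<sigma> \<in> G \<Longrightarrow> (\<Sum>y\<in>J. e y * \<sigma> (s y)) = 0) \<Longrightarrow> k \<in> J \<Longrightarrow> s k = 0"
proof (induct "card J" arbitrary: J s k)
  case 0
  then show ?case by simp
next
  case (Suc n)
  show ?case
  proof (rule ccontr)
    assume sk: "s k \<noteq> 0"
    define t where "t y = s y / s k" for y
    have tk: "t k = 1" using sk by (simp add: t_def)
    have t: "(\<Sum>y\<in>J. e y * \<sigma> (t y)) = 0" if \<sigma>: "\<sigma> \<in> G" for \<sigma>
    proof -
      interpret \<sigma>: field_hom \<sigma> by (rule hom[OF \<sigma>])
      have "(\<Sum>y\<in>J. e y * \<sigma> (t y)) = (\<Sum>y\<in>J. e y * \<sigma> (s y)) / \<sigma> (s k)"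
        by (simp add: t_def \<sigma>.hom_div sum_divide_distrib)
      then show ?thesis using Suc.prems(3)[OF \<sigma>] by simp
    qed
    have fix1: "\<tau> (t y) - t y = 0" if \<tau>: "\<tau> \<in> G" and y: "y \<in> J" for \<tau> y
    proof (cases "y = k")
      case True
      interpret \<tau>: field_hom \<tau> by (rule hom[OF \<tau>])
      show ?thesis using True tk by simp
    next
      case False
      have "(\<Sum>y\<in>J - {k}. e y * \<sigma> (\<tau> (t y) - t y)) = 0" if \<sigma>: "\<sigma> \<in> G" for \<sigma>
      proof -
        interpret \<sigma>: field_hom \<sigma> by (rule hom[OF \<sigma>])
        interpret \<tau>: field_hom \<tau> by (rule hom[OF \<tau>])
        have "0 = (\<Sum>y\<in>J. e y * \<sigma> (\<tau> (t y))) - (\<Sum>y\<in>J. e y * \<sigma> (t y))"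
          using t[OF comp[OF \<sigma> \<tau>]] t[OF \<sigma>] by simp
        also have "\<dots> = (\<Sum>y\<in>J. e y * \<sigma> (\<tau> (t y) - t y))"
          by (simp add: \<sigma>.hom_minus right_diff_distrib sum_subtractf)
        also have "\<dots> = (\<Sum>y\<in>J - {k}. e y * \<sigma> (\<tau> (t y) - t y))"
          using Suc.prems(1,4) tk by (subst sum.remove[of J k]) auto
        finally show ?thesis by simp
      qed
      then show ?thesis
        using Suc.hyps(1)[of "J - {k}" "\<lambda>y. \<tau> (t y) - t y" y] Suc.hyps(2) Suc.prems(1,4) y False
          lin_indep_subset[OF Suc.prems(2,1) _ K(1), of "J - {k}"] by auto
    qed
    have tK: "t y \<in> K" if "y \<in> J" for y
      using fix1[OF _ that] by (intro fixed) simp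
    have "(\<Sum>y\<in>J. t y * e y) = 0" using t[OF id] by (simp add: mult.commute)
    then have "t k = 0" using lin_indepD[of K J e t k] Suc.prems(2,4) tK by blast
    then show False using tk by simp
  qed
qed

section \<open>Spanning rows, and matrices under homomorphisms and derivations\<close>

lemma basis_of_spanning_set:
  fixes S :: "('a::field, 'n::finite) Finite_Cartesian_Product.vec set"
  assumes "vec.span S = UNIV"
  obtains f :: "'n \<Rightarrow> ('a, 'n) Finite_Cartesian_Product.vec" where "range f \<subseteq> S" "vec.span (range f) = UNIV"
proof -
  obtain B where B: "B \<subseteq> S" "vec.independent B" "S \<subseteq> vec.span B"
    using vec.maximal_independent_subset[of S] by metis
  have span: "vec.span B = UNIV"
    using vec.span_mono[OF B(3)] assms by (simp add: vec.span_span top.extremum_uniqueI)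
  have "card B = vec.dim (UNIV :: ('a, 'n) Finite_Cartesian_Product.vec set)"
    using vec.basis_card_eq_dim[of B UNIV] B span by simp
  then have "card B = CARD('n)" by (simp add: vec.dim_UNIV card_cart_basis vec.dimension_def)
  moreover have "finite B" by (rule vec.finiteI_independent[OF B(2)])
  ultimately obtain f :: "'n \<Rightarrow> _" where "bij_betw f UNIV B"
    using finite_same_card_bij[of "UNIV :: 'n set" B] by auto
  then have "range f = B" by (simp add: bij_betw_def)
  then show ?thesis using that B(1) span by metis
qed

lemma span_axes_UNIV:
  fixes S :: "('a::field, 'n::finite) Finite_Cartesian_Product.vec set"
  assumes "\<And>i. axis i 1 \<in> vec.span S"
  shows "vec.span S = UNIV"
proof -
  have "(cart_basis :: ('a, 'n) Finite_Cartesian_Product.vec set) \<subseteq> vec.span S"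
    using assms by (auto simp: cart_basis_def)
  then have "vec.span cart_basis \<subseteq> vec.span S" by (rule vec.span_minimal[OF _ vec.subspace_span])
  then show ?thesis by (simp add: span_cart_basis top.extremum_uniqueI)
qed

lemma invertible_of_spanning_rows:
  fixes X :: "('a::field, 'n::finite) sqmat"
  assumes "vec.span (range (\<lambda>i. X $ i)) = UNIV"
  shows "invertible X"
proof -
  have "Finite_Cartesian_Product.rows X = range (\<lambda>i. X $ i)"
    by (auto simp: Finite_Cartesian_Product.rows_def Finite_Cartesian_Product.row_def)
  then show ?thesis using assms matrix_left_invertible_span_rows_gen[of X] by (simp add: invertible_left_inverse)
qed

lemma matrix_mult_entry: "(A ** B) $ i $ j = (\<Sum>p\<in>UNIV. A $ i $ p * B $ p $ j)"
  by (simp add: matrix_matrix_mult_def)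

lemma map_matrix_entry [simp]: "map_matrix f A $ i $ j = f (A $ i $ j)"
  by (simp add: map_matrix_def)

lemma map_matrix_mult:
  assumes "field_hom f"
  shows "map_matrix f (A ** B) = map_matrix f A ** map_matrix f B"
proof -
  interpret field_hom f by fact
  show ?thesis by (simp add: Finite_Cartesian_Product.vec_eq_iff matrix_mult_entry hom_sum hom_mult)
qed

lemma map_matrix_derivation_mult:
  assumes "derivation d"
  shows "map_matrix d (A ** B) = map_matrix d A ** B + A ** map_matrix d B"
  by (simp add: Finite_Cartesian_Product.vec_eq_iff matrix_mult_entry derivation_sum[OF assms] derivation_mult[OF assms] sum.distrib)

lemma mat_one_entry: "(Finite_Cartesian_Product.mat 1 :: ('a::{zero,one}, 'n::finite) sqmat) $ i $ j = (if i = j then 1 else 0)"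
  by (simp add: Finite_Cartesian_Product.mat_def)

lemma map_matrix_mat_one:
  assumes "field_hom f"
  shows "map_matrix f (Finite_Cartesian_Product.mat 1) = Finite_Cartesian_Product.mat 1"
proof -
  interpret field_hom f by fact
  show ?thesis by (simp add: Finite_Cartesian_Product.vec_eq_iff mat_one_entry)
qed

lemma peval_hom:
  assumes h: "comm_ring_hom h"
  shows "h (peval \<phi> x p) = peval (\<lambda>a. h (\<phi> a)) (\<lambda>v. h (x v)) p"
proof -
  interpret comm_ring_hom h by fact
  show ?thesis by (simp add: peval_def mono_eval_def hom_sum hom_mult hom_prod hom_power)
qed

lemma field_hom_comm_ring_hom: "field_hom h \<Longrightarrow> comm_ring_hom h"
  by (simp add: field_hom_def idom_hom_def)

text \<open>Induction on the degree: partial derivatives of a relation are relations of lower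
  degree, hence zero. So the relation is a constant, and \<phi> is injective on constants.\<close>

lemma peval_inj_of_pdiff_closed:
  fixes \<phi> :: "'a::field \<Rightarrow> 'e::field"
  assumes \<phi>: "field_hom \<phi>" and char: "CHAR('a) = 0"
    and closed: "\<And>p v. peval \<phi> x p = 0 \<Longrightarrow> peval \<phi> x (pdiff v p) = 0" and p: "peval \<phi> x p = 0"
  shows "p = 0"
proof -
  interpret field_hom \<phi> by fact
  have const: "q = 0" if q: "\<And>v. pdiff v q = 0" "peval \<phi> x q = 0" for q
  proof -
    have e: "q = pconst (Poly_Mapping.lookup q 0)" by (rule pdiff_all_zero_imp_const[OF char q(1)])
    have "peval \<phi> x q = \<phi> (Poly_Mapping.lookup q 0)" by (subst e) (rule peval_pconst[of \<phi>, OF hom_zero hom_add])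
    then have "Poly_Mapping.lookup q 0 = 0" using q(2) by simp
    then show ?thesis using e by (simp add: pconst_def)
  qed
  have "degree_le n q \<Longrightarrow> peval \<phi> x q = 0 \<Longrightarrow> q = 0" for n q
  proof (induct n arbitrary: q)
    case 0
    have "pdiff v q = 0" for v by (subst degree_le_0_imp_const[OF 0(1)]) (rule pdiff(2))
    then show ?case using const 0 by blast
  next
    case (Suc n)
    have "pdiff v q = 0" for v using Suc(1)[OF degree_le_pdiff[OF Suc(2)] closed[OF Suc(3)]] .
    then show ?case using const Suc by blast
  qed
  then show ?thesis using degree_le_exists p by blast
qed

text \<open>The tangent direction of the one-parameter group \<open>1 + t E\<^sub>a\<^sub>b\<close> at the generic matrix: \<open>X + t X E\<^sub>a\<^sub>b\<close>
  evaluates a polynomial \<open>P\<close> to a polynomial in \<open>t\<close> whose linear coefficient involves the partial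
  derivatives of \<open>P\<close>.\<close>

lemma pderiv_column_operation:
  fixes X :: "('e::field, 'n::finite) sqmat" and \<iota> :: "'k::field \<Rightarrow> 'e" and a b :: 'n
  assumes \<iota>: "field_hom \<iota>"
  defines "ev \<equiv> peval \<iota> (\<lambda>(i, j). X $ i $ j)"
  defines "PE \<equiv> peval (\<lambda>c. [:\<iota> c:]) (\<lambda>(i, j). [:X $ i $ j, if j = b then X $ i $ a else 0:])"
  shows "poly (PE p) 0 = ev p" "poly (pderiv (PE p)) 0 = (\<Sum>i\<in>UNIV. X $ i $ a * ev (pdiff (i, b) p))"
proof -
  interpret field_hom \<iota> by fact
  have c: "comm_ring_hom (\<lambda>c. [:\<iota> c:])" by unfold_locales (auto simp: hom_add hom_mult one_pCons)
  interpret c: comm_ring_hom "\<lambda>c. [:\<iota> c:]" by (rule c)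
  interpret PE: comm_ring_hom PE unfolding PE_def by (rule comm_ring_hom_peval[OF c])
  interpret ev: comm_ring_hom ev unfolding ev_def by (rule comm_ring_hom_peval[OF field_hom_comm_ring_hom[OF \<iota>]])
  have PEc: "PE (pconst k) = [:\<iota> k:]" for k unfolding PE_def by (rule peval_pconst[of "\<lambda>c. [:\<iota> c:]", OF c.hom_zero c.hom_add])
  have PEv: "PE (pvar (i, j)) = [:X $ i $ j, if j = b then X $ i $ a else 0:]" for i j
    unfolding PE_def by (simp add: peval_pvar[OF c])
  have evc: "ev (pconst k) = \<iota> k" for k unfolding ev_def by (rule peval_pconst[of \<iota>, OF hom_zero hom_add])
  have evv: "ev (pvar (i, j)) = X $ i $ j" for i j unfolding ev_def by (simp add: peval_pvar[OF field_hom_comm_ring_hom[OF \<iota>]])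
  show *: "poly (PE p) 0 = ev p" for p
  proof (induct p rule: mpoly_induct)
    case (var v p)
    then show ?case by (cases v) (simp only: PE.hom_mult ev.hom_mult poly_mult PEv evv, simp)
  qed (simp_all add: PEc evc PE.hom_add ev.hom_add)
  show "poly (pderiv (PE p)) 0 = (\<Sum>i\<in>UNIV. X $ i $ a * ev (pdiff (i, b) p))"
  proof (induct p rule: mpoly_induct)
    case (const c)
    show ?case by (simp add: PEc pdiff(2))
  next
    case (add p q)
    then show ?case
      by (simp add: PE.hom_add pderiv_add derivation_add[OF pdiff(1)] ev.hom_add distrib_left sum.distrib)
  next
    case (var v p)
    obtain i j where v: "v = (i, j)" by (cases v)
    have "(\<Sum>i'\<in>UNIV. X $ i' $ a * ev (pdiff (i', b) (pvar (i, j) * p)))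
      = (\<Sum>i'\<in>UNIV. (if i' = i then (if j = b then X $ i' $ a else 0) * ev p else 0) + X $ i $ j * (X $ i' $ a * ev (pdiff (i', b) p)))"
      by (intro sum.cong refl)
        (auto simp: derivation_mult[OF pdiff(1)] pdiff(3) ev.hom_add ev.hom_mult evv algebra_simps)
    also have "\<dots> = (if j = b then X $ i $ a else 0) * ev p + X $ i $ j * (\<Sum>i'\<in>UNIV. X $ i' $ a * ev (pdiff (i', b) p))"
      by (simp add: sum.distrib sum_distrib_left)
    also have "\<dots> = poly (pderiv (PE (pvar (i, j) * p))) 0"
      unfolding PE.hom_mult PEv pderiv_mult by (simp add: pderiv_pCons * var)
    finally show ?case unfolding v by simp
  qed
qed

lemma matrix_derivation:
  fixes D :: "'k::field \<Rightarrow> 'k" and A :: "('k, 'n::{finite, linorder}) sqmat"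
  assumes D: "derivation D"
  shows "derivation (matrix_derivation D A)"
    and "matrix_derivation D A (ratconst c) = ratconst (D c)"
    and "matrix_derivation D A (ratvar (i, j)) = (\<Sum>l\<in>UNIV. ratconst (A $ i $ l) * ratvar (l, j))"
  unfolding matrix_derivation_def by (simp_all add: extend_derivation[OF D])

text \<open>The assumption comes from the case a = b, where the matrix is diagonal with the entry 1
  + c.\<close>

lemma transvection_invertible:
  fixes c :: "'a::field" and a b :: "'n::finite"
  assumes "1 + c \<noteq> 0"
  shows "Determinants.det (\<chi> p q. (if p = q then 1 else 0) + (if p = a \<and> q = b then c else 0) :: ('a, 'n) sqmat) \<noteq> 0"
proof -
  let ?g = "\<chi> p q. (if p = q then 1 else 0) + (if p = a \<and> q = b then c else 0) :: ('a, 'n) sqmat"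
  have gx: "(?g *v x) $ p = x $ p + (if p = a then c * x $ b else 0)" for x p
  proof -
    have "(?g *v x) $ p = (\<Sum>q\<in>UNIV. (if q = p then x $ q else 0) + (if q = b then (if p = a then c * x $ q else 0) else 0))"
      unfolding matrix_vector_mult_def by (simp, intro sum.cong) (auto simp: algebra_simps)
    then show ?thesis by (simp add: sum.distrib)
  qed
  have "x = 0" if "?g *v x = 0" for x
  proof -
    have *: "x $ p + (if p = a then c * x $ b else 0) = 0" for p using gx[of x p] that by simp
    have "x $ b = 0"
    proof (cases "a = b")
      case True
      then have "(1 + c) * x $ b = 0" using *[of b] by (simp add: algebra_simps)
      then show ?thesis using assms by simp
    qed (use *[of b] in auto)
    then have "x $ p = 0" for p using *[of p] by (simp split: if_splits)
    then show ?thesis by (simp add: Finite_Cartesian_Product.vec_eq_iff)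
  qed
  then have "invertible ?g" unfolding invertible_left_inverse matrix_left_invertible_ker by blast
  then show ?thesis by (simp add: invertible_det_nz)
qed

section \<open>Hilbert 90 and the specialisation\<close>

context fundamental_solutions
begin

lemma G_comp: "\<sigma> \<in> G \<Longrightarrow> \<tau> \<in> G \<Longrightarrow> (\<lambda>x. \<sigma> (\<tau> x)) \<in> G"
proof -
  assume *: "\<sigma> \<in> G" "\<tau> \<in> G"
  interpret \<sigma>: field_hom \<sigma> by (rule galois_hom(1)[OF *(1)])
  interpret \<tau>: field_hom \<tau> by (rule galois_hom(1)[OF *(2)])
  have "field_hom (\<lambda>x. \<sigma> (\<tau> x))"
    by unfold_locales (simp_all add: \<sigma>.hom_add \<tau>.hom_add \<sigma>.hom_mult \<tau>.hom_mult)
  moreover have "bij (\<sigma> \<circ> \<tau>)" using * by (intro bij_comp) (auto simp: galois_group_def)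
  ultimately show ?thesis using galois_hom(2,3)[OF *(1)] galois_hom(2,3)[OF *(2)]
    by (simp add: galois_group_def o_def)
qed

lemma G_id: "(\<lambda>x. x) \<in> G"
proof -
  have "field_hom (\<lambda>x::'e. x)" by unfold_locales auto
  then show ?thesis by (simp add: galois_group_def bij_betw_id[unfolded id_def])
qed

lemma G_fixed: "(\<And>\<sigma>. \<sigma> \<in> G \<Longrightarrow> \<sigma> x = x) \<Longrightarrow> x \<in> range \<iota>"
  using galois_moves by blast

lemma G_indep:
  fixes J :: "'i set" and e t :: "'i \<Rightarrow> 'e"
  assumes "finite J" "lin_indep (range \<iota>) J e" "\<And>\<sigma>. \<sigma> \<in> G \<Longrightarrow> (\<Sum>y\<in>J. e y * \<sigma> (t y)) = 0" "k \<in> J"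
  shows "t k = 0"
proof (rule semilinear_independence[where G = G and K = "range \<iota>" and e = e and J = J])
  show "0 \<in> range \<iota>" "1 \<in> range \<iota>" by (rule is_subfieldD[OF is_subfield_range[OF \<iota>]])+
qed (use assms galois_hom(1) G_comp G_id G_fixed in blast)+

text \<open>\<open>\<gamma>\<close> is the inverse of the isomorphism from \<open>GL\<^sub>n(C)\<close>.  Its entries are representable, and
  independence of the \<open>e\<^sub>y\<close> in \<open>\<gamma>(\<sigma>) = \<Sum> e\<^sub>y \<sigma>(R\<^sub>y)\<close> makes each matrix \<open>R\<^sub>y\<close> equivariant; this
  is Hilbert 90 for \<open>GL\<^sub>n\<close>.\<close>

lemma equivariant_matrix_exists:
  fixes \<gamma> :: "('e \<Rightarrow> 'e) \<Rightarrow> ('k, 'n::finite) sqmat"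
  assumes rep: "\<And>i j. representable (\<lambda>\<sigma>. \<gamma> \<sigma> $ i $ j)"
    and comp: "\<And>\<sigma> \<tau>. \<sigma> \<in> G \<Longrightarrow> \<tau> \<in> G \<Longrightarrow> \<gamma> (\<lambda>x. \<sigma> (\<tau> x)) = \<gamma> \<sigma> ** \<gamma> \<tau>"
    and one: "\<gamma> (\<lambda>x. x) = Finite_Cartesian_Product.mat 1"
  obtains X :: "('e, 'n) sqmat" where "invertible X" "\<And>\<sigma>. \<sigma> \<in> G \<Longrightarrow> map_matrix \<sigma> X = X ** map_matrix \<iota> (\<gamma> \<sigma>)"
proof -
  note K = is_subfieldD[OF is_subfield_range[OF \<iota>]]
  have "\<forall>i j. \<exists>ps. \<forall>\<sigma>\<in>G. \<iota> (\<gamma> \<sigma> $ i $ j) = (\<Sum>(e, x)\<leftarrow>ps. e * \<sigma> x)" using rep unfolding representable_def by blast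
  then obtain ps where ps: "\<And>i j \<sigma>. \<sigma> \<in> G \<Longrightarrow> \<iota> (\<gamma> \<sigma> $ i $ j) = (\<Sum>(e, x)\<leftarrow>ps i j. e * \<sigma> x)" by metis
  \<comment> \<open>The sums for all matrix entries are merged into one family, so that a single
    list of left factors e serves every entry; \<rho> puts each right factor into its own entry and
    0 elsewhere.\<close>
  define I where "I = (SIGMA ij:UNIV. {..<length (ps (fst ij) (snd ij))})"
  define e where "e = (\<lambda>(ij, k). fst (ps (fst ij) (snd ij) ! k))"
  define \<rho> where "\<rho> = (\<lambda>((i', j'), k) i j. if i = i' \<and> j = j' then snd (ps i' j' ! k) else 0)"
  have finI: "finite I" unfolding I_def by (intro finite_SigmaI) auto
  have sumI: "\<iota> (\<gamma> \<sigma> $ i $ j) = (\<Sum>x\<in>I. e x * \<sigma> (\<rho> x i j))" if \<sigma>: "\<sigma> \<in> G" for \<sigma> i j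
  proof -
    interpret \<sigma>: field_hom \<sigma> by (rule galois_hom(1)[OF \<sigma>])
    have "(\<Sum>x\<in>I. e x * \<sigma> (\<rho> x i j)) = (\<Sum>ij\<in>UNIV. \<Sum>k<length (ps (fst ij) (snd ij)). e (ij, k) * \<sigma> (\<rho> (ij, k) i j))"
      unfolding I_def by (subst sum.Sigma) auto
    also have "\<dots> = (\<Sum>ij\<in>UNIV. if ij = (i, j) then (\<Sum>k<length (ps i j). fst (ps i j ! k) * \<sigma> (snd (ps i j ! k))) else 0)"
    proof (intro sum.cong refl)
      fix ij
      show "(\<Sum>k<length (ps (fst ij) (snd ij)). e (ij, k) * \<sigma> (\<rho> (ij, k) i j))
        = (if ij = (i, j) then (\<Sum>k<length (ps i j). fst (ps i j ! k) * \<sigma> (snd (ps i j ! k))) else 0)"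
        by (cases ij; cases "ij = (i, j)") (auto simp: e_def \<rho>_def intro!: sum.neutral)
    qed
    also have "\<dots> = (\<Sum>k<length (ps i j). fst (ps i j ! k) * \<sigma> (snd (ps i j ! k)))" by simp
    also have "\<dots> = \<iota> (\<gamma> \<sigma> $ i $ j)"
      unfolding ps[OF \<sigma>] by (simp add: sum_list_sum_nth atLeast0LessThan case_prod_unfold)
    finally show ?thesis by simp
  qed
  obtain J where J: "J \<subseteq> I" "lin_indep (range \<iota>) J e" "\<forall>x\<in>I. \<exists>c. (\<forall>y\<in>J. c y \<in> range \<iota>) \<and> e x = (\<Sum>y\<in>J. c y * e y)"
    using lin_indep_reduce[OF is_subfield_range[OF \<iota>] finI, of e] by blast
  have finJ: "finite J" using J(1) finI finite_subset by blast
  obtain c where c: "\<And>x y. x \<in> I \<Longrightarrow> y \<in> J \<Longrightarrow> c x y \<in> range \<iota>" "\<And>x. x \<in> I \<Longrightarrow> e x = (\<Sum>y\<in>J. c x y * e y)"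
    using J(3) by metis
  define R where "R y i j = (\<Sum>x\<in>I. c x y * \<rho> x i j)" for y i j
  have R: "\<iota> (\<gamma> \<sigma> $ i $ j) = (\<Sum>y\<in>J. e y * \<sigma> (R y i j))" if \<sigma>: "\<sigma> \<in> G" for \<sigma> i j
  proof -
    interpret \<sigma>: field_hom \<sigma> by (rule galois_hom(1)[OF \<sigma>])
    have \<sigma>c: "\<sigma> (c x y) = c x y" if "x \<in> I" "y \<in> J" for x y using c(1)[OF that] galois_hom(2)[OF \<sigma>] by auto
    have "\<iota> (\<gamma> \<sigma> $ i $ j) = (\<Sum>x\<in>I. \<Sum>y\<in>J. e y * \<sigma> (c x y * \<rho> x i j))"
      unfolding sumI[OF \<sigma>]
      by (intro sum.cong refl, subst c(2), assumption, simp add: \<sigma>c \<sigma>.hom_mult sum_distrib_left sum_distrib_right mult_ac)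
    also have "\<dots> = (\<Sum>y\<in>J. e y * \<sigma> (R y i j))"
      unfolding R_def by (subst sum.swap) (simp add: \<sigma>.hom_sum sum_distrib_left)
    finally show ?thesis .
  qed
  \<comment> \<open>Expanding both sides of \<gamma>(\<sigma> \<tau>) = \<gamma>(\<sigma>)
    \<gamma>(\<tau>) in the independent e y and letting \<sigma> vary, \<open>G_indep\<close>
    compares the coefficients.\<close>
  have equi: "\<tau> (R y i j) = (\<Sum>q\<in>UNIV. R y i q * \<iota> (\<gamma> \<tau> $ q $ j))" if \<tau>: "\<tau> \<in> G" and y: "y \<in> J" for \<tau> y i j
  proof -
    have "(\<Sum>y\<in>J. e y * \<sigma> (\<tau> (R y i j) - (\<Sum>q\<in>UNIV. R y i q * \<iota> (\<gamma> \<tau> $ q $ j)))) = 0" if \<sigma>: "\<sigma> \<in> G" for \<sigma>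
    proof -
      interpret \<sigma>: field_hom \<sigma> by (rule galois_hom(1)[OF \<sigma>])
      have "(\<Sum>y\<in>J. e y * \<sigma> (\<tau> (R y i j))) = \<iota> (\<gamma> (\<lambda>x. \<sigma> (\<tau> x)) $ i $ j)"
        using R[OF G_comp[OF \<sigma> \<tau>]] by simp
      also have "\<dots> = (\<Sum>q\<in>UNIV. \<iota> (\<gamma> \<sigma> $ i $ q) * \<iota> (\<gamma> \<tau> $ q $ j))"
        by (simp add: comp[OF \<sigma> \<tau>] matrix_mult_entry \<iota>.hom_sum \<iota>.hom_mult)
      also have "\<dots> = (\<Sum>q\<in>UNIV. \<Sum>y\<in>J. e y * \<sigma> (R y i q * \<iota> (\<gamma> \<tau> $ q $ j)))"
        unfolding R[OF \<sigma>] by (simp add: sum_distrib_right \<sigma>.hom_mult galois_hom(2)[OF \<sigma>] mult.assoc)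
      also have "\<dots> = (\<Sum>y\<in>J. e y * \<sigma> (\<Sum>q\<in>UNIV. R y i q * \<iota> (\<gamma> \<tau> $ q $ j)))"
        by (subst sum.swap) (simp add: \<sigma>.hom_sum sum_distrib_left)
      finally show ?thesis by (simp add: \<sigma>.hom_minus right_diff_distrib sum_subtractf)
    qed
    then have "\<tau> (R y i j) - (\<Sum>q\<in>UNIV. R y i q * \<iota> (\<gamma> \<tau> $ q $ j)) = 0"
      by (rule G_indep[OF finJ J(2) _ y, where t = "\<lambda>y. \<tau> (R y i j) - (\<Sum>q\<in>UNIV. R y i q * \<iota> (\<gamma> \<tau> $ q $ j))"])
    then show ?thesis by simp
  qed
  \<comment> \<open>At the identity of G the expansion reads 1 = \<Sum> e_y R_y, so the rows of all
    the R_y together span the whole space.\<close>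
  define S where "S = {\<chi> j. R y i j | y i. y \<in> J}"
  have "axis i 1 \<in> vec.span S" for i
  proof -
    have "axis i 1 $ j = (\<Sum>y\<in>J. e y *s (\<chi> j. R y i j)) $ j" for j
    proof -
      have "axis i 1 $ j = \<iota> (\<gamma> (\<lambda>x. x) $ i $ j)" by (simp add: axis_def one mat_one_entry)
      then show ?thesis unfolding R[OF G_id] by simp
    qed
    then have "axis i 1 = (\<Sum>y\<in>J. e y *s (\<chi> j. R y i j))" by (simp add: Finite_Cartesian_Product.vec_eq_iff)
    also have "\<dots> \<in> vec.span S"
      by (intro vec.span_sum vec.span_scale vec.span_base) (auto simp: S_def)
    finally show ?thesis .
  qed
  then have "vec.span S = UNIV" by (rule span_axes_UNIV)
  then obtain f :: "'n \<Rightarrow> _" where f: "range f \<subseteq> S" "vec.span (range f) = UNIV" by (rule basis_of_spanning_set)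
  \<comment> \<open>Equivariance is a property of each row separately, so rows taken from different
    R_y may be combined into one invertible matrix.\<close>
  define X where "X = (\<chi> i. f i)"
  have "invertible X" by (rule invertible_of_spanning_rows) (simp add: X_def f)
  moreover have "map_matrix \<sigma> X = X ** map_matrix \<iota> (\<gamma> \<sigma>)" if \<sigma>: "\<sigma> \<in> G" for \<sigma>
  proof -
    have "\<sigma> (X $ i $ j) = (\<Sum>q\<in>UNIV. X $ i $ q * \<iota> (\<gamma> \<sigma> $ q $ j))" for i j
    proof -
      have "f i \<in> S" using f(1) by blast
      then obtain y i' where y: "y \<in> J" "f i = (\<chi> j. R y i' j)" unfolding S_def by blast
      then show ?thesis using equi[OF \<sigma> y(1)] by (simp add: X_def)
    qed
    then show ?thesis by (simp add: Finite_Cartesian_Product.vec_eq_iff matrix_mult_entry)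
  qed
  ultimately show ?thesis by (rule that)
qed

lemma infinite_constants_K: "infinite (constants DK)"
  by (rule infinite_subfield_char_0[OF is_subfield_constants[OF DK] charK])

theorem obtained_by_specialization_of_iso:
  fixes \<phi> :: "('k, 'n::{finite, linorder}) sqmat \<Rightarrow> 'e \<Rightarrow> 'e"
  assumes bij: "bij_betw \<phi> (GL (constants DK)) G"
    and mult: "\<And>g h. g \<in> GL (constants DK) \<Longrightarrow> h \<in> GL (constants DK) \<Longrightarrow> \<phi> (g ** h) = \<phi> g \<circ> \<phi> h"
    and regular: "\<And>f. regular_on (GL (constants DK)) (constants DK) GL_coordinates (f \<circ> \<phi>) \<Longrightarrow>
      regular_on G (constants DK) (galois_coordinates DK \<iota> m y) f"
  shows "\<exists>A :: ('k, 'n) sqmat. obtained_by_specialization DK DE \<iota> A"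
proof -
  let ?H = "GL (constants DK) :: ('k, 'n) sqmat set"
  define \<gamma> where "\<gamma> = inv_into ?H \<phi>"
  have inj: "inj_on \<phi> ?H" and im: "\<phi> ` ?H = G" using bij by (auto simp: bij_betw_def)
  have \<gamma>H: "\<gamma> \<sigma> \<in> ?H" and \<phi>\<gamma>: "\<phi> (\<gamma> \<sigma>) = \<sigma>" if "\<sigma> \<in> G" for \<sigma>
    using that im inv_into_into[of \<sigma> \<phi> ?H] f_inv_into_f[of \<sigma> \<phi> ?H] by (auto simp: \<gamma>_def)
  have \<gamma>\<phi>: "\<gamma> (\<phi> g) = g" if "g \<in> ?H" for g using inv_into_f_f[OF inj that] by (simp add: \<gamma>_def)
  have H_inv: "invertible g" if "g \<in> ?H" for g using that by (simp add: GL_def invertible_det_nz)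
  have H_mult: "g ** h \<in> ?H" if "g \<in> ?H" "h \<in> ?H" for g h
  proof -
    have "(g ** h) $ i $ j \<in> constants DK" for i j
      unfolding matrix_mult_entry
    proof (rule is_subfield_sum[OF is_subfield_constants[OF DK]])
      show "g $ i $ p * h $ p $ j \<in> constants DK" for p using that K_const(5) by (simp add: GL_def)
    qed
    then show ?thesis using that by (simp add: GL_def det_mul)
  qed
  have H_one: "Finite_Cartesian_Product.mat 1 \<in> ?H" using K_const(1,2) by (auto simp: GL_def mat_one_entry)
  \<comment> \<open>Composed with \<phi>, an entry of \<gamma> is a coordinate function of GL. Here
    the hypothesis \<open>regular\<close> is used: the entry is regular on G and hence
    representable.\<close>
  have rep: "representable (\<lambda>\<sigma>. \<gamma> \<sigma> $ i $ j)" for i j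
  proof -
    have "regular_on ?H (constants DK) GL_coordinates ((\<lambda>\<sigma>. \<gamma> \<sigma> $ i $ j) \<circ> \<phi>)"
      unfolding regular_on_def
    proof (rule bexI)
      show "(\<lambda>g. g $ i $ j) \<in> function_algebra (constants DK) GL_coordinates"
        by (rule function_algebra.gen) (auto simp: GL_coordinates_def)
      show "\<forall>x\<in>?H. ((\<lambda>\<sigma>. \<gamma> \<sigma> $ i $ j) \<circ> \<phi>) x = x $ i $ j" using \<gamma>\<phi> by simp
    qed
    from regular[OF this] obtain p where "p \<in> function_algebra (constants DK) (galois_coordinates DK \<iota> m y)"
      "\<forall>\<sigma>\<in>G. \<gamma> \<sigma> $ i $ j = p \<sigma>" unfolding regular_on_def by blast
    then show ?thesis using representable_regular[of p] unfolding representable_def by auto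
  qed
  have comp: "\<gamma> (\<lambda>x. \<sigma> (\<tau> x)) = \<gamma> \<sigma> ** \<gamma> \<tau>" if "\<sigma> \<in> G" "\<tau> \<in> G" for \<sigma> \<tau>
  proof -
    have "\<phi> (\<gamma> \<sigma> ** \<gamma> \<tau>) = (\<lambda>x. \<sigma> (\<tau> x))" using mult[OF \<gamma>H \<gamma>H, OF that] that by (simp add: \<phi>\<gamma> o_def)
    then show ?thesis using \<gamma>\<phi>[OF H_mult[OF \<gamma>H \<gamma>H, OF that]] by simp
  qed
  \<comment> \<open>The image of the identity is an invertible idempotent matrix.\<close>
  have one: "\<gamma> (\<lambda>x. x) = Finite_Cartesian_Product.mat 1"
  proof -
    have "\<gamma> (\<lambda>x. x) = \<gamma> (\<lambda>x. x) ** \<gamma> (\<lambda>x. x)" using comp[OF G_id G_id] by simp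
    moreover obtain B where "B ** \<gamma> (\<lambda>x. x) = Finite_Cartesian_Product.mat 1"
      using H_inv[OF \<gamma>H[OF G_id]] unfolding invertible_left_inverse by blast
    ultimately show ?thesis by (metis matrix_mul_assoc matrix_mul_lid)
  qed
  obtain X :: "('e, 'n) sqmat" where X: "invertible X" "\<And>\<sigma>. \<sigma> \<in> G \<Longrightarrow> map_matrix \<sigma> X = X ** map_matrix \<iota> (\<gamma> \<sigma>)"
    using equivariant_matrix_exists[of \<gamma>, OF rep comp one] by blast
  obtain Xi where Xi: "X ** Xi = Finite_Cartesian_Product.mat 1" "Xi ** X = Finite_Cartesian_Product.mat 1"
    using X(1) by (auto simp: invertible_def)
  define AE where "AE = map_matrix DE X ** Xi"
  have AEX: "map_matrix DE X = AE ** X"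
    unfolding AE_def by (simp add: matrix_mul_assoc[symmetric] Xi)
  have "map_matrix \<sigma> AE = AE" if \<sigma>: "\<sigma> \<in> G" for \<sigma>
  proof -
    let ?g = "map_matrix \<iota> (\<gamma> \<sigma>)"
    obtain B where "\<gamma> \<sigma> ** B = Finite_Cartesian_Product.mat 1"
      using H_inv[OF \<gamma>H[OF \<sigma>]] by (auto simp: invertible_def)
    then have gB: "?g ** map_matrix \<iota> B = Finite_Cartesian_Product.mat 1"
      by (metis map_matrix_mult[OF \<iota>] map_matrix_mat_one[OF \<iota>])
    have Dg: "map_matrix DE ?g = 0"
    proof -
      have "DE (\<iota> (\<gamma> \<sigma> $ i $ j)) = 0" for i j
      proof -
        have "\<gamma> \<sigma> $ i $ j \<in> constants DK" using \<gamma>H[OF \<sigma>] by (simp add: GL_def)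
        then have "\<iota> (\<gamma> \<sigma> $ i $ j) \<in> constants DE" using constants by blast
        then show ?thesis by (simp add: constants_def)
      qed
      then show ?thesis by (simp add: Finite_Cartesian_Product.vec_eq_iff)
    qed
    have "map_matrix \<sigma> (map_matrix DE X) = map_matrix DE (map_matrix \<sigma> X)"
      by (simp add: Finite_Cartesian_Product.vec_eq_iff galois_hom(3)[OF \<sigma>])
    also have "\<dots> = map_matrix DE X ** ?g"
      unfolding X(2)[OF \<sigma>] map_matrix_derivation_mult[OF DE] Dg by (simp add: Finite_Cartesian_Product.vec_eq_iff matrix_mult_entry)
    finally have "map_matrix \<sigma> AE ** (X ** ?g) = AE ** X ** ?g"
      unfolding AEX map_matrix_mult[OF galois_hom(1)[OF \<sigma>]] X(2)[OF \<sigma>] .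
    then have "map_matrix \<sigma> AE ** (X ** ?g) ** map_matrix \<iota> B ** Xi = AE ** X ** ?g ** map_matrix \<iota> B ** Xi" by simp
    then have "map_matrix \<sigma> AE ** (X ** (?g ** map_matrix \<iota> B) ** Xi) = AE ** (X ** (?g ** map_matrix \<iota> B) ** Xi)"
      by (simp only: matrix_mul_assoc)
    then show ?thesis by (simp add: gB Xi)
  qed
  then have "\<sigma> (AE $ i $ j) = AE $ i $ j" if "\<sigma> \<in> G" for \<sigma> i j
    using that by (metis map_matrix_entry)
  then have "AE $ i $ j \<in> range \<iota>" for i j by (rule G_fixed)
  then have "\<forall>i j. \<exists>k. AE $ i $ j = \<iota> k" by blast
  then obtain A' where A': "\<And>i j. AE $ i $ j = \<iota> (A' i j)" by metis
  define A0 :: "('k, 'n) sqmat" where "A0 = (\<chi> i j. A' i j)"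
  have DX: "DE (X $ i $ j) = (\<Sum>p\<in>UNIV. \<iota> (A0 $ i $ p) * X $ p $ j)" for i j
  proof -
    have "DE (X $ i $ j) = (AE ** X) $ i $ j" using AEX by (metis map_matrix_entry)
    then show ?thesis by (simp add: matrix_mult_entry A' A0_def)
  qed
  let ?x = "\<lambda>(i, j). X $ i $ j"
  have closed: "peval \<iota> ?x (pdiff v p) = 0" if p: "peval \<iota> ?x p = 0" for p v
  proof -
    obtain i0 b where v: "v = (i0, b)" by (cases v)
    have "(\<Sum>i\<in>UNIV. X $ i $ a * peval \<iota> ?x (pdiff (i, b) p)) = 0" for a
    proof -
      let ?PE = "peval (\<lambda>c. [:\<iota> c:]) (\<lambda>(i, j). [:X $ i $ j, if j = b then X $ i $ a else 0:]) p"
      \<comment> \<open>\<open>?PE\<close> is p evaluated at X (1 + t E_ab). For t = c a constant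
        other than -1 this matrix is \<sigma>(X) for some \<sigma> in G, and p vanishes there
        because it vanishes at X. These are infinitely many roots, so the coefficient of t vanishes
        as well.\<close>
      have root: "poly ?PE (\<iota> c) = 0" if c: "c \<in> constants DK" "1 + c \<noteq> 0" for c
      proof -
        let ?g = "\<chi> p q. (if p = q then 1 else 0) + (if p = a \<and> q = b then c else 0) :: ('k, 'n) sqmat"
        have g: "?g \<in> ?H" using transvection_invertible[OF c(2), of a b] K_const(1,2,3) c(1) by (simp add: GL_def)
        let ?\<sigma> = "\<phi> ?g"
        have \<sigma>: "?\<sigma> \<in> G" using g im by blast
        interpret \<sigma>: field_hom ?\<sigma> by (rule galois_hom(1)[OF \<sigma>])
        have \<sigma>X: "?\<sigma> (X $ i $ j) = X $ i $ j + \<iota> c * (if j = b then X $ i $ a else 0)" for i j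
        proof -
          have "?\<sigma> (X $ i $ j) = (X ** map_matrix \<iota> ?g) $ i $ j" unfolding X(2)[OF \<sigma>, unfolded \<gamma>\<phi>[OF g], symmetric] map_matrix_entry ..
          also have "\<dots> = (\<Sum>q\<in>UNIV. (if q = j then X $ i $ q else 0) + (if q = a then \<iota> c * (if j = b then X $ i $ q else 0) else 0))"
            unfolding matrix_mult_entry map_matrix_entry
          proof (rule sum.cong[OF refl])
            fix q
            show "X $ i $ q * \<iota> (?g $ q $ j) = (if q = j then X $ i $ q else 0) + (if q = a then \<iota> c * (if j = b then X $ i $ q else 0) else 0)"
              by (cases "q = j"; cases "q = a"; cases "j = b") (simp_all add: \<iota>.hom_add distrib_left mult.commute[of "X $ i $ _"])
          qed
          also have "\<dots> = X $ i $ j + \<iota> c * (if j = b then X $ i $ a else 0)" by (simp add: sum.distrib)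
          finally show ?thesis .
        qed
        have "comm_ring_hom (\<lambda>p. poly p (\<iota> c))" by unfold_locales auto
        from peval_hom[OF this, of "\<lambda>c. [:\<iota> c:]" "\<lambda>(i, j). [:X $ i $ j, if j = b then X $ i $ a else 0:]" p]
        have "poly ?PE (\<iota> c) = peval \<iota> (\<lambda>(i, j). ?\<sigma> (X $ i $ j)) p"
          by (simp add: \<sigma>X case_prod_unfold)
        also have "\<dots> = peval (\<lambda>k. ?\<sigma> (\<iota> k)) (\<lambda>v. ?\<sigma> (?x v)) p"
          by (simp add: galois_hom(2)[OF \<sigma>] case_prod_unfold)
        also have "\<dots> = ?\<sigma> (peval \<iota> ?x p)"
          by (rule peval_hom[OF field_hom_comm_ring_hom[OF galois_hom(1)[OF \<sigma>]], symmetric])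
        finally show ?thesis using p by simp
      qed
      have "infinite (\<iota> ` (constants DK - {-1}))"
        using infinite_constants_K finite_imageD[OF _ inj_on_subset[OF \<iota>.inj_f subset_UNIV]] by (metis infinite_remove)
      moreover have "\<iota> ` (constants DK - {-1}) \<subseteq> {t. poly ?PE t = 0}"
        using root by (auto simp: add_eq_0_iff)
      ultimately have "infinite {t. poly ?PE t = 0}" by (rule infinite_super[rotated])
      then have "?PE = 0" using poly_roots_finite by blast
      then show ?thesis using pderiv_column_operation(2)[OF \<iota>, of X b a p] by simp
    qed
    \<comment> \<open>The relations obtained for all a form a linear system with coefficient matrix
      the transpose of X; multiplying by X^-1 isolates the derivative with i = i0.\<close>
    then have "0 = (\<Sum>a\<in>UNIV. Xi $ a $ i0 * (\<Sum>i\<in>UNIV. X $ i $ a * peval \<iota> ?x (pdiff (i, b) p)))" by simp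
    also have "\<dots> = (\<Sum>i\<in>UNIV. (\<Sum>a\<in>UNIV. Xi $ a $ i0 * X $ i $ a) * peval \<iota> ?x (pdiff (i, b) p))"
      by (rule sum_mult_assoc)
    also have "\<dots> = (\<Sum>i\<in>UNIV. if i = i0 then peval \<iota> ?x (pdiff (i, b) p) else 0)"
    proof (rule sum.cong[OF refl])
      fix i
      have "(\<Sum>a\<in>UNIV. Xi $ a $ i0 * X $ i $ a) = (X ** Xi) $ i $ i0" by (simp add: matrix_mult_entry mult.commute)
      also have "\<dots> = (if i = i0 then 1 else 0)" unfolding Xi(1) by (rule mat_one_entry)
      finally show "(\<Sum>a\<in>UNIV. Xi $ a $ i0 * X $ i $ a) * peval \<iota> ?x (pdiff (i, b) p) = (if i = i0 then peval \<iota> ?x (pdiff (i, b) p) else 0)"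
        by simp
    qed
    also have "\<dots> = peval \<iota> ?x (pdiff (i0, b) p)" by simp
    finally have "peval \<iota> ?x (pdiff (i0, b) p) = 0" ..
    then show ?thesis by (simp add: v)
  qed
  have inj_ev: "p = 0" if "peval \<iota> ?x p = 0" for p
    by (rule peval_inj_of_pdiff_closed[OF \<iota> charK closed that])
  obtain \<psi> :: "('n \<times> 'n, 'k) ratfun \<Rightarrow> 'e" where \<psi>: "field_hom \<psi>" "\<And>c. \<psi> (ratconst c) = \<iota> c"
    "\<And>v. \<psi> (ratvar v) = ?x v"
    by (rule ratfun_eval[OF \<iota>, of ?x]) (erule inj_ev, rule that)
  interpret \<psi>: field_hom \<psi> by fact
  note md = matrix_derivation[OF DK, of A0]
  have D\<psi>: "DE (\<psi> w) = \<psi> (matrix_derivation DK A0 w)" for w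
  proof (induct w rule: ratfun_induct)
    case (var v)
    show ?case by (cases v) (simp add: md(3) \<psi> DX \<psi>.hom_sum \<psi>.hom_mult)
  qed (simp_all add: md(2) \<psi>(2) DE_\<iota> derivation_add[OF md(1)] derivation_mult[OF md(1)] derivation_inverse[OF md(1)]
      derivation_add[OF DE] derivation_mult[OF DE] derivation_inverse[OF DE]
      \<psi>.hom_add \<psi>.hom_mult \<psi>.hom_inverse \<psi>.hom_uminus)
  have \<iota>\<psi>: "range \<iota> \<subseteq> range \<psi>"
    by (auto simp flip: \<psi>(2))
  \<comment> \<open>Y is also a fundamental matrix over the larger base F(X), so
    \<open>galois_moves\<close> applies there. An automorphism over F(X) fixes X, so its matrix
    \<gamma> \<sigma> is 1 and it moves nothing.\<close>
  interpret L: matrix_extension "matrix_derivation DK A0" DE \<psi> m Y Yi "\<lambda>i j. ratconst (A i j)"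
  proof unfold_locales
    show "differential_extension (matrix_derivation DK A0) DE \<psi>"
      using md(1) DE \<psi>(1) D\<psi> by (simp add: differential_extension_def)
    show "constants DE \<subseteq> range \<psi>" using constants_in_base \<iota>\<psi> by blast
    show "DE (Y i j) = (\<Sum>p<m. \<psi> (ratconst (A i p)) * Y p j)" if "i < m" "j < m" for i j
      using Y_ode[OF that] by (simp add: \<psi>)
    show "S = UNIV" if "is_subfield S" "range \<psi> \<subseteq> S" "\<And>i j. i < m \<Longrightarrow> j < m \<Longrightarrow> Y i j \<in> S" for S
      using generated_by_Y[OF that(1) _ that(3)] \<iota>\<psi> that(2) by blast
  qed (use char_0 alg_closed Yi in auto)
  have "x \<in> range \<psi>" for x
  proof (rule ccontr)
    assume "x \<notin> range \<psi>"
    then obtain \<sigma> where \<sigma>: "\<sigma> \<in> galois_group DE \<psi>" "\<sigma> x \<noteq> x" using L.galois_moves by blast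
    have "\<sigma> (\<psi> w) = \<psi> w" for w using \<sigma>(1) by (simp add: galois_group_def)
    from this[of "ratconst _"] this[of "ratvar _"]
    have 1: "\<sigma> (\<iota> k) = \<iota> k" and 2: "\<sigma> (X $ i $ j) = X $ i $ j" for k i j by (simp add: \<psi>, metis \<psi>(3) case_prod_conv)
    have \<sigma>G: "\<sigma> \<in> G" using \<sigma>(1) 1 by (simp add: galois_group_def)
    have "map_matrix \<sigma> X = X" by (simp add: Finite_Cartesian_Product.vec_eq_iff 2)
    then have "X ** map_matrix \<iota> (\<gamma> \<sigma>) = X" using X(2)[OF \<sigma>G] by simp
    then have "Xi ** X ** map_matrix \<iota> (\<gamma> \<sigma>) = Xi ** X" by (metis matrix_mul_assoc)
    then have "map_matrix \<iota> (\<gamma> \<sigma>) = map_matrix \<iota> (Finite_Cartesian_Product.mat 1)"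
      by (simp add: Xi map_matrix_mat_one[OF \<iota>])
    then have "\<gamma> \<sigma> = Finite_Cartesian_Product.mat 1" by (simp add: Finite_Cartesian_Product.vec_eq_iff)
    then have "\<sigma> = (\<lambda>x. x)" using \<phi>\<gamma>[OF \<sigma>G] \<phi>\<gamma>[OF G_id] one by metis
    then show False using \<sigma>(2) by simp
  qed
  then have "bij \<psi>" using \<psi>.inj_f by (auto simp: bij_def)
  then have "obtained_by_specialization DK DE \<iota> A0"
    unfolding obtained_by_specialization_def using \<psi> D\<psi> by (intro exI[of _ \<psi>]) auto
  then show ?thesis by blast
qed

end

theorem specialization_of_generic_extension:
  fixes \<phi> :: "('k::field, 'n::{finite, linorder}) sqmat \<Rightarrow> 'e::field \<Rightarrow> 'e"
  assumes pv: "picard_vessiot DK DE \<iota>" and iso: "GL_galois_iso DK DE \<iota> (constants DK) \<phi>"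
  shows "\<exists>A :: ('k, 'n) sqmat. obtained_by_specialization DK DE \<iota> A"
proof -
  obtain m y where y: "fundamental_system DK DE \<iota> m y"
    "\<And>f. regular_on (galois_group DE \<iota>) (constants DK) (galois_coordinates DK \<iota> m y) f \<longleftrightarrow>
       regular_on (GL (constants DK)) (constants DK) GL_coordinates (f \<circ> \<phi>)"
    using iso unfolding GL_galois_iso_def by blast
  obtain a where a: "basis_over (constants DK) \<iota> m y (ode_solutions DE \<iota> m a)"
    "differential_subfield DE hull (range \<iota> \<union> ode_solutions DE \<iota> m a) = UNIV"
    using y(1) unfolding fundamental_system_def by blast
  interpret fundamental_solutions DK DE \<iota> m y a by unfold_locales (rule pv a)+
  show ?thesis
    by (rule obtained_by_specialization_of_iso[of \<phi>]) (use iso y(2) in \<open>auto simp: GL_galois_iso_def\<close>)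
qed

section \<open>Constants of the generic extension\<close>

lemma derivation_commutator:
  assumes d: "derivation d" and d': "derivation d'"
  shows "derivation (\<lambda>x. d (d' x) - d' (d x))"
  unfolding derivation_def
  by (simp add: derivation_add[OF d] derivation_add[OF d'] derivation_mult[OF d] derivation_mult[OF d'] algebra_simps)

lemma derivation_sum_multiples:
  assumes "\<And>q. derivation (d q)"
  shows "derivation (\<lambda>x. \<Sum>q\<in>I. c q * d q x)"
  unfolding derivation_def
  by (simp add: assms[THEN derivation_add] assms[THEN derivation_mult] algebra_simps sum.distrib sum_distrib_left sum_distrib_right)

text \<open>Applied to the partial derivatives by the k-th derivatives of the indeterminates, this
  says that f involves only finitely many of them. It starts the descending induction on k, with N
  uniform in i.\<close>

lemma derivation_vanishes_eventually:
  fixes f :: "('v::linorder, 'a::field) ratfun" and d :: "'i \<Rightarrow> nat \<Rightarrow> ('v, 'a) ratfun \<Rightarrow> ('v, 'a) ratfun"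
  assumes der: "\<And>i k. derivation (d i k)" and const: "\<And>c. \<exists>N. \<forall>i. \<forall>k\<ge>N. d i k (ratconst c) = 0"
    and var: "\<And>v. \<exists>N. \<forall>i. \<forall>k\<ge>N. d i k (ratvar v) = 0"
  shows "\<exists>N. \<forall>i. \<forall>k\<ge>N. d i k f = 0"
proof (induct f rule: ratfun_induct)
  case (add x y)
  then obtain N N' where "\<forall>i. \<forall>k\<ge>N. d i k x = 0" "\<forall>i. \<forall>k\<ge>N'. d i k y = 0" by blast
  then show ?case by (intro exI[of _ "max N N'"]) (simp add: derivation_add[OF der])
next
  case (mult x y)
  then obtain N N' where "\<forall>i. \<forall>k\<ge>N. d i k x = 0" "\<forall>i. \<forall>k\<ge>N'. d i k y = 0" by blast
  then show ?case by (intro exI[of _ "max N N'"]) (simp add: derivation_mult[OF der])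
next
  case (inverse x)
  then show ?case by (auto simp: derivation_inverse[OF der])
qed (fact const var)+

lemma descending_vanish:
  assumes "\<exists>N. \<forall>i. \<forall>k\<ge>N. d i k = (0::'a::zero)" and step: "\<And>i k. d i (Suc k) = 0 \<Longrightarrow> d i k = 0"
  shows "d i k = 0"
proof -
  obtain N where "\<forall>k\<ge>N. d i k = 0" using assms(1) by blast
  then have "d i (k + (N - k)) = 0" by simp
  moreover have "d i (k + j) = 0 \<Longrightarrow> d i k = 0" for j by (induct j) (use step in auto)
  ultimately show ?thesis by blast
qed

lemma diff_indet_derivation:
  assumes D: "derivation D"
  shows "derivation (diff_indet_derivation D)"
    and "diff_indet_derivation D (ratconst c) = ratconst (D c)"
    and "diff_indet_derivation D (ratvar (i, j, k)) = ratvar (i, j, Suc k)"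
  unfolding diff_indet_derivation_def by (simp_all add: extend_derivation[OF D])

text \<open>\<open>index\<close> enumerates the index type because fundamental systems are indexed
  by natural numbers; \<open>index 0\<close> marks the row of X that supplies the solutions.\<close>

locale generic_extension =
  fixes D :: "'f::field \<Rightarrow> 'f" and n :: nat and index :: "nat \<Rightarrow> 'n::{finite, linorder}"
  assumes D: "derivation D" and char_f: "CHAR('f) = 0"
    and n: "n = CARD('n)" and index: "bij_betw index {..<n} UNIV"
begin

definition DY :: "('n, 'f) diff_ratfun \<Rightarrow> ('n, 'f) diff_ratfun" where
  "DY = diff_indet_derivation D"

definition DX :: "('n \<times> 'n, ('n, 'f) diff_ratfun) ratfun \<Rightarrow> ('n \<times> 'n, ('n, 'f) diff_ratfun) ratfun" where
  "DX = matrix_derivation DY diff_indet_matrix"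

lemma DY: "derivation DY" "DY (ratconst c) = ratconst (D c)" "DY (ratvar (i, j, k)) = ratvar (i, j, Suc k)"
  unfolding DY_def by (rule diff_indet_derivation[OF D])+

lemma DX: "derivation DX" "DX (ratconst f) = ratconst (DY f)"
  "DX (ratvar (i, j)) = (\<Sum>l\<in>UNIV. ratconst (ratvar (i, l, 0)) * ratvar (l, j))"
  unfolding DX_def by (simp_all add: matrix_derivation[OF DY(1)] diff_indet_matrix_def)

sublocale F: field_hom "ratconst :: 'f \<Rightarrow> ('n, 'f) diff_ratfun" by (rule field_hom_ratconst)
sublocale K: field_hom "ratconst :: ('n, 'f) diff_ratfun \<Rightarrow> ('n \<times> 'n, ('n, 'f) diff_ratfun) ratfun"
  by (rule field_hom_ratconst)

lemma char_K: "CHAR(('n, 'f) diff_ratfun) = 0"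
  by (rule CHAR_0_field_hom[OF field_hom_ratconst char_f])

text \<open>A commutator of derivations is a derivation, so both identities need checking only on
  coefficients and variables. The shift by one arises because \<open>DY\<close> takes the k-th
  derivative of an indeterminate to the next.\<close>

lemma ratdiff_DY:
  "ratdiff (i, j, Suc k) (DY f) = DY (ratdiff (i, j, Suc k) f) + ratdiff (i, j, k) f"
  "ratdiff (i, j, 0) (DY f) = DY (ratdiff (i, j, 0) f)"
proof -
  let ?r = "\<lambda>v. ratdiff v :: ('n, 'f) diff_ratfun \<Rightarrow> _"
  have "ratdiff (i, j, Suc k) (DY f) - DY (ratdiff (i, j, Suc k) f) = ratdiff (i, j, k) f"
  proof (rule ratfun_derivation_eqI[OF derivation_commutator[OF ratdiff(1) DY(1)] ratdiff(1)])
    show "?r (i, j, Suc k) (DY (ratvar v)) - DY (?r (i, j, Suc k) (ratvar v)) = ?r (i, j, k) (ratvar v)" for v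
      by (cases v) (simp add: DY ratdiff derivation_zero[OF DY(1)] derivation_one[OF DY(1)])
  qed (simp add: DY ratdiff derivation_zero[OF DY(1)])
  then show "ratdiff (i, j, Suc k) (DY f) = DY (ratdiff (i, j, Suc k) f) + ratdiff (i, j, k) f"
    by (simp add: diff_eq_eq add.commute)
  have "ratdiff (i, j, 0) (DY f) - DY (ratdiff (i, j, 0) f) = 0"
  proof (rule ratfun_derivation_eqI[OF derivation_commutator[OF ratdiff(1) DY(1)] derivation_0])
    show "?r (i, j, 0) (DY (ratvar v)) - DY (?r (i, j, 0) (ratvar v)) = 0" for v
      by (cases v) (simp add: DY ratdiff derivation_zero[OF DY(1)] derivation_one[OF DY(1)])
  qed (simp add: DY ratdiff derivation_zero[OF DY(1)])
  then show "ratdiff (i, j, 0) (DY f) = DY (ratdiff (i, j, 0) f)" by simp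
qed

lemma ratdiff_vanishes_eventually:
  fixes f :: "('n, 'f) diff_ratfun"
  shows "\<exists>N. \<forall>ij. \<forall>k\<ge>N. ratdiff (fst ij, snd ij, k) f = 0"
proof (rule derivation_vanishes_eventually)
  fix v :: "'n \<times> 'n \<times> nat"
  obtain a b c where v: "v = (a, b, c)" by (cases v)
  show "\<exists>N. \<forall>ij. \<forall>k\<ge>N. ratdiff (fst ij, snd ij, k) (ratvar v :: ('n, 'f) diff_ratfun) = 0"
    by (intro exI[of _ "Suc c"]) (auto simp: ratdiff v)
qed (auto simp: ratdiff)

lemma constants_DY: "constants DY = ratconst ` constants D"
proof (intro equalityI subsetI)
  fix f assume "f \<in> constants DY"
  then have f: "DY f = 0" by (simp add: constants_def)
  have "ratdiff (fst ij, snd ij, k) f = 0" for ij k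
  proof (rule descending_vanish[where d = "\<lambda>ij k. ratdiff (fst ij, snd ij, k) f"])
    fix ij :: "'n \<times> 'n" and k assume "ratdiff (fst ij, snd ij, Suc k) f = 0"
    then show "ratdiff (fst ij, snd ij, k) f = 0"
      using ratdiff_DY(1)[of "fst ij" "snd ij" k f] by (simp add: f derivation_zero[OF DY(1)] derivation_zero[OF ratdiff(1)])
  qed (rule ratdiff_vanishes_eventually)
  then have "ratdiff (i, j, k) f = 0" for i j k by (metis fst_conv snd_conv)
  then obtain c where c: "f = ratconst c" using ratdiff_all_zero_imp_const[OF char_f, of f] by auto
  then have "ratconst (D c) = (0 :: ('n, 'f) diff_ratfun)" using f by (simp add: DY)
  then show "f \<in> ratconst ` constants D" by (simp add: c constants_def)
qed (auto simp: constants_def DY)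

definition partialY :: "'n \<times> 'n \<times> nat \<Rightarrow> ('n \<times> 'n, ('n, 'f) diff_ratfun) ratfun \<Rightarrow> ('n \<times> 'n, ('n, 'f) diff_ratfun) ratfun" where
  "partialY v = extend_derivation (ratdiff v) (\<lambda>_. 0)"

lemma partialY: "derivation (partialY v)" "partialY v (ratconst f) = ratconst (ratdiff v f)" "partialY v (ratvar w) = 0"
  unfolding partialY_def by (rule extend_derivation[OF ratdiff(1)])+

lemmas zeros = derivation_zero[OF DY(1)] derivation_zero[OF DX(1)] derivation_one[OF DX(1)] derivation_zero[OF partialY(1)]
  derivation_zero[OF ratdiff(1)]

text \<open>At k = 0 the commutator acts on X too: in D X = Y X, the entry (i, b) contains Y_ij
  X_jb, whose derivative by Y_ij is X_jb. On a constant the resulting combinations vanish for every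
  j, and \<open>X_cancel\<close> then removes the factor X.\<close>

lemma partialY_DX:
  "partialY (i, j, Suc k) (DX z) = DX (partialY (i, j, Suc k) z) + partialY (i, j, k) z"
  "partialY (i, j, 0) (DX z) = DX (partialY (i, j, 0) z) + (\<Sum>q\<in>UNIV. ratvar (j, q) * ratdiff (i, q) z)"
proof -
  note sums = derivation_sum[OF partialY(1)] derivation_mult[OF partialY(1)]
  have "partialY (i, j, Suc k) (DX z) - DX (partialY (i, j, Suc k) z) = partialY (i, j, k) z"
  proof (rule ratfun_derivation_eqI[OF derivation_commutator[OF partialY(1) DX(1)] partialY(1)])
    show "partialY (i, j, Suc k) (DX (ratvar v)) - DX (partialY (i, j, Suc k) (ratvar v)) = partialY (i, j, k) (ratvar v)" for v
      by (cases v) (simp add: DX partialY sums ratdiff zeros)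
    show "partialY (i, j, Suc k) (DX (ratconst f)) - DX (partialY (i, j, Suc k) (ratconst f)) = partialY (i, j, k) (ratconst f)" for f
      by (simp add: DX partialY ratdiff_DY K.hom_add)
  qed
  then show "partialY (i, j, Suc k) (DX z) = DX (partialY (i, j, Suc k) z) + partialY (i, j, k) z"
    by (simp add: diff_eq_eq add.commute)
  let ?r = "\<lambda>v. ratdiff v :: ('n \<times> 'n, ('n, 'f) diff_ratfun) ratfun \<Rightarrow> _"
  have "partialY (i, j, 0) (DX z) - DX (partialY (i, j, 0) z) = (\<Sum>q\<in>UNIV. ratvar (j, q) * ratdiff (i, q) z)"
  proof (rule ratfun_derivation_eqI[OF derivation_commutator[OF partialY(1) DX(1)] derivation_sum_multiples[OF ratdiff(1)]])
    show "partialY (i, j, 0) (DX (ratvar v)) - DX (partialY (i, j, 0) (ratvar v)) = (\<Sum>q\<in>UNIV. ratvar (j, q) * ratdiff (i, q) (ratvar v))" for v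
    proof -
      obtain a b where v: "v = (a, b)" by (cases v)
      have "partialY (i, j, 0) (DX (ratvar v)) = (\<Sum>l\<in>UNIV. if l = j then (if a = i then ratvar (l, b) else 0) else 0)"
        unfolding v DX(3) sums partialY ratdiff by (intro sum.cong) auto
      moreover have "(\<Sum>q\<in>UNIV. ratvar (j, q) * ?r (i, q) (ratvar v)) = (\<Sum>q\<in>UNIV. if q = b then (if a = i then ratvar (j, q) else 0) else 0)"
        unfolding v ratdiff by (intro sum.cong) auto
      ultimately show ?thesis by (simp add: partialY zeros)
    qed
    show "partialY (i, j, 0) (DX (ratconst f)) - DX (partialY (i, j, 0) (ratconst f)) = (\<Sum>q\<in>UNIV. ratvar (j, q) * ratdiff (i, q) (ratconst f))" for f
      by (simp add: DX partialY ratdiff_DY ratdiff)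
  qed
  then show "partialY (i, j, 0) (DX z) = DX (partialY (i, j, 0) z) + (\<Sum>q\<in>UNIV. ratvar (j, q) * ratdiff (i, q) z)"
    by (simp add: diff_eq_eq add.commute)
qed

end

text \<open>Vectors \<open>u\<^sub>0, u\<^sub>1, \<dots>\<close> such that the entries of \<open>u\<^sub>k\<close> are independent variables over the
  field generated by the earlier ones, as witnessed by derivations.\<close>

lemma independent_of_derivations:
  fixes u :: "nat \<Rightarrow> ('a::field, 'n::finite) Finite_Cartesian_Product.vec" and d :: "nat \<Rightarrow> 'n \<Rightarrow> 'a \<Rightarrow> 'a"
  assumes u0: "u 0 \<noteq> 0" and d: "\<And>k j. derivation (d k j)"
    and kill: "\<And>k j i l. 0 < k \<Longrightarrow> k < CARD('n) \<Longrightarrow> i < k \<Longrightarrow> d k j (u i $ l) = 0"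
    and one: "\<And>k j l. 0 < k \<Longrightarrow> k < CARD('n) \<Longrightarrow> d k j (u k $ l) = (if l = j then 1 else 0)"
  shows "n \<le> CARD('n) \<Longrightarrow> vec.independent (u ` {..<n}) \<and> inj_on u {..<n}"
proof (induct n)
  case (Suc n)
  then have IH: "vec.independent (u ` {..<n})" "inj_on u {..<n}" by auto
  have "u n \<notin> vec.span (u ` {..<n})"
  proof (cases "n = 0")
    case False
    show ?thesis
    proof
      assume "u n \<in> vec.span (u ` {..<n})"
      then obtain c where "u n = (\<Sum>v\<in>u ` {..<n}. c v *s v)" by (auto simp: vec.span_finite)
      then have c: "u n = (\<Sum>i<n. c (u i) *s u i)" by (simp add: sum.reindex[OF IH(2)])
      \<comment> \<open>Applying \<open>d n j\<close> to the dependence relation puts every unit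
        vector into the span of the n earlier vectors, although n is less than the
        dimension.\<close>
      have "axis j 1 = (\<Sum>i<n. d n j (c (u i)) *s u i)" for j
      proof -
        have "axis j 1 $ l = (\<Sum>i<n. d n j (c (u i)) *s u i) $ l" for l
        proof -
          have "axis j 1 $ l = d n j (u n $ l)" using one[of n j l] False Suc(2) by (simp add: axis_def)
          also have "\<dots> = (\<Sum>i<n. d n j (c (u i)) * u i $ l)"
            unfolding c using kill False Suc(2) by (simp add: derivation_sum[OF d] derivation_mult[OF d])
          finally show ?thesis by simp
        qed
        then show ?thesis by (simp add: Finite_Cartesian_Product.vec_eq_iff)
      qed
      moreover have "(\<Sum>i<n. d n j (c (u i)) *s u i) \<in> vec.span (u ` {..<n})" for j
        by (intro vec.span_sum vec.span_scale vec.span_base) auto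
      ultimately have "vec.span (u ` {..<n}) = UNIV" by (intro span_axes_UNIV) metis
      then have "vec.dim (UNIV :: ('a, 'n) Finite_Cartesian_Product.vec set) \<le> card (u ` {..<n})"
        by (intro vec.dim_le_card) auto
      then have "CARD('n) \<le> n" using card_image[OF IH(2)]
        by (simp add: vec.dim_UNIV card_cart_basis vec.dimension_def)
      then show False using Suc(2) by simp
    qed
  qed (simp add: u0)
  then show ?case
    using IH vec.span_base[of "u n" "u ` {..<n}"] by (auto simp: lessThan_Suc vec.independent_insertI)
qed (simp add: vec.independent_empty)

lemma span_UNIV_of_derivations:
  fixes u :: "nat \<Rightarrow> ('a::field, 'n::finite) Finite_Cartesian_Product.vec" and d :: "nat \<Rightarrow> 'n \<Rightarrow> 'a \<Rightarrow> 'a"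
  assumes "u 0 \<noteq> 0" "\<And>k j. derivation (d k j)"
    "\<And>k j i l. 0 < k \<Longrightarrow> k < CARD('n) \<Longrightarrow> i < k \<Longrightarrow> d k j (u i $ l) = 0"
    "\<And>k j l. 0 < k \<Longrightarrow> k < CARD('n) \<Longrightarrow> d k j (u k $ l) = (if l = j then 1 else 0)"
  shows "vec.span (u ` {..<CARD('n)}) = UNIV" "inj_on u {..<CARD('n)}"
proof -
  have *: "vec.independent (u ` {..<CARD('n)})" "inj_on u {..<CARD('n)}"
    using independent_of_derivations[of u d "CARD('n)", OF assms] by auto
  then have "card (u ` {..<CARD('n)}) = CARD('n)" by (simp add: card_image)
  then have "UNIV \<subseteq> vec.span (u ` {..<CARD('n)})"
    by (intro vec.card_ge_dim_independent *) (simp_all add: vec.dim_UNIV card_cart_basis vec.dimension_def)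
  then show "vec.span (u ` {..<CARD('n)}) = UNIV" "inj_on u {..<CARD('n)}" using * by auto
qed

lemma invertible_map_matrix:
  fixes h :: "'a::field \<Rightarrow> 'b::field" and A :: "('a, 'n::finite) sqmat"
  assumes "field_hom h" "invertible A"
  shows "invertible (map_matrix h A)"
proof -
  obtain B where "A ** B = Finite_Cartesian_Product.mat 1" using assms(2) by (auto simp: invertible_def)
  then have "map_matrix h A ** map_matrix h B = Finite_Cartesian_Product.mat 1"
    by (metis map_matrix_mult[OF assms(1)] map_matrix_mat_one[OF assms(1)])
  then show ?thesis unfolding invertible_right_inverse by blast
qed

lemma ratvar_nonzero: "ratvar v \<noteq> (0 :: ('v::linorder, 'a::field) ratfun)"
proof
  assume "ratvar v = (0 :: ('v, 'a) ratfun)"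
  then have "ratdiff v (ratvar v :: ('v, 'a) ratfun) = 0" by (simp add: derivation_zero[OF ratdiff(1)])
  then show False by (simp add: ratdiff)
qed

context generic_extension
begin

lemma sum_index: "(\<Sum>i<n. f (index i)) = (\<Sum>j\<in>UNIV. f j)"
  by (rule sum.reindex_bij_betw[OF index])

lemma index_eq_iff: "i < n \<Longrightarrow> k < n \<Longrightarrow> index i = index k \<longleftrightarrow> i = k"
  using index by (auto simp: bij_betw_def inj_on_def)

definition pos :: "'n \<Rightarrow> nat" where "pos = inv_into {..<n} index"

lemma pos: "pos p < n" "index (pos p) = p" "k < n \<Longrightarrow> pos (index k) = k"
proof -
  have p: "p \<in> index ` {..<n}" using index by (auto simp: bij_betw_def)
  show "pos p < n" "index (pos p) = p"
    using inv_into_into[OF p] f_inv_into_f[OF p] by (simp_all add: pos_def)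
  show "k < n \<Longrightarrow> pos (index k) = k"
    unfolding pos_def using index by (intro inv_into_f_f) (auto simp: bij_betw_def)
qed

lemma range_pos: "range pos = {..<n}"
proof (intro equalityI subsetI)
  fix k assume "k \<in> {..<n}"
  then have "k = pos (index k)" using pos(3) by simp
  then show "k \<in> range pos" by blast
qed (use pos(1) in auto)

definition X :: "(('n \<times> 'n, ('n, 'f) diff_ratfun) ratfun, 'n) sqmat" where
  "X = (\<chi> i j. ratvar (i, j))"

text \<open>The rows consist of distinct variables, so the derivatives by the variables of the k-th
  row are the witnesses for its independence of the earlier rows.\<close>

lemma X_invertible: "invertible X"
proof (rule invertible_of_spanning_rows)
  have "(\<lambda>k. X $ index k) ` {..<n} = (\<lambda>i. X $ i) ` index ` {..<n}" by (simp only: image_image)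
  also have "index ` {..<n} = UNIV" using index by (simp add: bij_betw_def)
  finally have "range (\<lambda>i. X $ i) = (\<lambda>k. X $ index k) ` {..<n}" by simp
  moreover have "vec.span ((\<lambda>k. X $ index k) ` {..<n}) = UNIV"
  proof (rule span_UNIV_of_derivations(1)[where 'n = 'n, folded n, where d = "\<lambda>k j. ratdiff (index k, j)"])
    have "X $ index 0 $ index 0 \<noteq> 0 $ index 0" by (simp add: X_def ratvar_nonzero)
    then show "X $ index 0 \<noteq> 0" by metis
  qed (auto simp: X_def ratdiff ratdiff(1) index_eq_iff)
  ultimately show "vec.span (range (\<lambda>i. X $ i)) = UNIV" by simp
qed

lemma X_cancel:
  assumes "\<And>i. (\<Sum>q\<in>UNIV. ratvar (i, q) * c q) = (0 :: ('n \<times> 'n, ('n, 'f) diff_ratfun) ratfun)"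
  shows "c q = 0"
proof -
  have "X *v (\<chi> q. c q) = 0"
    by (simp add: Finite_Cartesian_Product.vec_eq_iff matrix_vector_mult_def X_def assms)
  then have "(\<chi> q. c q) = 0" using X_invertible unfolding invertible_left_inverse matrix_left_invertible_ker by blast
  then have "(\<chi> q. c q) $ q = 0" by simp
  then show ?thesis by simp
qed

lemma partialY_vanishes_eventually: "\<exists>N. \<forall>ij. \<forall>k\<ge>N. partialY (fst ij, snd ij, k) z = 0"
proof (rule derivation_vanishes_eventually)
  fix f :: "('n, 'f) diff_ratfun"
  obtain N where "\<forall>ij. \<forall>k\<ge>N. ratdiff (fst ij, snd ij, k) f = 0" using ratdiff_vanishes_eventually by blast
  then show "\<exists>N. \<forall>ij. \<forall>k\<ge>N. partialY (fst ij, snd ij, k) (ratconst f) = 0"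
    by (intro exI[of _ N]) (simp add: partialY)
qed (simp_all add: partialY)

lemma constants_DX: "constants DX = ratconst ` constants DY"
proof (intro equalityI subsetI)
  fix z assume "z \<in> constants DX"
  then have z: "DX z = 0" by (simp add: constants_def)
  have "partialY (fst ij, snd ij, k) z = 0" for ij k
  proof (rule descending_vanish[where d = "\<lambda>ij k. partialY (fst ij, snd ij, k) z"])
    fix ij :: "'n \<times> 'n" and k assume "partialY (fst ij, snd ij, Suc k) z = 0"
    then show "partialY (fst ij, snd ij, k) z = 0"
      using partialY_DX(1)[of "fst ij" "snd ij" k z] by (simp add: z zeros)
  qed (rule partialY_vanishes_eventually)
  then have "partialY (i, j, 0) z = 0" for i j by (metis fst_conv snd_conv)
  then have "(\<Sum>q\<in>UNIV. ratvar (j, q) * ratdiff (i, q) z) = 0" for i j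
    using partialY_DX(2)[of i j z] by (simp add: z zeros)
  then have "ratdiff (i, q) z = 0" for i q by (rule X_cancel)
  then have "ratdiff v z = 0" for v by (cases v) simp
  then obtain f where f: "z = ratconst f" using ratdiff_all_zero_imp_const[OF char_K, of z] by auto
  then have "ratconst (DY f) = (0 :: ('n \<times> 'n, ('n, 'f) diff_ratfun) ratfun)" using z by (simp add: DX)
  then show "z \<in> ratconst ` constants DY" by (simp add: f constants_def)
qed (auto simp: constants_def DX)

section \<open>The generic equation as a scalar equation\<close>

text \<open>The coordinates, with respect to the rows of X, of the k-th derivative of its first row
  (see \<open>DX_pow\<close>). The recursion is v \<mapsto> v' + v Y, starting at the first unit
  vector.\<close>

primrec cyclic :: "nat \<Rightarrow> (('n, 'f) diff_ratfun, 'n) Finite_Cartesian_Product.vec" where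
  "cyclic 0 = axis (index 0) 1"
| "cyclic (Suc k) = (\<chi> p. DY (cyclic k $ p) + (\<Sum>l\<in>UNIV. cyclic k $ l * ratvar (l, p, 0)))"

lemma cyclic_0: "cyclic 0 $ p = (if p = index 0 then 1 else 0)"
  by (simp add: axis_def)

lemma ratdiff_cyclic_zero: "i \<le> k \<Longrightarrow> ratdiff (a, j, k) (cyclic i $ p) = 0"
proof (induct i arbitrary: k p)
  case 0
  show ?case by (simp add: cyclic_0 derivation_zero[OF ratdiff(1)] derivation_one[OF ratdiff(1)] del: cyclic.simps)
next
  case (Suc i)
  then obtain k' where "k = Suc k'" "i \<le> k'" by (cases k) auto
  then show ?case
    by (simp add: derivation_add[OF ratdiff(1)] derivation_sum[OF ratdiff(1)] derivation_mult[OF ratdiff(1)]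
        ratdiff_DY Suc(1) ratdiff(3) zeros)
qed

text \<open>Up to derivatives of Y of order below k, \<open>cyclic (Suc k)\<close> is the k-th
  derivative of the first row of Y, so its entries bring in new variables with coefficient
  1.\<close>

lemma ratdiff_cyclic: "ratdiff (index 0, j, k) (cyclic (Suc k) $ p) = (if p = j then 1 else 0)"
proof (induct k)
  case 0
  have "(\<Sum>l\<in>UNIV. cyclic 0 $ l * ratvar (l, p, 0)) = (\<Sum>l\<in>UNIV. if l = index 0 then ratvar (l, p, 0) else 0)"
    unfolding cyclic_0 by (intro sum.cong) auto
  then have "(\<Sum>l\<in>UNIV. cyclic 0 $ l * ratvar (l, p, 0)) = ratvar (index 0, p, 0)" by simp
  moreover have "DY (cyclic 0 $ p) = 0" by (simp add: cyclic_0 zeros derivation_one[OF DY(1)] del: cyclic.simps)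
  ultimately have "cyclic (Suc 0) $ p = ratvar (index 0, p, 0)" by simp
  then show ?case by (simp add: ratdiff del: cyclic.simps)
next
  case (Suc k)
  have z: "ratdiff (index 0, j, Suc k) (cyclic (Suc k) $ l) = 0" for l by (rule ratdiff_cyclic_zero) simp
  show ?case
    unfolding cyclic.simps(2)[of "Suc k"]
    by (simp add: derivation_add[OF ratdiff(1)] derivation_sum[OF ratdiff(1)] derivation_mult[OF ratdiff(1)]
        ratdiff_DY z Suc ratdiff(3) zeros del: cyclic.simps)
qed

text \<open>The witness for \<open>cyclic k\<close> has order k - 1, since Y first enters in
  \<open>cyclic 1\<close>. The vector \<open>cyclic 0\<close> is constant and only has to be
  nonzero.\<close>

lemma cyclic_span: "vec.span (cyclic ` {..<n}) = UNIV"
proof (rule span_UNIV_of_derivations(1)[where 'n = 'n, folded n, where d = "\<lambda>k j. ratdiff (index 0, j, k - 1)"])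
  fix k :: nat and j l assume "0 < k"
  then show "ratdiff (index 0, j, k - 1) (cyclic k $ l) = (if l = j then 1 else 0)"
    using ratdiff_cyclic[of j "k - 1" l] by simp
qed (auto simp: ratdiff(1) ratdiff_cyclic_zero axis_eq_0_iff simp del: cyclic.simps(2))

text \<open>The first n vectors form a basis, so the next one depends on them. The coefficients of
  this dependence become those of the scalar equation of order n.\<close>

lemma cyclic_relation: "\<exists>a. \<forall>l. cyclic n $ l + (\<Sum>k<n. a k * cyclic k $ l) = 0"
proof -
  have inj: "inj_on cyclic {..<n}"
  proof (rule span_UNIV_of_derivations(2)[where 'n = 'n, folded n, where d = "\<lambda>k j. ratdiff (index 0, j, k - 1)"])
    fix k :: nat and j l assume "0 < k"
    then show "ratdiff (index 0, j, k - 1) (cyclic k $ l) = (if l = j then 1 else 0)"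
      using ratdiff_cyclic[of j "k - 1" l] by simp
  qed (auto simp: ratdiff(1) ratdiff_cyclic_zero axis_eq_0_iff simp del: cyclic.simps(2))
  have "cyclic n \<in> vec.span (cyclic ` {..<n})" using cyclic_span by blast
  then obtain c where "cyclic n = (\<Sum>v\<in>cyclic ` {..<n}. c v *s v)" by (auto simp: vec.span_finite)
  then have c: "cyclic n = (\<Sum>i<n. c (cyclic i) *s cyclic i)" by (simp add: sum.reindex[OF inj])
  have "cyclic n $ l + (\<Sum>k<n. (- c (cyclic k)) * cyclic k $ l) = 0" for l
  proof -
    have "cyclic n $ l = (\<Sum>i<n. c (cyclic i) *s cyclic i) $ l" using c by simp
    then show ?thesis by (simp add: sum_negf)
  qed
  then show ?thesis by (intro exI[of _ "\<lambda>k. - c (cyclic k)"]) blast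
qed

definition a :: "nat \<Rightarrow> ('n, 'f) diff_ratfun" where
  "a = (SOME a. \<forall>l. cyclic n $ l + (\<Sum>k<n. a k * cyclic k $ l) = 0)"

lemma a: "cyclic n $ l + (\<Sum>k<n. a k * cyclic k $ l) = 0"
  using someI_ex[OF cyclic_relation] unfolding a_def by blast

lemma DX_pow: "(DX ^^ k) (ratvar (index 0, j)) = (\<Sum>l\<in>UNIV. ratconst (cyclic k $ l) * ratvar (l, j))"
proof (induct k)
  case 0
  have "(\<Sum>l\<in>UNIV. ratconst (cyclic 0 $ l) * ratvar (l, j))
      = (\<Sum>l\<in>UNIV. if l = index 0 then ratvar (l, j) else (0 :: ('n \<times> 'n, ('n, 'f) diff_ratfun) ratfun))"
    unfolding cyclic_0 by (intro sum.cong) auto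
  then show ?case by (simp del: cyclic.simps)
next
  case (Suc k)
  let ?Y = "\<lambda>l p. ratconst (ratvar (l, p, 0)) :: ('n \<times> 'n, ('n, 'f) diff_ratfun) ratfun"
  have "(DX ^^ Suc k) (ratvar (index 0, j)) = (\<Sum>l\<in>UNIV. ratconst (DY (cyclic k $ l)) * ratvar (l, j))
      + (\<Sum>l\<in>UNIV. ratconst (cyclic k $ l) * (\<Sum>p\<in>UNIV. ?Y l p * ratvar (p, j)))"
    by (simp add: Suc derivation_sum[OF DX(1)] derivation_mult[OF DX(1)] DX sum.distrib del: cyclic.simps)
  also have "(\<Sum>l\<in>UNIV. ratconst (cyclic k $ l) * (\<Sum>p\<in>UNIV. ?Y l p * ratvar (p, j)))
      = (\<Sum>p\<in>UNIV. (\<Sum>l\<in>UNIV. ratconst (cyclic k $ l) * ?Y l p) * ratvar (p, j))"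
    by (rule sum_mult_assoc)
  finally show ?case by (simp add: K.hom_add K.hom_sum K.hom_mult distrib_right sum.distrib)
qed

lemma DX_pow_add_scaled:
  assumes "finite I" "\<And>j. j \<in> I \<Longrightarrow> DX (c j) = 0"
  shows "(DX ^^ k) (\<Sum>j\<in>I. c j * w j) = (\<Sum>j\<in>I. c j * (DX ^^ k) (w j))"
  by (induct k) (simp_all add: derivation_sum[OF DX(1)] derivation_mult[OF DX(1)] assms)

lemma ratvar_ode: "(DX ^^ n) (ratvar (index 0, j)) = (\<Sum>k<n. - ratconst (a k) * (DX ^^ k) (ratvar (index 0, j)))"
proof -
  have "(\<Sum>k<n. ratconst (a k) * (DX ^^ k) (ratvar (index 0, j)))
      = (\<Sum>l\<in>UNIV. (\<Sum>k<n. ratconst (a k) * ratconst (cyclic k $ l)) * ratvar (l, j))"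
    unfolding DX_pow by (rule sum_mult_assoc)
  then have "(DX ^^ n) (ratvar (index 0, j)) + (\<Sum>k<n. ratconst (a k) * (DX ^^ k) (ratvar (index 0, j)))
      = (\<Sum>l\<in>UNIV. ratconst (cyclic n $ l + (\<Sum>k<n. a k * cyclic k $ l)) * ratvar (l, j))"
    by (simp add: DX_pow K.hom_add K.hom_sum K.hom_mult distrib_right sum.distrib del: cyclic.simps)
  also have "\<dots> = 0" by (simp add: a del: cyclic.simps)
  finally show ?thesis by (simp add: eq_neg_iff_add_eq_0 sum_negf)
qed

text \<open>The Wronskian matrix of the first row of X. It factors as \<open>Wc\<close> times X by
  \<open>W_eq\<close>, which gives its invertibility and later recovers X from it.\<close>

definition W :: "(('n \<times> 'n, ('n, 'f) diff_ratfun) ratfun, 'n) sqmat" where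
  "W = (\<chi> p j. (DX ^^ pos p) (ratvar (index 0, j)))"

definition Wc :: "(('n, 'f) diff_ratfun, 'n) sqmat" where
  "Wc = (\<chi> p. cyclic (pos p))"

lemma Wc_invertible: "invertible Wc"
proof (rule invertible_of_spanning_rows)
  have "range (\<lambda>p. Wc $ p) = cyclic ` range pos" unfolding Wc_def by auto
  then show "vec.span (range (\<lambda>p. Wc $ p)) = UNIV" using cyclic_span range_pos by simp
qed

lemma W_eq: "W = map_matrix ratconst Wc ** X"
  by (simp add: Finite_Cartesian_Product.vec_eq_iff W_def Wc_def X_def matrix_mult_entry DX_pow)

lemma W_invertible: "invertible W"
  unfolding W_eq by (intro invertible_mult invertible_map_matrix field_hom_ratconst Wc_invertible X_invertible)

definition y :: "nat \<Rightarrow> ('n \<times> 'n, ('n, 'f) diff_ratfun) ratfun" where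
  "y j = ratvar (index 0, index j)"

text \<open>Variation of constants: c = W^-1 (z, z', ...) expresses the derivatives of z below order
  n through those of the first row, and the common equation adds order n. Comparing each identity
  with the derivative of the previous one leaves W c' = 0, so c is constant.\<close>

lemma solution_combination:
  assumes z: "z \<in> ode_solutions DX ratconst n a"
  shows "\<exists>c. (\<forall>i<n. c i \<in> constants DY) \<and> z = (\<Sum>i<n. ratconst (c i) * y i)"
proof -
  obtain Wi where Wi: "W ** Wi = Finite_Cartesian_Product.mat 1" "Wi ** W = Finite_Cartesian_Product.mat 1"
    using W_invertible by (auto simp: invertible_def)
  define zv where "zv = (\<chi> p. (DX ^^ pos p) z)"
  define c where "c = Wi *v zv"
  have "W *v c = zv" unfolding c_def by (simp add: matrix_vector_mul_assoc Wi)
  have eq: "(DX ^^ k) z = (\<Sum>j\<in>UNIV. (DX ^^ k) (ratvar (index 0, j)) * c $ j)" if k: "k < n" for k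
  proof -
    have "(DX ^^ k) z = zv $ index k" by (simp add: zv_def pos(3)[OF k])
    also have "\<dots> = (\<Sum>j\<in>UNIV. (DX ^^ k) (ratvar (index 0, j)) * c $ j)"
      unfolding \<open>W *v c = zv\<close>[symmetric] by (simp add: W_def matrix_vector_mult_def pos(3)[OF k])
    finally show ?thesis .
  qed
  have "(DX ^^ n) z = (\<Sum>k<n. - ratconst (a k) * (DX ^^ k) z)"
    using z by (simp add: ode_solutions_def eq_neg_iff_add_eq_0 sum_negf)
  also have "\<dots> = (\<Sum>k<n. - ratconst (a k) * (\<Sum>j\<in>UNIV. (DX ^^ k) (ratvar (index 0, j)) * c $ j))"
    by (intro sum.cong refl) (simp add: eq)
  also have "\<dots> = (\<Sum>j\<in>UNIV. (\<Sum>k<n. - ratconst (a k) * (DX ^^ k) (ratvar (index 0, j))) * c $ j)"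
    by (rule sum_mult_assoc)
  finally have "(DX ^^ n) z = (\<Sum>j\<in>UNIV. (DX ^^ n) (ratvar (index 0, j)) * c $ j)"
    unfolding ratvar_ode .
  with eq have eq': "(DX ^^ k) z = (\<Sum>j\<in>UNIV. (DX ^^ k) (ratvar (index 0, j)) * c $ j)" if "k \<le> n" for k
    using that by (cases "k = n") auto
  have "(\<Sum>j\<in>UNIV. (DX ^^ k) (ratvar (index 0, j)) * DX (c $ j)) = 0" if k: "k < n" for k
  proof -
    have "(DX ^^ Suc k) z = DX (\<Sum>j\<in>UNIV. (DX ^^ k) (ratvar (index 0, j)) * c $ j)" using eq'[of k] k by simp
    also have "\<dots> = (\<Sum>j\<in>UNIV. (DX ^^ Suc k) (ratvar (index 0, j)) * c $ j) + (\<Sum>j\<in>UNIV. (DX ^^ k) (ratvar (index 0, j)) * DX (c $ j))"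
      by (simp add: derivation_sum[OF DX(1)] derivation_mult[OF DX(1)] sum.distrib)
    finally show ?thesis using eq'[of "Suc k"] k by simp
  qed
  then have "W *v (\<chi> j. DX (c $ j)) = 0"
    by (simp add: Finite_Cartesian_Product.vec_eq_iff matrix_vector_mult_def W_def pos)
  then have "(\<chi> j. DX (c $ j)) = 0" using W_invertible unfolding invertible_left_inverse matrix_left_invertible_ker by blast
  then have "(\<chi> j. DX (c $ j)) $ j = 0" for j by simp
  then have "c $ j \<in> constants DX" for j by (simp add: constants_def)
  then have "\<forall>j. \<exists>k. k \<in> constants DY \<and> c $ j = ratconst k" unfolding constants_DX by blast
  then obtain b where b: "\<And>j. b j \<in> constants DY" "\<And>j. c $ j = ratconst (b j)" by metis
  have "z = (\<Sum>j\<in>UNIV. ratconst (b j) * ratvar (index 0, j))" using eq'[of 0] by (simp add: b mult.commute)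
  also have "\<dots> = (\<Sum>i<n. ratconst (b (index i)) * y i)" unfolding y_def by (rule sum_index[symmetric])
  finally show ?thesis using b(1) by (intro exI[of _ "\<lambda>i. b (index i)"]) simp
qed

lemma combination_solution:
  assumes "\<forall>i<n. c i \<in> constants DY"
  shows "(\<Sum>i<n. ratconst (c i) * y i) \<in> ode_solutions DX ratconst n a"
proof -
  have c: "DX (ratconst (c i)) = 0" if "i \<in> {..<n}" for i using assms that by (simp add: DX constants_def)
  have lin: "(DX ^^ k) (\<Sum>i<n. ratconst (c i) * y i) = (\<Sum>i<n. ratconst (c i) * (DX ^^ k) (y i))" for k
    by (rule DX_pow_add_scaled) (use c in simp_all)
  have "(\<Sum>k<n. ratconst (a k) * (DX ^^ k) (\<Sum>i<n. ratconst (c i) * y i))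
      = (\<Sum>k<n. ratconst (a k) * (\<Sum>i<n. (DX ^^ k) (y i) * ratconst (c i)))"
    by (simp add: lin mult.commute)
  also have "\<dots> = (\<Sum>i<n. (\<Sum>k<n. ratconst (a k) * (DX ^^ k) (y i)) * ratconst (c i))" by (rule sum_mult_assoc)
  also have "\<dots> = (\<Sum>i<n. - (DX ^^ n) (y i) * ratconst (c i))"
    unfolding y_def ratvar_ode by (simp add: sum_negf)
  also have "\<dots> = - (DX ^^ n) (\<Sum>i<n. ratconst (c i) * y i)"
    by (simp add: lin sum_negf mult.commute)
  finally show ?thesis by (simp add: ode_solutions_def)
qed

lemma y_indep:
  assumes "(\<Sum>i<n. ratconst (c i) * y i) = 0" "i < n"
  shows "c i = 0"
proof -
  have "ratdiff (index 0, index i) (\<Sum>k<n. ratconst (c k) * y k) = (\<Sum>k<n. if k = i then ratconst (c k) else 0)"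
    unfolding derivation_sum[OF ratdiff(1)] derivation_mult[OF ratdiff(1)] y_def ratdiff
    using assms(2) by (intro sum.cong) (auto simp: index_eq_iff)
  then have "ratconst (c i) = (0 :: ('n \<times> 'n, ('n, 'f) diff_ratfun) ratfun)" using assms by (simp add: zeros)
  then show ?thesis by simp
qed

text \<open>The solutions include the first row of X, its derivatives form W, and X = Wc^-1 W has
  its entries in any field containing these and the base.\<close>

lemma generated_by_solutions:
  assumes S: "differential_subfield DX S" "range ratconst \<subseteq> S" "ode_solutions DX ratconst n a \<subseteq> S"
  shows "S = UNIV"
proof -
  have sub: "is_subfield S" and SD: "\<And>x. x \<in> S \<Longrightarrow> DX x \<in> S"
    using S(1) by (auto simp: differential_subfield_def is_subfield_def)
  note sD = is_subfieldD[OF sub]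
  have y: "ratvar (index 0, j) \<in> S" for j
  proof -
    have "(\<Sum>i<n. ratconst (if i = pos j then 1 else 0) * y i) \<in> S"
      by (rule subsetD[OF S(3) combination_solution]) (simp add: constants_def zeros derivation_one[OF DY(1)])
    also have "(\<Sum>i<n. ratconst (if i = pos j then 1 else 0) * y i) = (\<Sum>i<n. if i = pos j then y i else 0)"
      by (intro sum.cong) auto
    also have "\<dots> = ratvar (index 0, j)" using pos(1,2)[of j] by (simp add: y_def)
    finally show ?thesis .
  qed
  have Dy: "(DX ^^ k) (ratvar (index 0, j)) \<in> S" for k j by (induct k) (simp_all add: y SD)
  obtain V where V: "V ** Wc = Finite_Cartesian_Product.mat 1" using Wc_invertible by (auto simp: invertible_def)
  have "X = map_matrix ratconst (V ** Wc) ** X"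
    unfolding V map_matrix_mat_one[OF field_hom_ratconst] by simp
  also have "\<dots> = map_matrix ratconst V ** W"
    unfolding W_eq map_matrix_mult[OF field_hom_ratconst] by (rule matrix_mul_assoc[symmetric])
  finally have X: "X = map_matrix ratconst V ** W" .
  have XS: "ratvar (i, j) \<in> S" for i j
  proof -
    have "ratvar (i, j) = X $ i $ j" by (simp add: X_def)
    also have "\<dots> = (\<Sum>p\<in>UNIV. ratconst (V $ i $ p) * (DX ^^ pos p) (ratvar (index 0, j)))"
      unfolding X by (simp add: matrix_mult_entry W_def)
    also have "\<dots> \<in> S" by (rule is_subfield_sum[OF sub]) (use S(2) Dy sD(5) in blast)
    finally show ?thesis .
  qed
  have "z \<in> S" for z
  proof (induct z rule: ratfun_induct)
    case (const c)
    then show ?case using S(2) by blast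
  next
    case (var v)
    then show ?case using XS by (cases v) simp
  qed (simp_all add: sD)
  then show ?thesis by blast
qed

lemma fundamental_a: "basis_over (constants DY) ratconst n y (ode_solutions DX ratconst n a)"
  "differential_subfield DX hull (range ratconst \<union> ode_solutions DX ratconst n a) = UNIV"
proof -
  show "basis_over (constants DY) ratconst n y (ode_solutions DX ratconst n a)"
    unfolding basis_over_def using solution_combination combination_solution y_indep by blast
  show "differential_subfield DX hull (range ratconst \<union> ode_solutions DX ratconst n a) = UNIV"
    unfolding hull_def using generated_by_solutions by auto
qed

lemma fundamental: "fundamental_system DY DX ratconst n y"
  unfolding fundamental_system_def using fundamental_a by blast

end

section \<open>The automorphisms of the generic extension\<close>

lemma det_map_matrix:
  fixes A :: "('a::field, 'n::finite) sqmat"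
  assumes "field_hom h"
  shows "Determinants.det (map_matrix h A) = h (Determinants.det A)"
proof -
  interpret field_hom h by fact
  show ?thesis by (simp add: Determinants.det_def hom_sum hom_mult hom_prod hom_of_int)
qed

text \<open>Relates the determinants of the two matrix types: conjugation with the enumeration e
  matches the permutations and preserves their signs.\<close>

lemma det_reindex:
  fixes g :: "('a::comm_ring_1, 'n::finite) sqmat" and e :: "nat \<Rightarrow> 'n"
  assumes e: "bij_betw e {..<n} UNIV"
  shows "Determinant.det (Matrix.mat n n (\<lambda>(i, j). g $ e i $ e j)) = Determinants.det g"
proof -
  let ?A = "Matrix.mat n n (\<lambda>(i, j). g $ e i $ e j)" and ?f = "inv_into {..<n} e"
  have f: "bij_betw ?f UNIV {..<n}" by (rule bij_betw_inv_into[OF e])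
  have "Determinant.det ?A = (\<Sum>p | p permutes {..<n}. of_int (sign p) * (\<Prod>i<n. ?A $$ (i, p i)))"
    by (subst det_def'[of _ n]) (simp_all add: atLeast0LessThan)
  also have "\<dots> = (\<Sum>p | p permutes UNIV. of_int (sign p) * (\<Prod>i\<in>UNIV. g $ i $ p i))"
  proof (rule sum.reindex_bij_witness[of _ "map_permutation UNIV ?f" "map_permutation {..<n} e"])
    fix p assume "p \<in> {p. p permutes {..<n}}"
    then have p: "p permutes {..<n}" by simp
    show "map_permutation UNIV ?f (map_permutation {..<n} e p) = p"
      by (rule map_permutation_compose_inv[OF e p]) (rule bij_betw_inv_into_left[OF e])
    show "map_permutation {..<n} e p \<in> {p. p permutes UNIV}" using map_permutation_permutes[OF e p] by simp
    have "(\<Prod>i\<in>UNIV. g $ i $ map_permutation {..<n} e p i) = (\<Prod>i<n. g $ e i $ map_permutation {..<n} e p (e i))"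
      by (rule prod.reindex_bij_betw[OF e, symmetric])
    also have "\<dots> = (\<Prod>i<n. ?A $$ (i, p i))"
    proof (rule prod.cong[OF refl])
      fix i assume i: "i \<in> {..<n}"
      then have "p i < n" using permutes_in_image[OF p, of i] by simp
      then show "g $ e i $ map_permutation {..<n} e p (e i) = ?A $$ (i, p i)"
        using map_permutation_apply[OF bij_betw_imp_inj_on[OF e] i, of p] i by simp
    qed
    finally show "of_int (sign (map_permutation {..<n} e p)) * (\<Prod>i\<in>UNIV. g $ i $ map_permutation {..<n} e p i)
        = of_int (sign p) * (\<Prod>i<n. ?A $$ (i, p i))"
      using sign_map_permutation[OF bij_betw_imp_inj_on[OF e] p] by simp
  next
    fix q :: "'n \<Rightarrow> 'n" assume "q \<in> {q. q permutes UNIV}"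
    then have q: "q permutes UNIV" by simp
    show "map_permutation {..<n} e (map_permutation UNIV ?f q) = q"
      by (rule map_permutation_compose_inv[OF f q]) (rule bij_betw_inv_into_right[OF e], simp)
    show "map_permutation UNIV ?f q \<in> {p. p permutes {..<n}}" using map_permutation_permutes[OF f q] by simp
  qed
  finally show ?thesis by (simp add: Determinants.det_def)
qed

text \<open>On polynomials, substituting X g' undoes substituting X g. The substitution is therefore
  injective and extends to rational functions.\<close>

lemma right_mult_exists:
  fixes g :: "('k::field, 'n::{finite, linorder}) sqmat"
  assumes "invertible g"
  shows "\<exists>h. field_hom h \<and> (\<forall>c. h (ratconst c) = ratconst c) \<and>
    (\<forall>i j. h (ratvar (i, j)) = (\<Sum>l\<in>UNIV. ratvar (i, l) * (ratconst (g $ l $ j) :: ('n \<times> 'n, 'k) ratfun)))"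
proof -
  obtain g' where g': "g' ** g = Finite_Cartesian_Product.mat 1" using assms by (auto simp: invertible_def)
  define S :: "('k, 'n) sqmat \<Rightarrow> (('n \<times> 'n \<Rightarrow>\<^sub>0 nat) \<Rightarrow>\<^sub>0 'k) \<Rightarrow> _" where
    "S g = peval pconst (\<lambda>(i, j). \<Sum>l\<in>UNIV. pvar (i, l) * pconst (g $ l $ j))" for g
  have c: "comm_ring_hom (pconst :: 'k \<Rightarrow> ('n \<times> 'n \<Rightarrow>\<^sub>0 nat) \<Rightarrow>\<^sub>0 'k)" by (rule comm_ring_hom_pconst)
  interpret c: comm_ring_hom "pconst :: 'k \<Rightarrow> ('n \<times> 'n \<Rightarrow>\<^sub>0 nat) \<Rightarrow>\<^sub>0 'k" by (rule c)
  interpret S: comm_ring_hom "S k" for k unfolding S_def by (rule comm_ring_hom_peval[OF c])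
  have Sc: "S g (pconst a) = pconst a" for g a
    unfolding S_def by (rule peval_pconst[of pconst, OF c.hom_zero c.hom_add])
  have Sv: "S g (pvar (i, j)) = (\<Sum>l\<in>UNIV. pvar (i, l) * pconst (g $ l $ j))" for g i j
    unfolding S_def by (subst peval_pvar[OF c]) simp
  have SS: "S g' (S g p) = p" for p
  proof (induct p rule: mpoly_induct)
    case (var v p)
    obtain i j where v: "v = (i, j)" by (cases v)
    have "S g' (S g (pvar (i, j))) = (\<Sum>l\<in>UNIV. pconst (g $ l $ j) * (\<Sum>q\<in>UNIV. pconst (g' $ q $ l) * pvar (i, q)))"
      by (simp add: Sv Sc S.hom_sum S.hom_mult mult.commute)
    also have "\<dots> = (\<Sum>q\<in>UNIV. (\<Sum>l\<in>UNIV. pconst (g $ l $ j) * pconst (g' $ q $ l)) * pvar (i, q))"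
      by (rule sum_mult_assoc)
    also have "\<dots> = (\<Sum>q\<in>UNIV. if q = j then pvar (i, q) else 0)"
    proof (rule sum.cong[OF refl])
      fix q
      have "(\<Sum>l\<in>UNIV. pconst (g $ l $ j) * pconst (g' $ q $ l)) = (pconst ((g' ** g) $ q $ j) :: ('n \<times> 'n \<Rightarrow>\<^sub>0 nat) \<Rightarrow>\<^sub>0 'k)"
        by (simp add: matrix_mult_entry c.hom_sum c.hom_mult mult.commute)
      also have "\<dots> = (if q = j then 1 else 0)" unfolding g' mat_one_entry by simp
      finally show "(\<Sum>l\<in>UNIV. pconst (g $ l $ j) * pconst (g' $ q $ l)) * pvar (i, q)
        = (if q = j then pvar (i, q) else 0 :: ('n \<times> 'n \<Rightarrow>\<^sub>0 nat) \<Rightarrow>\<^sub>0 'k)"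
        by simp
    qed
    also have "\<dots> = pvar (i, j)" by simp
    finally show ?case using var by (simp add: S.hom_mult v)
  qed (simp_all add: Sc S.hom_add)
  interpret t: comm_ring_hom "\<lambda>p :: ('n \<times> 'n \<Rightarrow>\<^sub>0 nat) \<Rightarrow>\<^sub>0 'k. Fract p 1" by (rule comm_ring_hom_to_fract)
  let ?x = "\<lambda>v. case v of (i, j) \<Rightarrow> \<Sum>l\<in>UNIV. ratvar (i, l) * (ratconst (g $ l $ j) :: ('n \<times> 'n, 'k) ratfun)"
  have x: "Fract (case v of (i, j) \<Rightarrow> \<Sum>l\<in>UNIV. pvar (i, l) * pconst (g $ l $ j)) 1 = ?x v" for v
    by (cases v) (simp only: prod.case t.hom_sum t.hom_mult ratconst_pconst ratvar_pvar)
  have "Fract (S g p) 1 = peval ratconst ?x p" for p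
    unfolding S_def peval_hom[OF comm_ring_hom_to_fract] x ratconst_pconst[symmetric] ..
  then have inj: "p = 0" if "peval ratconst ?x p = 0" for p
    using that SS[of p] Fract_eq_0_iff[of "S g p"] by simp
  show ?thesis
  proof (rule ratfun_eval[OF field_hom_ratconst, of ?x])
    show "peval ratconst ?x p = 0 \<Longrightarrow> p = 0" for p by (rule inj)
    fix H :: "('n \<times> 'n, 'k) ratfun \<Rightarrow> ('n \<times> 'n, 'k) ratfun"
    assume "field_hom H" "\<And>a. H (ratconst a) = ratconst a" "\<And>v. H (ratvar v) = ?x v"
    then show ?thesis by (intro exI[of _ H] conjI allI) simp_all
  qed
qed

definition right_mult :: "('k::field, 'n::{finite, linorder}) sqmat \<Rightarrow> ('n \<times> 'n, 'k) ratfun \<Rightarrow> ('n \<times> 'n, 'k) ratfun" where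
  "right_mult g = (SOME h. field_hom h \<and> (\<forall>c. h (ratconst c) = ratconst c) \<and>
    (\<forall>i j. h (ratvar (i, j)) = (\<Sum>l\<in>UNIV. ratvar (i, l) * ratconst (g $ l $ j))))"

lemma right_mult:
  fixes g :: "('k::field, 'n::{finite, linorder}) sqmat"
  assumes "invertible g"
  shows "field_hom (right_mult g)" "right_mult g (ratconst c) = ratconst c"
    "right_mult g (ratvar (i, j)) = (\<Sum>l\<in>UNIV. ratvar (i, l) * ratconst (g $ l $ j))"
  using someI_ex[OF right_mult_exists[OF assms]] unfolding right_mult_def by blast+

text \<open>\<open>right_mult h\<close> sends X to X h, and \<open>right_mult g\<close> sends this
  to X g h because it fixes the entries of h. So no reversal of the order occurs.\<close>

lemma right_mult_mult:
  fixes g h :: "('k::field, 'n::{finite, linorder}) sqmat"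
  assumes g: "invertible g" and h: "invertible h"
  shows "right_mult (g ** h) z = right_mult g (right_mult h z)"
proof (rule ratfun_hom_eqI[of "right_mult (g ** h)" "\<lambda>z. right_mult g (right_mult h z)"])
  note gh = invertible_mult[OF g h]
  interpret g: field_hom "right_mult g" by (rule right_mult(1)[OF g])
  interpret h: field_hom "right_mult h" by (rule right_mult(1)[OF h])
  interpret r: field_hom "ratconst :: 'k \<Rightarrow> ('n \<times> 'n, 'k) ratfun" by (rule field_hom_ratconst)
  show "field_hom (right_mult (g ** h))" by (rule right_mult(1)[OF gh])
  show "field_hom (\<lambda>z. right_mult g (right_mult h z))"
    by unfold_locales (simp_all add: g.hom_add h.hom_add g.hom_mult h.hom_mult)
  show "right_mult (g ** h) (ratconst a) = right_mult g (right_mult h (ratconst a))" for a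
    by (simp add: right_mult[OF g] right_mult[OF h] right_mult[OF gh])
  show "right_mult (g ** h) (ratvar v) = right_mult g (right_mult h (ratvar v))" for v
  proof -
    obtain i j where v: "v = (i, j)" by (cases v)
    have "right_mult g (right_mult h (ratvar v)) = (\<Sum>l\<in>UNIV. ratconst (h $ l $ j) * (\<Sum>p\<in>UNIV. ratconst (g $ p $ l) * ratvar (i, p)))"
      by (simp add: v right_mult[OF g] right_mult[OF h] g.hom_sum g.hom_mult mult.commute)
    also have "\<dots> = (\<Sum>p\<in>UNIV. (\<Sum>l\<in>UNIV. ratconst (h $ l $ j) * ratconst (g $ p $ l)) * ratvar (i, p))"
      by (rule sum_mult_assoc)
    also have "\<dots> = right_mult (g ** h) (ratvar v)"
      by (simp add: v right_mult[OF gh] matrix_mult_entry r.hom_sum r.hom_mult mult.commute)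
    finally show ?thesis ..
  qed
qed

lemma right_mult_one:
  "right_mult (Finite_Cartesian_Product.mat 1) z = (z :: ('n::{finite, linorder} \<times> 'n, 'k::field) ratfun)"
proof (rule ratfun_hom_eqI[of "right_mult (Finite_Cartesian_Product.mat 1)" "\<lambda>z. z"])
  let ?e = "Finite_Cartesian_Product.mat 1 :: ('k, 'n) sqmat"
  have e: "invertible ?e" by (simp add: invertible_def)
  show "field_hom (right_mult ?e)" by (rule right_mult(1)[OF e])
  show "field_hom (\<lambda>z :: ('n \<times> 'n, 'k) ratfun. z)" by unfold_locales simp_all
  show "right_mult ?e (ratconst a) = ratconst a" for a by (rule right_mult(2)[OF e])
  interpret r: field_hom "ratconst :: 'k \<Rightarrow> ('n \<times> 'n, 'k) ratfun" by (rule field_hom_ratconst)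
  show "right_mult ?e (ratvar v) = ratvar v" for v
  proof -
    obtain i j where v: "v = (i, j)" by (cases v)
    have "right_mult ?e (ratvar v) = (\<Sum>l\<in>UNIV. if l = j then ratvar (i, l) else 0)"
      unfolding v right_mult[OF e] mat_one_entry by (intro sum.cong) auto
    then show ?thesis by (simp add: v)
  qed
qed

lemma right_mult_inj:
  fixes g h :: "('k::field, 'n::{finite, linorder}) sqmat"
  assumes g: "invertible g" and h: "invertible h" and eq: "right_mult g = right_mult h"
  shows "g = h"
proof -
  interpret r: field_hom "ratconst :: 'k \<Rightarrow> ('n \<times> 'n, 'k) ratfun" by (rule field_hom_ratconst)
  have d: "ratdiff (i, l) (right_mult g (ratvar (i, j))) = ratconst (g $ l $ j)" if "invertible g" for g :: "('k, 'n) sqmat" and i l j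
  proof -
    have "ratdiff (i, l) (right_mult g (ratvar (i, j))) = (\<Sum>q\<in>UNIV. if q = l then ratconst (g $ q $ j) else 0)"
      unfolding right_mult[OF that] derivation_sum[OF ratdiff(1)] derivation_mult[OF ratdiff(1)] ratdiff
      by (intro sum.cong) auto
    then show ?thesis by simp
  qed
  have "ratconst (g $ l $ j) = (ratconst (h $ l $ j) :: ('n \<times> 'n, 'k) ratfun)" for l j
    using d[OF g, of l l j] d[OF h, of l l j] eq by simp
  then show ?thesis by (simp add: Finite_Cartesian_Product.vec_eq_iff)
qed

lemma GL_invertible: "g \<in> GL C \<Longrightarrow> invertible g"
  by (simp add: GL_def invertible_det_nz)

text \<open>Regularity of pulled-back functions has to be checked on generators only; this serves
  both directions of the comparison of GL with the Galois group.\<close>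

lemma regular_on_function_algebra:
  assumes gens: "\<And>s. s \<in> S \<Longrightarrow> regular_on H C T (\<lambda>x. s (f x))" and p: "p \<in> function_algebra C S"
  shows "regular_on H C T (\<lambda>x. p (f x))"
  using p
proof (induct rule: function_algebra.induct)
  case (const c)
  then show ?case unfolding regular_on_def using function_algebra.const[of c C T] by (intro bexI[of _ "\<lambda>_. c"]) auto
next
  case (add p q)
  then obtain p' q' where "p' \<in> function_algebra C T" "q' \<in> function_algebra C T"
    "\<forall>x\<in>H. p (f x) = p' x" "\<forall>x\<in>H. q (f x) = q' x" unfolding regular_on_def by blast
  then show ?case unfolding regular_on_def using function_algebra.add[of p' C T q'] by (intro bexI[of _ "\<lambda>x. p' x + q' x"]) auto
next
  case (mult p q)
  then obtain p' q' where "p' \<in> function_algebra C T" "q' \<in> function_algebra C T"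
    "\<forall>x\<in>H. p (f x) = p' x" "\<forall>x\<in>H. q (f x) = q' x" unfolding regular_on_def by blast
  then show ?case unfolding regular_on_def using function_algebra.mult[of p' C T q'] by (intro bexI[of _ "\<lambda>x. p' x * q' x"]) auto
qed (rule gens)

lemma regular_on_gen: "t \<in> T \<Longrightarrow> (\<And>x. x \<in> H \<Longrightarrow> f x = t x) \<Longrightarrow> regular_on H C T f"
  unfolding regular_on_def using function_algebra.gen[of t T C] by blast

context generic_extension
begin

lemma right_mult_galois:
  assumes g: "g \<in> GL (constants DY)"
  shows "right_mult g \<in> galois_group DX ratconst"
proof -
  note gi = GL_invertible[OF g]
  interpret g: field_hom "right_mult g" by (rule right_mult(1)[OF gi])
  obtain h where h: "g ** h = Finite_Cartesian_Product.mat 1" "h ** g = Finite_Cartesian_Product.mat 1"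
    using gi by (auto simp: invertible_def)
  then have hi: "invertible h" by (auto simp: invertible_def)
  have "right_mult g \<circ> right_mult h = id" "right_mult h \<circ> right_mult g = id"
    using right_mult_mult[OF gi hi] right_mult_mult[OF hi gi] by (simp_all add: fun_eq_iff h right_mult_one)
  then have "bij (right_mult g)" using o_bij by blast
  moreover have "right_mult g (DX z) = DX (right_mult g z)" for z
  proof (induct z rule: ratfun_induct)
    case (var v)
    obtain i j where v: "v = (i, j)" by (cases v)
    have c: "DX (ratconst (g $ l $ j)) = 0" for l using g by (simp add: DX GL_def constants_def)
    have "right_mult g (DX (ratvar v)) = (\<Sum>l\<in>UNIV. ratconst (ratvar (i, l, 0)) * (\<Sum>p\<in>UNIV. ratvar (l, p) * ratconst (g $ p $ j)))"
      by (simp add: v DX right_mult[OF gi] g.hom_sum g.hom_mult)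
    also have "\<dots> = (\<Sum>p\<in>UNIV. (\<Sum>l\<in>UNIV. ratconst (ratvar (i, l, 0)) * ratvar (l, p)) * ratconst (g $ p $ j))"
      by (rule sum_mult_assoc)
    also have "\<dots> = DX (right_mult g (ratvar v))"
      by (simp add: v right_mult[OF gi] derivation_sum[OF DX(1)] derivation_mult[OF DX(1)] c DX(3))
    finally show ?case .
  qed (simp_all add: DX right_mult[OF gi] derivation_add[OF DX(1)] derivation_mult[OF DX(1)] derivation_inverse[OF DX(1)]
      g.hom_add g.hom_mult g.hom_inverse g.hom_uminus)
  ultimately show ?thesis by (simp add: galois_group_def right_mult[OF gi])
qed

lemma galois_right_mult:
  assumes \<sigma>: "\<sigma> \<in> galois_group DX ratconst"
  shows "\<exists>g\<in>GL (constants DY). \<sigma> = right_mult g"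
proof -
  have hom: "field_hom \<sigma>" and \<sigma>D: "\<And>x. \<sigma> (DX x) = DX (\<sigma> x)" and \<sigma>c: "\<And>x. \<sigma> (ratconst x) = ratconst x"
    using \<sigma> by (auto simp: galois_group_def)
  interpret \<sigma>: field_hom \<sigma> by (rule hom)
  obtain Xi where Xi: "X ** Xi = Finite_Cartesian_Product.mat 1" "Xi ** X = Finite_Cartesian_Product.mat 1"
    using X_invertible by (auto simp: invertible_def)
  define M where "M = Xi ** map_matrix \<sigma> X"
  have XM: "map_matrix \<sigma> X = X ** M" by (simp add: M_def matrix_mul_assoc Xi)
  let ?A = "map_matrix ratconst diff_indet_matrix :: (('n \<times> 'n, ('n, 'f) diff_ratfun) ratfun, 'n) sqmat"
  have AX: "map_matrix DX X = ?A ** X"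
    by (simp add: Finite_Cartesian_Product.vec_eq_iff matrix_mult_entry X_def DX diff_indet_matrix_def)
  have "map_matrix \<sigma> ?A = ?A" by (simp add: Finite_Cartesian_Product.vec_eq_iff \<sigma>c)
  then have "?A ** (X ** M) = map_matrix \<sigma> (map_matrix DX X)"
    unfolding AX map_matrix_mult[OF hom] XM by simp
  also have "\<dots> = map_matrix DX (X ** M)"
    unfolding XM[symmetric] by (simp add: Finite_Cartesian_Product.vec_eq_iff \<sigma>D)
  also have "\<dots> = ?A ** X ** M + X ** map_matrix DX M" unfolding map_matrix_derivation_mult[OF DX(1)] AX ..
  finally have "X ** map_matrix DX M = 0" by (simp add: matrix_mul_assoc)
  then have "Xi ** (X ** map_matrix DX M) = Xi ** 0" by simp
  then have "map_matrix DX M = 0"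
    unfolding matrix_mul_assoc Xi by (simp add: Finite_Cartesian_Product.vec_eq_iff matrix_mult_entry)
  then have "map_matrix DX M $ i $ j = 0" for i j by simp
  then have "M $ i $ j \<in> constants DX" for i j by (simp add: constants_def)
  then have "\<forall>i j. \<exists>k. k \<in> constants DY \<and> M $ i $ j = ratconst k" unfolding constants_DX by blast
  then obtain g' where g': "\<And>i j. g' i j \<in> constants DY" "\<And>i j. M $ i $ j = ratconst (g' i j)" by metis
  define g :: "(('n, 'f) diff_ratfun, 'n) sqmat" where "g = (\<chi> i j. g' i j)"
  have Mg: "M = map_matrix ratconst g" by (simp add: Finite_Cartesian_Product.vec_eq_iff g_def g')
  have "invertible M" unfolding M_def
    by (intro invertible_mult invertible_map_matrix hom X_invertible) (use Xi in \<open>auto simp: invertible_def\<close>)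
  then have "ratconst (Determinants.det g) \<noteq> (0 :: ('n \<times> 'n, ('n, 'f) diff_ratfun) ratfun)"
    unfolding invertible_det_nz Mg det_map_matrix[OF field_hom_ratconst] .
  then have gGL: "g \<in> GL (constants DY)" by (auto simp: GL_def g_def g')
  note gi = GL_invertible[OF gGL]
  have "\<sigma> z = right_mult g z" for z
  proof (rule ratfun_hom_eqI[OF hom right_mult(1)[OF gi]])
    show "\<sigma> (ratconst a) = right_mult g (ratconst a)" for a by (simp add: \<sigma>c right_mult[OF gi])
    show "\<sigma> (ratvar v) = right_mult g (ratvar v)" for v
    proof -
      obtain i j where v: "v = (i, j)" by (cases v)
      have "\<sigma> (ratvar v) = map_matrix \<sigma> X $ i $ j" by (simp add: v X_def)
      then show ?thesis unfolding XM Mg by (simp add: matrix_mult_entry X_def v right_mult[OF gi])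
    qed
  qed
  then show ?thesis using gGL by blast
qed

context
  assumes alg_closed_D: "algebraically_closed_subfield (constants D)"
begin

lemma picard_vessiot: "picard_vessiot DY DX ratconst"
  unfolding picard_vessiot_def
proof (intro conjI)
  show "differential_extension DY DX ratconst"
    by (simp add: differential_extension_def DY(1) DX(1,2) field_hom_ratconst)
  show "algebraically_closed_subfield (constants DY)"
    unfolding constants_DY by (rule algebraically_closed_subfield_image[OF field_hom_ratconst alg_closed_D])
qed (use char_K fundamental constants_DX in blast)+

text \<open>The fundamental system is the first row of X, on which right multiplication by g acts
  through g itself.\<close>

lemma galois_matrix_right_mult:
  assumes g: "g \<in> GL (constants DY)"
  shows "galois_matrix DY ratconst n y (right_mult g) = Matrix.mat n n (\<lambda>(i, j). g $ index i $ index j)"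
proof -
  interpret P: fundamental_solutions DY DX ratconst n y a
    by unfold_locales (rule picard_vessiot fundamental_a)+
  let ?M = "galois_matrix DY ratconst n y (right_mult g)"
  note M = P.galois_matrix[OF right_mult_galois[OF g]]
  have "?M $$ (i, j) = g $ index i $ index j" if ij: "i < n" "j < n" for i j
  proof -
    have "right_mult g (y j) = (\<Sum>l\<in>UNIV. ratconst (g $ l $ index j) * ratvar (index 0, l))"
      by (simp add: y_def right_mult[OF GL_invertible[OF g]] mult.commute)
    also have "\<dots> = (\<Sum>i<n. ratconst (g $ index i $ index j) * y i)" unfolding y_def by (rule sum_index[symmetric])
    finally have "(\<Sum>i<n. ratconst (?M $$ (i, j) - g $ index i $ index j) * y i) = 0"
      unfolding M(2)[OF ij(2)] by (simp add: K.hom_minus left_diff_distrib sum_subtractf)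
    then have "?M $$ (i, j) - g $ index i $ index j = 0" by (rule y_indep) (rule ij)
    then show ?thesis by simp
  qed
  then show ?thesis using M(1) by (intro eq_matI) auto
qed

text \<open>Under \<open>right_mult\<close> the matrix entries and the inverse determinants on the
  two sides are the same functions up to the enumeration of indices, so the generators of both
  coordinate rings correspond.\<close>

lemma GL_galois_iso: "GL_galois_iso DY DX ratconst (constants DY) right_mult"
  unfolding GL_galois_iso_def
proof (intro conjI exI[of _ n] exI[of _ y] ballI allI)
  let ?H = "GL (constants DY) :: (('n, 'f) diff_ratfun, 'n) sqmat set" and ?G = "galois_group DX ratconst"
  have inj: "inj_on right_mult ?H" by (intro inj_onI right_mult_inj GL_invertible)
  then show bij: "bij_betw right_mult ?H ?G"
    unfolding bij_betw_def using right_mult_galois galois_right_mult by blast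
  show "right_mult (g ** h) = right_mult g \<circ> right_mult h" if "g \<in> ?H" "h \<in> ?H" for g h
    using right_mult_mult[OF that[THEN GL_invertible]] by (simp add: fun_eq_iff)
  show "fundamental_system DY DX ratconst n y" by (rule fundamental)
  fix f
  let ?S = "galois_coordinates DY ratconst n y" and ?T = "GL_coordinates :: ((('n, 'f) diff_ratfun, 'n) sqmat \<Rightarrow> _) set"
  have detg: "Determinant.det (galois_matrix DY ratconst n y (right_mult g)) = Determinants.det g" if "g \<in> ?H" for g
    unfolding galois_matrix_right_mult[OF that] by (rule det_reindex[OF index])
  show "regular_on ?G (constants DY) ?S f \<longleftrightarrow> regular_on ?H (constants DY) ?T (f \<circ> right_mult)"
  proof
    assume "regular_on ?G (constants DY) ?S f"
    then obtain p where p: "p \<in> function_algebra (constants DY) ?S" "\<forall>x\<in>?G. f x = p x" unfolding regular_on_def by blast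
    have "regular_on ?H (constants DY) ?T (\<lambda>g. p (right_mult g))"
    proof (rule regular_on_function_algebra[OF _ p(1)])
      fix t assume "t \<in> ?S"
      then consider i j where "i < n" "j < n" "t = (\<lambda>\<sigma>. galois_matrix DY ratconst n y \<sigma> $$ (i, j))"
        | "t = (\<lambda>\<sigma>. inverse (Determinant.det (galois_matrix DY ratconst n y \<sigma>)))"
        by (auto simp: galois_coordinates_def)
      then show "regular_on ?H (constants DY) ?T (\<lambda>g. t (right_mult g))"
      proof cases
        case 1
        show ?thesis by (rule regular_on_gen[of "\<lambda>g. g $ index i $ index j"])
          (use 1 in \<open>auto simp: GL_coordinates_def galois_matrix_right_mult\<close>)
      next
        case 2
        show ?thesis by (rule regular_on_gen[of "\<lambda>g. inverse (Determinants.det g)"])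
          (use 2 in \<open>auto simp: GL_coordinates_def detg\<close>)
      qed
    qed
    then show "regular_on ?H (constants DY) ?T (f \<circ> right_mult)"
      using p(2) right_mult_galois unfolding regular_on_def by simp
  next
    assume "regular_on ?H (constants DY) ?T (f \<circ> right_mult)"
    then obtain q where q: "q \<in> function_algebra (constants DY) ?T" "\<forall>g\<in>?H. f (right_mult g) = q g"
      unfolding regular_on_def by auto
    define \<gamma> where "\<gamma> = inv_into ?H right_mult"
    have \<gamma>: "\<gamma> \<sigma> \<in> ?H" "right_mult (\<gamma> \<sigma>) = \<sigma>" if "\<sigma> \<in> ?G" for \<sigma>
    proof -
      have "\<sigma> \<in> right_mult ` ?H" using that bij by (simp add: bij_betw_def)
      then show "\<gamma> \<sigma> \<in> ?H" "right_mult (\<gamma> \<sigma>) = \<sigma>" unfolding \<gamma>_def by (rule inv_into_into, rule f_inv_into_f)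
    qed
    have "regular_on ?G (constants DY) ?S (\<lambda>\<sigma>. q (\<gamma> \<sigma>))"
    proof (rule regular_on_function_algebra[OF _ q(1)])
      fix t assume "t \<in> ?T"
      then consider i j where "t = (\<lambda>g. g $ i $ j)" | "t = (\<lambda>g. inverse (Determinants.det g))"
        by (auto simp: GL_coordinates_def)
      then show "regular_on ?G (constants DY) ?S (\<lambda>\<sigma>. t (\<gamma> \<sigma>))"
      proof cases
        case 1
        show ?thesis
        proof (rule regular_on_gen[of "\<lambda>\<sigma>. galois_matrix DY ratconst n y \<sigma> $$ (pos i, pos j)"])
          show "(\<lambda>\<sigma>. galois_matrix DY ratconst n y \<sigma> $$ (pos i, pos j)) \<in> ?S"
            unfolding galois_coordinates_def using pos(1) by blast
          show "t (\<gamma> \<sigma>) = galois_matrix DY ratconst n y \<sigma> $$ (pos i, pos j)" if "\<sigma> \<in> ?G" for \<sigma>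
            using galois_matrix_right_mult[OF \<gamma>(1)[OF that]] by (simp add: \<gamma>(2)[OF that] 1 pos)
        qed
      next
        case 2
        show ?thesis
        proof (rule regular_on_gen[of "\<lambda>\<sigma>. inverse (Determinant.det (galois_matrix DY ratconst n y \<sigma>))"])
          show "t (\<gamma> \<sigma>) = inverse (Determinant.det (galois_matrix DY ratconst n y \<sigma>))" if "\<sigma> \<in> ?G" for \<sigma>
            using detg[OF \<gamma>(1)[OF that]] by (simp add: \<gamma>(2)[OF that] 2)
        qed (simp add: galois_coordinates_def)
      qed
    qed
    then obtain p where p: "p \<in> function_algebra (constants DY) ?S" "\<forall>\<sigma>\<in>?G. q (\<gamma> \<sigma>) = p \<sigma>"
      unfolding regular_on_def by blast
    have "f \<sigma> = p \<sigma>" if "\<sigma> \<in> ?G" for \<sigma>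
      using q(2) \<gamma>[OF that] p(2) that by metis
    then show "regular_on ?G (constants DY) ?S f" using p(1) unfolding regular_on_def by blast
  qed
qed

end

end

theorem theorem1:
  fixes D :: "'f::field_char_0 \<Rightarrow> 'f"
  assumes "derivation D"
    and "algebraically_closed_subfield (constants D)"
  shows
    "(let DY = diff_indet_derivation D;
          DX = matrix_derivation DY
                 (diff_indet_matrix :: (('n::{finite, linorder}, 'f) diff_ratfun, 'n) sqmat);
          C = ratconst ` constants D
      in picard_vessiot DY DX ratconst \<and>
         (\<exists>\<phi>. GL_galois_iso DY DX ratconst C \<phi> \<and>
              (\<forall>g\<in>GL C. \<forall>i j. \<phi> g (ratvar (i, j)) =
                 (\<Sum>l\<in>UNIV. ratvar (i, l) * ratconst (g $ l $ j)))))
     \<and>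
     (\<forall>(DE :: 'e::field \<Rightarrow> 'e) \<iota>.
        picard_vessiot D DE \<iota> \<and>
        (\<exists>\<phi> :: ('f, 'n) sqmat \<Rightarrow> _. GL_galois_iso D DE \<iota> (constants D) \<phi>) \<longrightarrow>
        (\<exists>A :: ('f, 'n) sqmat. obtained_by_specialization D DE \<iota> A))"
proof (intro conjI)
  obtain index :: "nat \<Rightarrow> 'n" where index: "bij_betw index {..<CARD('n)} UNIV"
    using ex_bij_betw_nat_finite[of "UNIV :: 'n set"] by (auto simp: atLeast0LessThan)
  interpret generic_extension D "CARD('n)" index
    by unfold_locales (use assms(1) index in simp_all)
  have "\<forall>g\<in>GL (constants DY). \<forall>i j. right_mult g (ratvar (i, j)) = (\<Sum>l\<in>UNIV. ratvar (i, l) * ratconst (g $ l $ j))"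
    using right_mult(3) GL_invertible by blast
  then show "let DY = diff_indet_derivation D;
          DX = matrix_derivation DY
                 (diff_indet_matrix :: (('n, 'f) diff_ratfun, 'n) sqmat);
          C = ratconst ` constants D
      in picard_vessiot DY DX ratconst \<and>
         (\<exists>\<phi>. GL_galois_iso DY DX ratconst C \<phi> \<and>
              (\<forall>g\<in>GL C. \<forall>i j. \<phi> g (ratvar (i, j)) =
                 (\<Sum>l\<in>UNIV. ratvar (i, l) * ratconst (g $ l $ j))))"
    \<comment> \<open>\<open>constants_DY\<close> identifies the copy of the constants of F with the
      constants of the differential field of the indeterminates, over which the isomorphism was
      constructed.\<close>
    unfolding Let_def DY_def[symmetric] DX_def[symmetric] constants_DY[symmetric]
    using picard_vessiot[OF assms(2)] GL_galois_iso[OF assms(2)] by blast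
qed (use specialization_of_generic_extension in blast)

end
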